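(* Let $k$ be a field, $n,d\ge 1$ integers, $S=k[x_1,\dots,x_n]$ and $\mathfrak m=(x_1,\dots,x_n)\subset S$. Let $\mathcal H^d_n$ be the hypersimplicial complex, let $A$ be the acyclic homogeneous matching on $\mathcal H^d_n$ consisting of the edges $C_{\mathbf a,J}\to C_{\mathbf a+\epsilon_{\min J},\,J\setminus\{\min J\}}$ for all $\mathbf a\in\mathbb N^n$ and $J\subseteq[n]$ with $2\le d-|\mathbf a|\le |J|-1$ and $\min J\le \operatorname{first}(\mathbf a)$, and let $\widetilde{\mathcal H}^d_n=(\mathcal H^d_n)_A$ be the corresponding Morse complex. Then $\widetilde{\mathcal H}^d_n$ supports a minimal linear cellular resolution of $\mathfrak m^d$ (i.e. the complex $\mathbb F_{\widetilde{\mathcal H}^d_n}$ is a minimal linear free resolution of $S/\mathfrak m^d$), and this resolution is isomorphic to the $L$-complex $L(\psi,d)$, where $F$ is the free $S$-module with basis $f_1,\dots,f_n$ and $\psi:F\to S$ is given by $\psi(f_i)=x_i$.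
   Context: **Conventions.** $\mathbb N=\{0,1,\dots\}$, $[n]=\{1,\dots,n\}$, $\epsilon_i$ is the $i$th unit vector, $|\mathbf a|=\sum_i a_i$. $\min J$ is the smallest element of $J$; $\operatorname{first}(\mathbf a)$ is the smallest index $i$ with $a_i\neq 0$ (with $\operatorname{first}(\mathbf 0)=+\infty$). **Hypersimplicial complex.** $\Delta(n,d)=\{y\in\mathbb R^n: \sum y_i=d,\ y_i\ge 0\}$. $\mathcal H^d_n$ is the polytopal (regular) CW-complex with underlying space $\Delta(n,d)$ whose closed cells are $$C_{\mathbf a,J}=\operatorname{conv}\Big(\mathbf a+\sum_{j\in J}\ell_j\epsilon_j \;\Big|\; \ell_j\in\{0,1\},\ \sum_{j\in J}\ell_j=d-|\mathbf a|\Big),$$ with $\mathbf a\in\mathbb N^n$, $J\subseteq[n]$, where either $|\mathbf a|=d$ and $J=\emptyset$ (the $0$-cells), or $1\le d-|\mathbf a|\le |J|-1$ (cells of dimension $|J|-1$). It is multigraded by $\operatorname{mdeg}(C_{\mathbf a,J})=\mathbf a+\sum_{j\in J}\epsilon_j$, identified with the corresponding monomial; the $0$-cell $C_{\mathbf a,\emptyset}$ is labeled by the generator $\mathbf x^{\mathbf a}$ of $\mathfrak m^d$. **Acyclic matchings.** For a regular CW-complex $X$, $G_X$ is the directed graph on the cells of $X$ with edges $c\to c'$ for $c'\subseteq c$, $\dim c'=\dim c-1$. A set $A$ of edges is an acyclic matching if each cell is in at most one edge of $A$ and the graph obtained from $G_X$ by reversing the edges of $A$ has no directed cycle. It is homogeneous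 if $\operatorname{mdeg}(c)=\operatorname{mdeg}(c')$ for all $c\to c'$ in $A$. Cells in no edge of $A$ are $A$-critical. **Morse complex.** For a homogeneous acyclic matching $A$, the Morse complex $X_A$ is the (not necessarily regular) CW-complex of Batzies–Welker, homotopy equivalent to $X$, whose $i$-cells are in bijection with the $A$-critical $i$-cells of $X$ and carry the same multidegrees. In its cellular chain complex, the coefficient of a critical $(i-1)$-cell $\sigma'$ in the boundary of a critical $i$-cell $\sigma$ is the sum, over all directed paths from $\sigma$ to $\sigma'$ in the graph $G_X$ with the edges of $A$ reversed that pass only through cells of dimensions $i$ and $i-1$, of the product of weights of the edges, where an unreversed edge $c\to c'$ has weight the incidence number $[c,c']$ and a reversed edge $c'\to c$ has weight $-[c,c']$. **Supporting a resolution.** For a multigraded CW-complex $X$ with $0$-cells labeled by the minimal generators of a monomial ideal $M$, $\mathbb F_X$ is the complex of free $S$-modules with a basis element $e_c$ of multidegree $\operatorname{mdeg}(c)$ in homological degree $\dim c+1$ for each cell $c$, and $e_\emptyset$ of multidegree $1$ in homological degree $0$, with differential $e_c\mapsto\sum_{c'}[c,c']\frac{\operatorname{mdeg}(c)}{\operatorname{mdeg}(c')}e_{c'}$, where $[c,c']$ are the coefficients of the augmented reduced cellular chain complex of $X$ over $k$. $X$ supports a cellular resolution of $M$ if $\mathbb F_X$ is a free resolution of $S/M$. **$L$-complex.** For a free $S$-module $F$ with basis $f_1,\dots,f_n$, let $S_b(F)$ be the $b$th symmetric power and $\kappa_{a,b}:\bigwedge^aF\otimes S_b(F)\to\bigwedge^{a-1}F\otimes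 S_{b+1}(F)$ the composite of comultiplication $\bigwedge^aF\to\bigwedge^{a-1}F\otimes F$ with multiplication $F\otimes S_b(F)\to S_{b+1}(F)$. Put $L^a_b(F)=\ker\kappa_{a,b}$. For $\psi:F\to S$ let $\mathrm{kos}^\psi:\bigwedge^aF\to\bigwedge^{a-1}F$ be the Koszul differential, $f_{j_1}\wedge\cdots\wedge f_{j_a}\mapsto\sum_i(-1)^i\psi(f_{j_i})f_{j_1}\wedge\cdots\widehat{f_{j_i}}\cdots\wedge f_{j_a}$. The $L$-complex $L(\psi,b)$ is $$0\to L^{n-1}_b(F)\xrightarrow{\mathrm{kos}^\psi\otimes1}\cdots\xrightarrow{\mathrm{kos}^\psi\otimes 1}L^0_b(F)=S_b(F)\xrightarrow{S_b(\psi)}S\to0,$$ with the maps $\mathrm{kos}^\psi\otimes1$ restricted to $L^a_b(F)\subseteq\bigwedge^aF\otimes S_b(F)$, $S_b(\psi)(f^\alpha)=\psi(f_1)^{\alpha_1}\cdots\psi(f_n)^{\alpha_n}$, $S$ in homological degree $0$. *)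

theory Defs
  imports
    "HOL-Analysis.Analysis"
    "HOL-Library.Poly_Mapping"
    "HOL-Library.Extended"
    "Jordan_Normal_Form.Determinant"
begin

text \<open>
  The index set \<open>[n]\<close> is a finite linearly ordered type \<open>'n\<close>, so \<open>n = CARD('n) \<ge> 1\<close>.
  Exponent vectors in \<open>\<nat>^n\<close> have type \<open>'n \<Rightarrow>\<^sub>0 nat\<close>, and the polynomial ring \<open>S = k[x_1, \<dots>, x_n]\<close> is
  the whole type \<open>('n \<Rightarrow>\<^sub>0 nat) \<Rightarrow>\<^sub>0 'k\<close> with its convolution product. The free \<open>S\<close>-module on a basis
  indexed by \<open>'b\<close> is \<open>'b \<Rightarrow>\<^sub>0 S\<close>.
\<close>

type_synonym 'n expo = "'n \<Rightarrow>\<^sub>0 nat"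
type_synonym ('n, 'k) mpol = "'n expo \<Rightarrow>\<^sub>0 'k"

abbreviation lookup :: "('a \<Rightarrow>\<^sub>0 'b::zero) \<Rightarrow> 'a \<Rightarrow> 'b"
  where "lookup \<equiv> Poly_Mapping.lookup"

abbreviation single :: "'a \<Rightarrow> 'b::zero \<Rightarrow> 'a \<Rightarrow>\<^sub>0 'b"
  where "single \<equiv> Poly_Mapping.single"

abbreviation keys :: "('a \<Rightarrow>\<^sub>0 'b::zero) \<Rightarrow> 'a set"
  where "keys \<equiv> Poly_Mapping.keys"

definition total :: "'n::finite expo \<Rightarrow> nat"
  where "total a = (\<Sum>i\<in>UNIV. lookup a i)"

definition first :: "'n::{finite,linorder} expo \<Rightarrow> 'n extended"
  where "first a = (if a = 0 then Pinf else Fin (Min (keys a)))"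


section \<open>Modules over a commutative ring\<close>

definition fscale :: "'s::comm_ring_1 \<Rightarrow> ('b \<Rightarrow>\<^sub>0 's) \<Rightarrow> 'b \<Rightarrow>\<^sub>0 's"
  where "fscale r f = Poly_Mapping.map ((*) r) f"

lemma lookup_fscale [simp]: "lookup (fscale r f) b = r * lookup f b"
  by (simp add: fscale_def Poly_Mapping.map.rep_eq when_def)

interpretation fmod: Modules.module "fscale :: 's::comm_ring_1 \<Rightarrow> ('b \<Rightarrow>\<^sub>0 's) \<Rightarrow> 'b \<Rightarrow>\<^sub>0 's"
  by standard (auto intro!: poly_mapping_eqI simp: lookup_add algebra_simps)

interpretation rmod: Modules.module "(*) :: 's::comm_ring_1 \<Rightarrow> 's \<Rightarrow> 's"
  by standard (auto simp: algebra_simps)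

definition free_on :: "'b set \<Rightarrow> ('b \<Rightarrow>\<^sub>0 's::comm_ring_1) set"
  where "free_on B = {f. keys f \<subseteq> B}"

definition is_free :: "('b \<Rightarrow>\<^sub>0 's::comm_ring_1) set \<Rightarrow> bool"
  where "is_free N \<longleftrightarrow> (\<exists>B. fmod.independent B \<and> fmod.span B = N)"

definition linear_between ::
    "('s \<Rightarrow> 'u \<Rightarrow> 'u) \<Rightarrow> ('s \<Rightarrow> 'v \<Rightarrow> 'v) \<Rightarrow> 'u::plus set \<Rightarrow> 'v::plus set \<Rightarrow> ('u \<Rightarrow> 'v) \<Rightarrow> bool"
  where "linear_between sc sc' N N' f \<longleftrightarrow>
    f ` N \<subseteq> N' \<and> (\<forall>x\<in>N. \<forall>y\<in>N. f (x + y) = f x + f y) \<and> (\<forall>r. \<forall>x\<in>N. f (sc r x) = sc' r (f x))"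

text \<open>The linear map sending the basis element \<open>b\<close> to \<open>g b\<close>.\<close>

definition lin_ext :: "('b \<Rightarrow> 'c \<Rightarrow>\<^sub>0 's::comm_ring_1) \<Rightarrow> ('b \<Rightarrow>\<^sub>0 's) \<Rightarrow> 'c \<Rightarrow>\<^sub>0 's"
  where "lin_ext g f = (\<Sum>b\<in>keys f. fscale (lookup f b) (g b))"

fun ideal_power :: "'s::comm_ring_1 set \<Rightarrow> nat \<Rightarrow> 's set"
  where
    "ideal_power I 0 = UNIV"
  | "ideal_power I (Suc e) = rmod.span {a * b |a b. a \<in> I \<and> b \<in> ideal_power I e}"

definition ideal_times_module :: "'s::comm_ring_1 set \<Rightarrow> ('b \<Rightarrow>\<^sub>0 's) set \<Rightarrow> ('b \<Rightarrow>\<^sub>0 's) set"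
  where "ideal_times_module I N = fmod.span {fscale r f |r f. r \<in> I \<and> f \<in> N}"

definition xvar :: "'n \<Rightarrow> ('n, 'k::field) mpol"
  where "xvar i = single (single i 1) 1"

definition max_ideal :: "('n, 'k::field) mpol set"
  where "max_ideal = rmod.span (range xvar)"

definition min_gens :: "('n, 'k::field) mpol set \<Rightarrow> 'n expo set"
  where "min_gens M = {u. single u 1 \<in> M \<and> (\<forall>v w. single v 1 \<in> M \<longrightarrow> u = v + w \<longrightarrow> v = u)}"


section \<open>Complexes of modules and resolutions\<close>

text \<open>Only the maps \<open>chain_diff C (Suc i) : chain_mod C (Suc i) \<rightarrow> chain_mod C i\<close> are meaningful.\<close>

record 'm chain =
  chain_mod :: "nat \<Rightarrow> 'm set"
  chain_diff :: "nat \<Rightarrow> 'm \<Rightarrow> 'm"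

text \<open>
  A free resolution of \<open>S/M\<close>. The augmentation \<open>chain_mod C 0 \<rightarrow> S/M\<close> is given by a linear map
  \<open>\<pi> : chain_mod C 0 \<rightarrow> S\<close>, followed by the projection \<open>S \<rightarrow> S/M\<close>. The composite has to be onto
  with kernel the image of \<open>chain_diff C 1\<close>.
\<close>

definition free_resolution ::
    "('b \<Rightarrow>\<^sub>0 's::comm_ring_1) chain \<Rightarrow> (('b \<Rightarrow>\<^sub>0 's) \<Rightarrow> 's) \<Rightarrow> 's set \<Rightarrow> bool"
  where "free_resolution C \<pi> M \<longleftrightarrow>
    (\<forall>i. is_free (chain_mod C i)) \<and>
    (\<forall>i. linear_between fscale fscale (chain_mod C (Suc i)) (chain_mod C i) (chain_diff C (Suc i))) \<and>
    (\<forall>i. chain_diff C (Suc (Suc i)) ` chain_mod C (Suc (Suc i)) = {f \<in> chain_mod C (Suc i). chain_diff C (Suc i) f = 0}) \<and>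
    linear_between fscale (*) (chain_mod C 0) UNIV \<pi> \<and>
    chain_diff C (Suc 0) ` chain_mod C (Suc 0) = {f \<in> chain_mod C 0. \<pi> f \<in> M} \<and>
    (\<forall>s. \<exists>f\<in>chain_mod C 0. s - \<pi> f \<in> M)"

definition minimal_complex :: "('b \<Rightarrow>\<^sub>0 ('n, 'k::field) mpol) chain \<Rightarrow> bool"
  where "minimal_complex C \<longleftrightarrow>
    (\<forall>i. chain_diff C (Suc i) ` chain_mod C (Suc i) \<subseteq> ideal_times_module max_ideal (chain_mod C i))"

definition chain_iso ::
    "('b \<Rightarrow>\<^sub>0 's::comm_ring_1) chain \<Rightarrow> ('c \<Rightarrow>\<^sub>0 's) chain \<Rightarrow> bool"
  where "chain_iso C D \<longleftrightarrow> (\<exists>\<phi>.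
    (\<forall>i. linear_between fscale fscale (chain_mod C i) (chain_mod D i) (\<phi> i) \<and> bij_betw (\<phi> i) (chain_mod C i) (chain_mod D i)) \<and>
    (\<forall>i. \<forall>f\<in>chain_mod C (Suc i). \<phi> i (chain_diff C (Suc i) f) = chain_diff D (Suc i) (\<phi> (Suc i) f)))"

text \<open>\<open>C\<close> is free on the homogeneous bases \<open>B i\<close> of multidegrees \<open>deg\<close>, with multihomogeneous differentials.\<close>

definition multigraded_free ::
    "('b \<Rightarrow>\<^sub>0 ('n, 'k::field) mpol) chain \<Rightarrow> (nat \<Rightarrow> 'b set) \<Rightarrow> ('b \<Rightarrow> 'n expo) \<Rightarrow> bool"
  where "multigraded_free C B deg \<longleftrightarrow>
    (\<forall>i. chain_mod C i = free_on (B i)) \<and>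
    (\<forall>i. \<forall>b\<in>B (Suc i). \<forall>b'. \<forall>m\<in>keys (lookup (chain_diff C (Suc i) (single b 1)) b'). m + deg b' = deg b)"

text \<open>
  Linearity for a resolution of \<open>S/M\<close> with \<open>M\<close> generated in degree \<open>d\<close>: for \<open>i \<ge> 1\<close>, the module in
  homological degree \<open>i\<close> is generated in total degree \<open>d + i - 1\<close>.
\<close>

definition linear_complex ::
    "('b \<Rightarrow>\<^sub>0 ('n::finite, 'k::field) mpol) chain \<Rightarrow> (nat \<Rightarrow> 'b set) \<Rightarrow> ('b \<Rightarrow> 'n expo) \<Rightarrow> nat \<Rightarrow> bool"
  where "linear_complex C B deg d \<longleftrightarrow>
    multigraded_free C B deg \<and> (\<forall>i. \<forall>b\<in>B (Suc i). total (deg b) = d + i)"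


section \<open>Multigraded polytopal complexes and their cellular incidence numbers\<close>

text \<open>Cells are given by an index type \<open>'c\<close>, with \<open>pol X c\<close> the closed cell indexed by \<open>c\<close>.\<close>

record ('c, 'v, 'n) polycomplex =
  cells :: "'c set"
  pol :: "'c \<Rightarrow> 'v set"
  mdeg :: "'c \<Rightarrow> 'n expo"

definition cdim :: "('c, 'v::euclidean_space, 'n) polycomplex \<Rightarrow> 'c \<Rightarrow> int"
  where "cdim X c = aff_dim (pol X c)"

text \<open>The edges \<open>c \<rightarrow> c'\<close> of the graph \<open>G_X\<close>.\<close>

definition face_graph :: "('c, 'v::euclidean_space, 'n) polycomplex \<Rightarrow> ('c \<times> 'c) set"
  where "face_graph X =
    {(c, c'). c \<in> cells X \<and> c' \<in> cells X \<and> pol X c' \<subseteq> pol X c \<and> cdim X c' = cdim X c - 1}"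

text \<open>
  An orientation of a cell is an ordered basis of the linear space parallel to its affine hull.
  For a 0-cell this is the empty list, so 0-cells carry their canonical orientation.
\<close>

definition oriented :: "('c, 'v::euclidean_space, 'n) polycomplex \<Rightarrow> ('c \<Rightarrow> 'v list) \<Rightarrow> bool"
  where "oriented X ori \<longleftrightarrow> (\<forall>c\<in>cells X. distinct (ori c) \<and> independent (set (ori c)) \<and>
    span (set (ori c)) = span {p - q |p q. p \<in> pol X c \<and> q \<in> pol X c})"

text \<open>Whether the ordered basis \<open>ws\<close> of \<open>span (set vs)\<close> is equi-oriented with \<open>vs\<close>: the sign of the
  determinant of the change of basis. \<open>Determinant.det\<close> is the determinant of \<open>m \<times> m\<close> matrices with \<open>m\<close> a natural number.\<close>

definition orientation_sign :: "'v::euclidean_space list \<Rightarrow> 'v list \<Rightarrow> int"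
  where "orientation_sign vs ws = (let m = length vs;
      D = Determinant.det (Matrix.mat m m (\<lambda>(i, j). representation (set vs) (ws ! j) (vs ! i)))
    in if D > 0 then 1 else if D < 0 then - 1 else 0)"

text \<open>
  The incidence number \<open>[c, c']\<close> for a facet \<open>c'\<close> of \<open>c\<close> compares the orientation of \<open>c\<close> with the
  orientation of \<open>c'\<close> preceded by a vector pointing out of \<open>c\<close> across \<open>c'\<close> (the result does not
  depend on that vector). For an edge this gives head minus tail.
\<close>

definition outward :: "('c, 'v::euclidean_space, 'n) polycomplex \<Rightarrow> 'c \<Rightarrow> 'c \<Rightarrow> 'v"
  where "outward X c c' =
    (SOME v. \<exists>p q. p \<in> pol X c' \<and> q \<in> pol X c \<and> q \<notin> affine hull (pol X c') \<and> v = p - q)"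

definition incidence ::
    "('c, 'v::euclidean_space, 'n) polycomplex \<Rightarrow> ('c \<Rightarrow> 'v list) \<Rightarrow> 'c \<Rightarrow> 'c \<Rightarrow> int"
  where "incidence X ori c c' =
    (if (c, c') \<in> face_graph X then orientation_sign (ori c) (outward X c c' # ori c') else 0)"


section \<open>Acyclic matchings and the Morse complex\<close>

definition reversed_graph ::
    "('c, 'v::euclidean_space, 'n) polycomplex \<Rightarrow> ('c \<times> 'c) set \<Rightarrow> ('c \<times> 'c) set"
  where "reversed_graph X A = (face_graph X - A) \<union> A\<inverse>"

definition acyclic_matching ::
    "('c, 'v::euclidean_space, 'n) polycomplex \<Rightarrow> ('c \<times> 'c) set \<Rightarrow> bool"
  where "acyclic_matching X A \<longleftrightarrow>
    A \<subseteq> face_graph X \<and>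
    (\<forall>e\<in>A. \<forall>e'\<in>A. {fst e, snd e} \<inter> {fst e', snd e'} \<noteq> {} \<longrightarrow> e = e') \<and>
    acyclic (reversed_graph X A)"

definition homogeneous_matching ::
    "('c, 'v::euclidean_space, 'n) polycomplex \<Rightarrow> ('c \<times> 'c) set \<Rightarrow> bool"
  where "homogeneous_matching X A \<longleftrightarrow> (\<forall>(c, c')\<in>A. mdeg X c = mdeg X c')"

definition critical :: "('c, 'v::euclidean_space, 'n) polycomplex \<Rightarrow> ('c \<times> 'c) set \<Rightarrow> nat \<Rightarrow> 'c set"
  where "critical X A i = {c \<in> cells X. cdim X c = int i \<and> c \<notin> Field A}"

text \<open>Directed paths, as lists of cells, from \<open>c\<close> to \<open>c'\<close> through cells of dimension \<open>dim c\<close> and \<open>dim c - 1\<close>.\<close>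

definition morse_paths ::
    "('c, 'v::euclidean_space, 'n) polycomplex \<Rightarrow> ('c \<times> 'c) set \<Rightarrow> 'c \<Rightarrow> 'c \<Rightarrow> 'c list set"
  where "morse_paths X A c c' = {p. p \<noteq> [] \<and> hd p = c \<and> last p = c' \<and>
    (\<forall>k. Suc k < length p \<longrightarrow> (p ! k, p ! Suc k) \<in> reversed_graph X A) \<and>
    (\<forall>q\<in>set p. cdim X q = cdim X c \<or> cdim X q = cdim X c - 1)}"

definition edge_weight ::
    "('c, 'v::euclidean_space, 'n) polycomplex \<Rightarrow> ('c \<Rightarrow> 'v list) \<Rightarrow> ('c \<times> 'c) set \<Rightarrow> 'c \<Rightarrow> 'c \<Rightarrow> int"
  where "edge_weight X ori A c c' =
    (if (c', c) \<in> A then - incidence X ori c' c else incidence X ori c c')"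

definition morse_incidence ::
    "('c, 'v::euclidean_space, 'n) polycomplex \<Rightarrow> ('c \<Rightarrow> 'v list) \<Rightarrow> ('c \<times> 'c) set \<Rightarrow> 'c \<Rightarrow> 'c \<Rightarrow> int"
  where "morse_incidence X ori A c c' =
    (\<Sum>p\<in>morse_paths X A c c'. \<Prod>k<length p - 1. edge_weight X ori A (p ! k) (p ! Suc k))"

text \<open>
  The cellular data of a multigraded CW-complex: its cells by dimension, their multidegrees, and the
  coefficients of the cellular boundary of an \<open>(i+1)\<close>-cell on the \<open>i\<close>-cells. A Morse complex is in
  general not regular; it enters through its cellular data.
\<close>

record ('c, 'n) cw_data =
  cw_cells :: "nat \<Rightarrow> 'c set"
  cw_mdeg :: "'c \<Rightarrow> 'n expo"
  cw_inc :: "'c \<Rightarrow> 'c \<Rightarrow> int"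

definition morse_complex ::
    "('c, 'v::euclidean_space, 'n) polycomplex \<Rightarrow> ('c \<Rightarrow> 'v list) \<Rightarrow> ('c \<times> 'c) set \<Rightarrow> ('c, 'n) cw_data"
  where "morse_complex X ori A =
    \<lparr>cw_cells = critical X A, cw_mdeg = mdeg X, cw_inc = morse_incidence X ori A\<rparr>"


section \<open>Cellular resolutions\<close>

text \<open>The basis element \<open>e_c\<close> is indexed by \<open>Some c\<close>, and \<open>e_\<emptyset>\<close> by \<open>None\<close>.\<close>

fun cell_basis :: "('c, 'n) cw_data \<Rightarrow> nat \<Rightarrow> 'c option set"
  where
    "cell_basis Y 0 = {None}"
  | "cell_basis Y (Suc i) = Some ` cw_cells Y i"

definition cell_deg :: "('c, 'n) cw_data \<Rightarrow> 'c option \<Rightarrow> 'n expo"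
  where "cell_deg Y b = (case b of None \<Rightarrow> 0 | Some c \<Rightarrow> cw_mdeg Y c)"

text \<open>The incidence numbers \<open>[v, \<emptyset>]\<close> of the augmented complex are 1.\<close>

definition aug_inc :: "('c, 'n) cw_data \<Rightarrow> 'c option \<Rightarrow> 'c option \<Rightarrow> int"
  where "aug_inc Y b b' = (case (b, b') of
      (Some c, Some c') \<Rightarrow> cw_inc Y c c'
    | (Some c, None) \<Rightarrow> 1
    | _ \<Rightarrow> 0)"

text \<open>The quotient of monomials \<open>mdeg(c)/mdeg(c')\<close> is written with the truncated difference
  of exponents; that it is exact whenever the coefficient is nonzero is part of \<open>multigraded_free\<close>.\<close>

definition cellular_complex ::
    "('c, 'n) cw_data \<Rightarrow> ('c option \<Rightarrow>\<^sub>0 ('n, 'k::field) mpol) chain"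
  where "cellular_complex Y = \<lparr>
    chain_mod = (\<lambda>i. free_on (cell_basis Y i)),
    chain_diff = (\<lambda>i. if i = 0 then (\<lambda>_. 0) else lin_ext (\<lambda>b. \<Sum>b'\<in>cell_basis Y (i - 1).
      single b' (single (cell_deg Y b - cell_deg Y b') (of_int (aug_inc Y b b')))))\<rparr>"

definition supports_cellular_resolution ::
    "('c, 'n) cw_data \<Rightarrow> ('n, 'k::field) mpol set \<Rightarrow> bool"
  where "supports_cellular_resolution Y M \<longleftrightarrow>
    bij_betw (cw_mdeg Y) (cw_cells Y 0) (min_gens M) \<and>
    multigraded_free (cellular_complex Y :: ('c option \<Rightarrow>\<^sub>0 ('n, 'k) mpol) chain) (cell_basis Y) (cell_deg Y) \<and>
    free_resolution (cellular_complex Y) (\<lambda>f. lookup f None) M"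


section \<open>The hypersimplicial complex\<close>

text \<open>Distinct admissible pairs \<open>(a, J)\<close> index distinct cells \<open>C_(a, J)\<close>.\<close>

type_synonym 'n hcell = "'n expo \<times> 'n set"

definition hyper_cell :: "nat \<Rightarrow> 'n::finite hcell \<Rightarrow> (real ^ 'n) set"
  where "hyper_cell d = (\<lambda>(a, J). convex hull
    {(\<chi> i. real (lookup a i)) + (\<Sum>j\<in>J. real (l j) *\<^sub>R axis j 1) |l :: 'n \<Rightarrow> nat.
      (\<forall>j\<in>J. l j \<in> {0, 1}) \<and> int (\<Sum>j\<in>J. l j) = int d - int (total a)})"

definition hypersimplicial :: "nat \<Rightarrow> ('n::finite hcell, real ^ 'n, 'n) polycomplex"
  where "hypersimplicial d = \<lparr>
    cells = {(a, J). total a = d \<and> J = {} \<or>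
      1 \<le> int d - int (total a) \<and> int d - int (total a) \<le> int (card J) - 1},
    pol = hyper_cell d,
    mdeg = (\<lambda>(a, J). a + (\<Sum>j\<in>J. single j 1))\<rparr>"

definition hyper_matching :: "nat \<Rightarrow> ('n::{finite,linorder} hcell \<times> 'n hcell) set"
  where "hyper_matching d = {((a, J), (a + single (Min J) 1, J - {Min J})) |a J.
    2 \<le> int d - int (total a) \<and> int d - int (total a) \<le> int (card J) - 1 \<and> Fin (Min J) \<le> first a}"


section \<open>The \<open>L\<close>-complex\<close>

text \<open>
  For \<open>F\<close> free on \<open>(f_i)\<close>, the module \<open>\<And>^a F \<otimes> S_b(F)\<close> is free on the elements
  \<open>f_J \<otimes> f^\<alpha>\<close> with \<open>card J = a\<close> and \<open>|\<alpha>| = b\<close>, where \<open>f_J\<close> is the wedge product of the \<open>f_j\<close>, \<open>j \<in> J\<close>, in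
  increasing order. This basis element is indexed by \<open>Some (J, \<alpha>)\<close>; the index \<open>None\<close> stands for the
  generator 1 of the module \<open>S\<close> in homological degree 0.
\<close>

type_synonym 'n lbasis = "('n set \<times> 'n expo) option"

definition wedge_sym :: "nat \<Rightarrow> nat \<Rightarrow> ('n::finite lbasis \<Rightarrow>\<^sub>0 's::comm_ring_1) set"
  where "wedge_sym a b = free_on {Some (J, \<alpha>) |J \<alpha>. card J = a \<and> total \<alpha> = b}"

text \<open>The comultiplication sends \<open>f_J\<close> to the sum of \<open>\<plusminus> f_(J - {j}) \<otimes> f_j\<close>, the sign coming from
  moving \<open>f_j\<close> to the right end.\<close>

definition kappa :: "('n::linorder lbasis \<Rightarrow>\<^sub>0 's::comm_ring_1) \<Rightarrow> 'n lbasis \<Rightarrow>\<^sub>0 's"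
  where "kappa = lin_ext (\<lambda>b. case b of
      None \<Rightarrow> 0
    | Some (J, \<alpha>) \<Rightarrow>
        \<Sum>j\<in>J. single (Some (J - {j}, \<alpha> + single j 1)) ((- 1) ^ card {l \<in> J. j < l}))"

definition L_module :: "nat \<Rightarrow> nat \<Rightarrow> ('n::{finite,linorder} lbasis \<Rightarrow>\<^sub>0 's::comm_ring_1) set"
  where "L_module a b = {f \<in> wedge_sym a b. kappa f = 0}"

text \<open>A linear map \<open>\<psi> : F \<rightarrow> S\<close> is given by its values \<open>\<psi> i\<close> on the basis elements \<open>f_i\<close>.\<close>

definition koszul_tensor_id ::
    "('n::linorder \<Rightarrow> 's::comm_ring_1) \<Rightarrow> ('n lbasis \<Rightarrow>\<^sub>0 's) \<Rightarrow> 'n lbasis \<Rightarrow>\<^sub>0 's"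
  where "koszul_tensor_id \<psi> = lin_ext (\<lambda>b. case b of
      None \<Rightarrow> 0
    | Some (J, \<alpha>) \<Rightarrow> \<Sum>j\<in>J. single (Some (J - {j}, \<alpha>)) ((- 1) ^ card {l \<in> J. l \<le> j} * \<psi> j))"

definition sym_power_map ::
    "('n::finite \<Rightarrow> 's::comm_ring_1) \<Rightarrow> ('n lbasis \<Rightarrow>\<^sub>0 's) \<Rightarrow> 'n lbasis \<Rightarrow>\<^sub>0 's"
  where "sym_power_map \<psi> = lin_ext (\<lambda>b. case b of
      None \<Rightarrow> 0
    | Some (J, \<alpha>) \<Rightarrow> if J = {} then single None (\<Prod>i\<in>UNIV. \<psi> i ^ lookup \<alpha> i) else 0)"

definition L_complex ::
    "('n::{finite,linorder} \<Rightarrow> 's::comm_ring_1) \<Rightarrow> nat \<Rightarrow> ('n lbasis \<Rightarrow>\<^sub>0 's) chain"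
  where "L_complex \<psi> b = \<lparr>
    chain_mod = (\<lambda>i. if i = 0 then free_on {None} else if i \<le> CARD('n) then L_module (i - 1) b else {0}),
    chain_diff = (\<lambda>i. if i = 0 then (\<lambda>_. 0) else if i = 1 then sym_power_map \<psi> else koszul_tensor_id \<psi>)\<rparr>"

end

theory Submission
  imports Defs
begin

text \<open>
  The critical cells are the vertices and the cells \<open>(a, K)\<close> with \<open>|a| = d - 1\<close> and \<open>min K \<le> first a\<close>.
  A gradient path from such a cell down to a critical cell either consists of a single facet
  \<open>(a, K - {j})\<close>, or it turns around exactly once, at the non-critical facet \<open>(a, K - {min K})\<close>.
  Sending \<open>(a, K)\<close> to \<open>\<plusminus> \<kappa>(f\<^sub>K \<otimes> f\<^sup>a)\<close> (and a vertex \<open>a\<close> to \<open>f\<^sup>a\<close>) therefore commutes with the differentials,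
  because the turning paths spell out the relation \<open>\<kappa> \<circ> \<kappa> = 0\<close>. The map is bijective onto \<open>ker \<kappa>\<close>: its
  inverse is the contraction of the Koszul complex of \<open>\<kappa>\<close> that moves the smallest index of the support
  from the symmetric to the exterior factor. Finally the \<open>L\<close>-complex is exact, by induction on the
  symmetric degree, since \<open>\<kappa>\<close> and the Koszul differential anticommute and are both exact.
\<close>

text \<open>The incidence numbers of the Morse complex are computed outright by listing all gradient
  paths, and exactness is then carried back from the \<open>L\<close>-complex along the isomorphism.
  Two obstacles shape the computation. Orientations are arbitrary and \<open>outward\<close> is an
  unspecified choice, so each cell is compared with the orientation given by its coordinates in
  increasing order; this sign, \<open>cell_sign\<close>, is the sign left open above. Every
  incidence number is then the \<open>cell_sign\<close> of both ends times \<open>rem_sign\<close>,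
  with opposite signs on the facets y_j = a_j and y_j = a_j + 1. Secondly, a vertex is a +
  \<epsilon>_k in several ways, whereas a critical cell has to name one pair (a, K); k is taken to
  be the smallest index of the support. With this convention all critical cells, vertices included,
  are the pairs with |a| = d - 1 and min K at most first a. The same pairs index the basis in which
  the contraction of \<open>symm_diff\<close> takes its values: matching and contraction follow one
  minimum rule, and this is why critical cells and kernel correspond. The field has any
  characteristic, so no sign argument divides by 2.\<close>

type_synonym ('n, 'k) L_elt = "'n lbasis \<Rightarrow>\<^sub>0 ('n, 'k) mpol"
type_synonym ('n, 'k) cell_elt = "'n hcell option \<Rightarrow>\<^sub>0 ('n, 'k) mpol"

section \<open>Linear maps between free modules\<close>

text \<open>The additive counterpart of \<open>lin_ext\<close>. The contraction
  \<open>coef_htpy\<close> below acts on single monomials of the coefficients, so it is additive but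
  not linear over S.\<close>

definition add_ext :: "('b \<Rightarrow> 's::ab_group_add \<Rightarrow> 'g::ab_group_add) \<Rightarrow> ('b \<Rightarrow>\<^sub>0 's) \<Rightarrow> 'g"
  where "add_ext g f = (\<Sum>b\<in>keys f. g b (lookup f b))"

lemma add_ext_eq_sum:
  assumes "\<And>b. g b 0 = 0" "finite K" "keys f \<subseteq> K"
  shows "add_ext g f = (\<Sum>b\<in>K. g b (lookup f b))"
  unfolding add_ext_def
  by (rule sum.mono_neutral_left) (use assms in \<open>auto simp: in_keys_iff\<close>)

lemma additive_add_ext:
  assumes "\<And>b. Modules.additive (g b)"
  shows "Modules.additive (add_ext g)"
proof
  fix x y :: "'a \<Rightarrow>\<^sub>0 'b"
  have 0: "\<And>b. g b 0 = 0"
    using assms Modules.additive.zero by blast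
  have "add_ext g (x + y) = (\<Sum>b\<in>keys x \<union> keys y. g b (lookup (x + y) b))"
    by (rule add_ext_eq_sum) (use 0 keys_add[of x y] in auto)
  also have "\<dots> = add_ext g x + add_ext g y"
    using 0 by (simp add: add_ext_eq_sum[of g "keys x \<union> keys y"] lookup_add
        Modules.additive.add[OF assms] sum.distrib)
  finally show "add_ext g (x + y) = add_ext g x + add_ext g y" .
qed

lemma add_ext_single: "g b 0 = 0 \<Longrightarrow> add_ext g (single b r) = g b r"
  by (simp add: add_ext_def)

lemma poly_mapping_sum_single: "f = (\<Sum>b\<in>keys f. single b (lookup f b))"
proof (rule poly_mapping_eqI)
  fix k
  have "lookup (\<Sum>b\<in>keys f. single b (lookup f b)) k = (\<Sum>b\<in>keys f. if b = k then lookup f b else 0)"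
    by (simp add: lookup_sum lookup_single when_def)
  then show "lookup f k = lookup (\<Sum>b\<in>keys f. single b (lookup f b)) k"
    by (auto simp: in_keys_iff)
qed

lemma additive_sum:
  assumes "Modules.additive F" shows "F (\<Sum>i\<in>I. f i) = (\<Sum>i\<in>I. F (f i))"
  using assms by (rule Modules.additive.sum)

lemma additive_eqI:
  fixes F G :: "('a \<Rightarrow>\<^sub>0 'b::ab_group_add) \<Rightarrow> 'c::ab_group_add"
  assumes "Modules.additive F" "Modules.additive G" "\<And>b. b \<in> keys f \<Longrightarrow> F (single b (lookup f b)) = G (single b (lookup f b))"
  shows "F f = G f"
proof -
  have *: "F' f = (\<Sum>b\<in>keys f. F' (single b (lookup f b)))" if "Modules.additive F'" for F' :: "('a \<Rightarrow>\<^sub>0 'b) \<Rightarrow> 'c"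
    by (subst poly_mapping_sum_single[of f]) (simp add: additive_sum[OF that])
  show ?thesis
    unfolding *[OF assms(1)] *[OF assms(2)] using assms(3) by simp
qed

lemma additive_compose: "Modules.additive F \<Longrightarrow> Modules.additive G \<Longrightarrow> Modules.additive (\<lambda>x. F (G x))"
  by (simp add: Modules.additive_def)

lemma additive_plus: "Modules.additive F \<Longrightarrow> Modules.additive G \<Longrightarrow> Modules.additive (\<lambda>x. F x + G x)"
  by (simp add: Modules.additive_def)

lemma additive_neg: "Modules.additive F \<Longrightarrow> Modules.additive (\<lambda>x. - F x)"
  by (simp add: Modules.additive_def)

lemma additive_ident: "Modules.additive (\<lambda>x. x)"
  by (simp add: Modules.additive_def)

lemma additive_const_zero: "Modules.additive (\<lambda>x. 0)"
  by (simp add: Modules.additive_def)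

lemma additive_single: "Modules.additive (single b)"
  by (simp add: Modules.additive_def single_add)

text \<open>For maps such as \<open>coef_htpy\<close>, additive but not linear over S, the
  coefficients have to be split into monomials as well.\<close>

lemma additive_double_eqI:
  fixes f :: "'b \<Rightarrow>\<^sub>0 ('c \<Rightarrow>\<^sub>0 'd::ab_group_add)"
  assumes "Modules.additive F" "Modules.additive G"
    and "\<And>b u c. b \<in> keys f \<Longrightarrow> F (single b (single u c)) = G (single b (single u c))"
  shows "F f = G f"
proof (rule additive_eqI[OF assms(1,2)])
  fix b :: 'b assume "b \<in> keys f"
  then show "F (single b (lookup f b)) = G (single b (lookup f b))"
    using additive_eqI[OF additive_compose[OF assms(1) additive_single]
        additive_compose[OF assms(2) additive_single], of "lookup f b" b b] assms(3) by blast
qed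

lemma lin_ext_eq_add_ext: "lin_ext g = add_ext (\<lambda>b r. fscale r (g b))"
  by (simp add: fun_eq_iff lin_ext_def add_ext_def)

lemma additive_lin_ext: "Modules.additive (lin_ext g)"
  unfolding lin_ext_eq_add_ext
  by (rule additive_add_ext) (simp add: Modules.additive_def fmod.scale_left_distrib)

lemmas lin_ext_add = Modules.additive.add[OF additive_lin_ext]
  and lin_ext_zero [simp] = Modules.additive.zero[OF additive_lin_ext]
  and lin_ext_sum = Modules.additive.sum[OF additive_lin_ext]

lemma lin_ext_eq_sum:
  assumes "finite K" "keys f \<subseteq> K"
  shows "lin_ext g f = (\<Sum>b\<in>K. fscale (lookup f b) (g b))"
  unfolding lin_ext_eq_add_ext by (rule add_ext_eq_sum) (use assms in auto)

lemma lin_ext_single [simp]: "lin_ext g (single b r) = fscale r (g b)"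
  unfolding lin_ext_eq_add_ext by (rule add_ext_single) simp

lemma fscale_single [simp]: "fscale r (single b s) = single b (r * s)"
  by (rule poly_mapping_eqI) (auto simp: lookup_single when_def)

lemma keys_fscale: "keys (fscale r f) \<subseteq> keys f"
  by (auto simp: in_keys_iff)

lemma lin_ext_fscale: "lin_ext g (fscale r f) = fscale r (lin_ext g f)"
  unfolding lin_ext_eq_sum[OF finite_keys keys_fscale[of r f]] lin_ext_def[of g f]
  by (simp add: fmod.scale_sum_right)

lemma lin_ext_cong:
  "(\<And>b. b \<in> keys f \<Longrightarrow> g b = h b) \<Longrightarrow> lin_ext g f = lin_ext h f"
  by (simp add: lin_ext_def)

lemma lin_ext_lin_ext: "lin_ext g (lin_ext h f) = lin_ext (\<lambda>b. lin_ext g (h b)) f"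
  unfolding lin_ext_def[of h f] lin_ext_def[of _ f] by (simp add: lin_ext_sum lin_ext_fscale)

lemma lin_ext_basis: "lin_ext (\<lambda>b. single b 1) f = f"
  by (simp add: lin_ext_def flip: poly_mapping_sum_single)

lemma mem_free_on: "f \<in> free_on B \<longleftrightarrow> keys f \<subseteq> B"
  by (simp add: free_on_def)

lemma free_on_zero [simp]: "0 \<in> free_on B"
  by (simp add: mem_free_on)

lemma free_on_add: "f \<in> free_on B \<Longrightarrow> g \<in> free_on B \<Longrightarrow> f + g \<in> free_on B"
  using keys_add[of f g] by (auto simp: mem_free_on)

lemma free_on_fscale: "f \<in> free_on B \<Longrightarrow> fscale r f \<in> free_on B"
  using keys_fscale[of r f] by (auto simp: mem_free_on)

lemma free_on_uminus: "f \<in> free_on B \<Longrightarrow> - f \<in> free_on B"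
  using free_on_fscale[of f B "- 1"] by (simp add: fmod.scale_minus_left)

lemma free_on_diff: "f \<in> free_on B \<Longrightarrow> g \<in> free_on B \<Longrightarrow> f - g \<in> free_on B"
  using free_on_add[of f B "- g"] free_on_uminus by force

lemma free_on_sum: "(\<And>i. i \<in> I \<Longrightarrow> f i \<in> free_on B) \<Longrightarrow> (\<Sum>i\<in>I. f i) \<in> free_on B"
  by (induction I rule: infinite_finite_induct) (auto intro: free_on_add)

lemma free_on_single: "b \<in> B \<Longrightarrow> single b r \<in> free_on B"
  by (simp add: mem_free_on)

lemma lin_ext_in_free_on:
  assumes "f \<in> free_on B" "\<And>b. b \<in> B \<Longrightarrow> g b \<in> free_on B'"
  shows "lin_ext g f \<in> free_on B'"
  unfolding lin_ext_def
  by (intro free_on_sum free_on_fscale) (use assms in \<open>auto simp: mem_free_on\<close>)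

lemma span_basis: "fmod.span ((\<lambda>b. single b 1) ` B) = (free_on B :: ('b \<Rightarrow>\<^sub>0 's::comm_ring_1) set)"
proof
  have "fmod.subspace (free_on B :: ('b \<Rightarrow>\<^sub>0 's) set)"
    by (auto intro!: fmod.subspaceI free_on_add free_on_fscale)
  then show "fmod.span ((\<lambda>b. single b 1) ` B) \<subseteq> (free_on B :: ('b \<Rightarrow>\<^sub>0 's) set)"
    by (intro fmod.span_minimal) (auto intro: free_on_single)
  show "free_on B \<subseteq> fmod.span ((\<lambda>b. single b (1::'s)) ` B)"
  proof
    fix f :: "'b \<Rightarrow>\<^sub>0 's" assume f: "f \<in> free_on B"
    have "(\<Sum>b\<in>keys f. fscale (lookup f b) (single b 1)) \<in> fmod.span ((\<lambda>b. single b (1::'s)) ` B)"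
      using f by (intro fmod.span_sum fmod.span_scale fmod.span_base) (auto simp: mem_free_on)
    then show "f \<in> fmod.span ((\<lambda>b. single b (1::'s)) ` B)"
      by (simp flip: poly_mapping_sum_single)
  qed
qed

lemma independent_basis: "fmod.independent ((\<lambda>b. single b (1::'s::comm_ring_1)) ` B)"
  unfolding fmod.independent_explicit_module
proof (intro allI impI)
  fix t u v
  assume t: "finite t" "t \<subseteq> (\<lambda>b. single b (1::'s)) ` B" and v: "v \<in> t"
    and 0: "(\<Sum>v\<in>t. fscale (u v) v) = 0"
  obtain b where b: "v = single b 1"
    using t v by auto
  have "0 = lookup (\<Sum>v\<in>t. fscale (u v) v) b"
    by (simp add: 0)
  also have "\<dots> = (\<Sum>w\<in>t. if w = v then u w else 0)"
    unfolding lookup_sum lookup_fscale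
  proof (rule sum.cong)
    fix w assume "w \<in> t"
    then obtain b' where b': "w = single b' 1"
      using t by auto
    then show "u w * lookup w b = (if w = v then u w else 0)"
      using b by (cases "b = b'") (auto simp: lookup_single when_def, metis lookup_single_eq lookup_single_not_eq zero_neq_one)
  qed simp
  also have "\<dots> = u v"
    using t v by simp
  finally show "u v = 0" by simp
qed

lemma is_free_free_on: "is_free (free_on B)"
  unfolding is_free_def using independent_basis span_basis by blast

declare One_nat_def [simp del]

section \<open>Two Koszul differentials\<close>

text \<open>The sign of moving f_j to the front of f_J. Both \<open>kappa\<close>, which moves f_j
  to the end, and the Koszul map, which counts j itself, are renormalised to this one.\<close>

definition rem_sign :: "'n::linorder set \<Rightarrow> 'n \<Rightarrow> 's::comm_ring_1"
  where "rem_sign J j = (- 1) ^ card {l \<in> J. l < j}"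

lemma rem_sign_cases:
  "rem_sign J j = 1 \<or> rem_sign J j = - 1"
  unfolding rem_sign_def by (metis neg_one_even_power neg_one_odd_power)

lemma of_int_rem_sign [simp]: "of_int (rem_sign J j) = rem_sign J j"
  by (simp add: rem_sign_def)

lemma rem_sign_Min:
  assumes "\<And>l. l \<in> J \<Longrightarrow> m \<le> l"
  shows "rem_sign J m = 1"
proof -
  have *: "{l \<in> J. l < m} = {}" using assms by force
  show ?thesis unfolding rem_sign_def * by simp
qed

lemma rem_sign_insert_less:
  assumes "finite J" "m \<notin> J" "m < j"
  shows "rem_sign (insert m J) j = - rem_sign J j"
proof -
  have "{l \<in> insert m J. l < j} = insert m {l \<in> J. l < j}" using assms by auto
  with assms show ?thesis by (simp add: rem_sign_def)
qed

lemma rem_sign_insert_ge: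
  assumes "j \<le> m"
  shows "rem_sign (insert m J) j = rem_sign J j"
proof -
  have "{l \<in> insert m J. l < j} = {l \<in> J. l < j}" using assms by auto
  then show ?thesis by (simp add: rem_sign_def)
qed

text \<open>The sign of the larger index changes when the smaller one has been removed before it;
  the sign of the smaller index is the same in both orders.\<close>

lemma rem_sign_swap:
  assumes "finite J" "j \<in> J" "l \<in> J" "j \<noteq> l"
  shows "rem_sign J j * rem_sign (J - {j}) l = - (rem_sign J l * rem_sign (J - {l}) j)"
proof -
  have *: "rem_sign J a * rem_sign (J - {a}) b = - (rem_sign J b * rem_sign (J - {b}) a :: 'b)"
    if "a \<in> J" "b \<in> J" "a < b" for a b
  proof -
    have "rem_sign (insert a (J - {a})) b = - (rem_sign (J - {a}) b :: 'b)"
      by (rule rem_sign_insert_less) (use assms that in auto)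
    moreover have "rem_sign (insert b (J - {b})) a = (rem_sign (J - {b}) a :: 'b)"
      by (rule rem_sign_insert_ge) (use assms that in auto)
    ultimately show ?thesis using that by (simp add: insert_absorb mult.commute)
  qed
  show ?thesis
    using *[of j l] *[of l j] assms by (cases j l rule: linorder_cases) auto
qed

text \<open>\<open>rem_sign_swap\<close> summed over ordered pairs. No symmetry of \<open>g\<close>
  is assumed, as fits two different differentials that anticommute.\<close>

lemma sum_rem_sign_swap:
  fixes g :: "'n::linorder \<Rightarrow> 'n \<Rightarrow> 'b \<Rightarrow>\<^sub>0 's::comm_ring_1"
  assumes "finite J"
  shows "(\<Sum>j\<in>J. fscale (rem_sign J j) (\<Sum>l\<in>J - {j}. fscale (rem_sign (J - {j}) l) (g j l))) =
    - (\<Sum>l\<in>J. fscale (rem_sign J l) (\<Sum>j\<in>J - {l}. fscale (rem_sign (J - {l}) j) (g j l)))"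
proof -
  have *: "J - {j} = {l \<in> J. l \<noteq> j}" "J - {j} = {l \<in> J. j \<noteq> l}" for j by auto
  have "(\<Sum>j\<in>J. fscale (rem_sign J j) (\<Sum>l\<in>J - {j}. fscale (rem_sign (J - {j}) l) (g j l))) =
      (\<Sum>j\<in>J. \<Sum>l\<in>{l \<in> J. l \<noteq> j}. fscale (rem_sign J j * rem_sign (J - {j}) l) (g j l))"
    by (simp add: fmod.scale_sum_right flip: *(1))
  also have "\<dots> = (\<Sum>l\<in>J. \<Sum>j\<in>{j \<in> J. l \<noteq> j}. fscale (rem_sign J j * rem_sign (J - {j}) l) (g j l))"
    by (rule sum.swap_restrict) (use assms in auto)
  also have "\<dots> = (\<Sum>l\<in>J. \<Sum>j\<in>J - {l}. fscale (- (rem_sign J l * rem_sign (J - {l}) j)) (g j l))"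
    unfolding *(2)[symmetric]
  proof (intro sum.cong arg_cong2[of _ _ _ _ fscale] refl)
    fix l j assume "l \<in> J" "j \<in> J - {l}"
    then show "rem_sign J j * rem_sign (J - {j}) l = - (rem_sign J l * rem_sign (J - {l}) j :: 's)"
      by (intro rem_sign_swap) (use assms in auto)
  qed
  finally show ?thesis
    by (simp add: fmod.scale_sum_right fmod.scale_minus_left sum_negf)
qed

lemma Diff_swap: "A - {a} - {b} = A - {b} - {a}"
  by auto

lemma add_single_diff_single: "(u :: 'n expo) + single j 1 - single j 1 = u"
  by (intro poly_mapping_eqI) (simp add: lookup_add lookup_minus)

text \<open>The abstract contraction: in each multidegree \<open>J + u\<close>, the smallest element \<open>m\<close> of the support
  is fixed, and \<open>H\<close> moves \<open>m\<close> from the symmetric to the exterior factor.\<close>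

lemma koszul_contraction:
  fixes e :: "'n::{finite,linorder} set \<Rightarrow> 'n expo \<Rightarrow> 'b \<Rightarrow>\<^sub>0 's::comm_ring_1"
  assumes D: "Modules.additive D" "\<And>J u. D (e J u) = (\<Sum>j\<in>J. fscale (rem_sign J j) (e (J - {j}) (u + single j 1)))"
    and H: "Modules.additive H"
      "\<And>J u. H (e J u) = (if J = {} \<and> u = 0 \<or> Min (J \<union> keys u) \<in> J then 0
        else e (insert (Min (J \<union> keys u)) J) (u - single (Min (J \<union> keys u)) 1))"
    and nz: "J \<noteq> {} \<or> u \<noteq> 0"
  shows "D (H (e J u)) + H (D (e J u)) = e J u"
proof -
  define m where "m = Min (J \<union> keys u)"
  have fin: "finite J" by simp
  have ne: "J \<union> keys u \<noteq> {}" using nz by auto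
  have m_in: "m \<in> J \<union> keys u" unfolding m_def by (rule Min_in) (use ne in auto)
  have m_le: "m \<le> l" if "l \<in> J \<union> keys u" for l unfolding m_def by (rule Min_le) (use that in auto)
  \<comment> \<open>\<open>coef_htpy\<close> commutes with signs but not with general coefficients,
    so only signs are pulled through \<open>H\<close>.\<close>
  have Hsgn: "H (fscale (rem_sign K j) x) = fscale (rem_sign K j) (H x)" for K j x
  proof -
    have "rem_sign K j = (1::'s) \<or> rem_sign K j = (- 1::'s)" by (rule rem_sign_cases)
    then show ?thesis using Modules.additive.minus[OF H(1)] by (auto simp: fmod.scale_minus_left)
  qed
  have keys_plus: "keys (u + single j 1) = insert j (keys u)" for j
    by (auto simp: in_keys_iff lookup_add lookup_single when_def split: if_splits)
  \<comment> \<open>Moving j from the exterior to the symmetric factor preserves the union of the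
    supports, so \<open>m\<close> stays the same along \<open>D\<close>.\<close>
  have min_j: "Min ((J - {j}) \<union> keys (u + single j 1)) = m" if "j \<in> J" for j
  proof -
    have "(J - {j}) \<union> keys (u + single j 1) = J \<union> keys u" using that unfolding keys_plus by auto
    then show ?thesis by (simp add: m_def)
  qed
  have nz_j: "u + single j 1 \<noteq> 0" for j
    using keys_plus[of j] by auto
  have HD: "H (D (e J u)) = (\<Sum>j\<in>J. fscale (rem_sign J j)
      (if m \<in> J - {j} then 0 else e (insert m (J - {j})) (u + single j 1 - single m 1)))"
    unfolding D(2) additive_sum[OF H(1)] Hsgn H(2)
    by (intro sum.cong refl) (simp add: min_j nz_j del: Un_insert_right One_nat_def)
  show ?thesis
  proof (cases "m \<in> J")
    case True
    have "H (e J u) = 0" unfolding H(2) using True by (simp add: m_def)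
    \<comment> \<open>A summand with j other than \<open>m\<close> still contains \<open>m\<close>
      and is killed by \<open>H\<close>; in the one with j = m, \<open>H\<close> moves
      \<open>m\<close> straight back.\<close>
    moreover have "H (D (e J u)) = (\<Sum>j\<in>J. if j = m then fscale (rem_sign J m) (e J u) else 0)"
      unfolding HD
      by (intro sum.cong refl) (use True in \<open>auto simp: insert_absorb\<close>)
    moreover have "rem_sign J m = (1 :: 's)" by (rule rem_sign_Min) (use m_le in auto)
    ultimately show ?thesis using True Modules.additive.zero[OF D(1)] by simp
  next
    case False
    have um: "m \<in> keys u" using m_in False by auto
    have uadd: "u - single m 1 + single j 1 = u + single j 1 - single m 1" for j
      using um by (intro poly_mapping_eqI) (auto simp: lookup_add lookup_minus lookup_single when_def in_keys_iff)
    have "H (e J u) = e (insert m J) (u - single m 1)"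
      unfolding H(2) using False nz by (auto simp: m_def)
    then have "D (H (e J u)) = (\<Sum>j\<in>insert m J. fscale (rem_sign (insert m J) j)
        (e (insert m J - {j}) (u + single j 1 - single m 1)))"
      by (simp add: D(2) uadd)
    \<comment> \<open>The summand at \<open>m\<close> undoes \<open>H\<close>. The others will
      cancel against \<open>H (D (e J u))\<close>, because inserting \<open>m\<close> below j flips
      the sign.\<close>
    also have "\<dots> = e J u + (\<Sum>j\<in>J. fscale (rem_sign (insert m J) j)
        (e (insert m J - {j}) (u + single j 1 - single m 1)))"
    proof -
      have "rem_sign (insert m J) m = (1 :: 's)" by (rule rem_sign_Min) (use m_le in auto)
      then show ?thesis using False um by (auto simp: add_single_diff_single)
    qed
    also have "(\<Sum>j\<in>J. fscale (rem_sign (insert m J) j)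
        (e (insert m J - {j}) (u + single j 1 - single m 1))) = - H (D (e J u))"
      unfolding HD sum_negf[symmetric]
    proof (intro sum.cong refl)
      fix j assume j: "j \<in> J"
      then have "m < j" using m_le[of j] False by (metis UnI1 order_le_less)
      moreover have "insert m J - {j} = insert m (J - {j})" using j False by auto
      ultimately show "fscale (rem_sign (insert m J) j) (e (insert m J - {j}) (u + single j 1 - single m 1)) =
          - fscale (rem_sign J j) (if m \<in> J - {j} then 0 else e (insert m (J - {j})) (u + single j 1 - single m 1))"
        using False by (simp add: rem_sign_insert_less fmod.scale_minus_left)
    qed
    finally show ?thesis by simp
  qed
qed

text \<open>Up to sign these are \<open>kappa\<close> and the Koszul map of the \<open>L\<close>-complex; with the signs normalised to
  \<open>rem_sign\<close> they anticommute.\<close>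

definition symm_diff :: "('n::linorder lbasis \<Rightarrow>\<^sub>0 's::comm_ring_1) \<Rightarrow> 'n lbasis \<Rightarrow>\<^sub>0 's"
  where "symm_diff = lin_ext (\<lambda>b. case b of None \<Rightarrow> 0
    | Some (J, \<alpha>) \<Rightarrow> \<Sum>j\<in>J. single (Some (J - {j}, \<alpha> + single j 1)) (rem_sign J j))"

definition coef_diff :: "('n::linorder lbasis \<Rightarrow>\<^sub>0 ('n, 'k::field) mpol) \<Rightarrow> ('n, 'k) L_elt"
  where "coef_diff = lin_ext (\<lambda>b. case b of None \<Rightarrow> 0
    | Some (J, \<alpha>) \<Rightarrow> \<Sum>j\<in>J. single (Some (J - {j}, \<alpha>)) (rem_sign J j * xvar j))"

abbreviation basis_elt :: "'n set \<Rightarrow> 'n expo \<Rightarrow> 'n lbasis \<Rightarrow>\<^sub>0 's::comm_ring_1"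
  where "basis_elt J \<alpha> \<equiv> single (Some (J, \<alpha>)) 1"

lemma symm_diff_single:
  "symm_diff (single (Some (J, \<alpha>)) r) = (\<Sum>j\<in>J. fscale (rem_sign J j) (single (Some (J - {j}, \<alpha> + single j 1)) r))"
  unfolding symm_diff_def lin_ext_single option.case prod.case fmod.scale_sum_right fscale_single
  by (simp only: mult.commute mult_1_right)

lemma coef_diff_single:
  "coef_diff (single (Some (J, \<alpha>)) r) = (\<Sum>j\<in>J. fscale (rem_sign J j) (single (Some (J - {j}, \<alpha>)) (xvar j * r)))"
  unfolding coef_diff_def lin_ext_single option.case prod.case fmod.scale_sum_right fscale_single
  by (simp only: mult.commute mult.left_commute)

lemma symm_diff_None [simp]: "symm_diff (single None r) = 0"
  by (simp add: symm_diff_def)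

lemma coef_diff_None [simp]: "coef_diff (single None r) = 0"
  by (simp add: coef_diff_def)

lemma additive_symm_diff: "Modules.additive symm_diff"
  unfolding symm_diff_def by (rule additive_lin_ext)

lemmas symm_diff_diff = Modules.additive.diff[OF additive_symm_diff]
  and symm_diff_minus = Modules.additive.minus[OF additive_symm_diff]
  and symm_diff_sum = Modules.additive.sum[OF additive_symm_diff]
  and symm_diff_zero = Modules.additive.zero[OF additive_symm_diff]

lemma additive_coef_diff: "Modules.additive coef_diff"
  unfolding coef_diff_def by (rule additive_lin_ext)

lemmas coef_diff_diff = Modules.additive.diff[OF additive_coef_diff]
  and coef_diff_minus = Modules.additive.minus[OF additive_coef_diff]
  and coef_diff_sum = Modules.additive.sum[OF additive_coef_diff]
  and coef_diff_zero = Modules.additive.zero[OF additive_coef_diff]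

lemma symm_diff_fscale: "symm_diff (fscale r f) = fscale r (symm_diff f)"
  unfolding symm_diff_def by (rule lin_ext_fscale)

lemma coef_diff_fscale: "coef_diff (fscale r f) = fscale r (coef_diff f)"
  unfolding coef_diff_def by (rule lin_ext_fscale)

text \<open>Removing j for one differential and l for the other meets opposite signs in the two
  orders, while the exponents produced are the same.\<close>

lemma symm_diff_coef_diff:
  fixes f :: "'n::{finite,linorder} lbasis \<Rightarrow>\<^sub>0 ('n, 'k::field) mpol"
  shows "symm_diff (coef_diff f) = - coef_diff (symm_diff f)"
proof (rule additive_eqI[where F = "\<lambda>f. symm_diff (coef_diff f)" and G = "\<lambda>f. - coef_diff (symm_diff f)"])
  fix b :: "'n lbasis"
  show "symm_diff (coef_diff (single b (lookup f b))) = - coef_diff (symm_diff (single b (lookup f b)))"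
  proof (cases b)
    case (Some c)
    obtain J \<alpha> where c: "c = (J, \<alpha>)" by (cases c)
    have "symm_diff (coef_diff (single b (lookup f b))) =
       (\<Sum>j\<in>J. fscale (rem_sign J j) (\<Sum>l\<in>J - {j}. fscale (rem_sign (J - {j}) l)
          (single (Some (J - {j} - {l}, \<alpha> + single l 1)) (xvar j * lookup f b))))"
      unfolding Some c coef_diff_single symm_diff_sum symm_diff_fscale symm_diff_single ..
    also have "\<dots> = - (\<Sum>l\<in>J. fscale (rem_sign J l) (\<Sum>j\<in>J - {l}. fscale (rem_sign (J - {l}) j)
          (single (Some (J - {j} - {l}, \<alpha> + single l 1)) (xvar j * lookup f b))))"
      by (rule sum_rem_sign_swap) simp
    also have "\<dots> = - coef_diff (symm_diff (single b (lookup f b)))"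
      unfolding Some c symm_diff_single coef_diff_sum coef_diff_fscale coef_diff_single
      by (intro arg_cong[of _ _ uminus] sum.cong arg_cong2[of _ _ _ _ fscale] refl)
        (subst Diff_swap, rule refl)
    finally show ?thesis .
  qed (simp add: symm_diff_zero coef_diff_zero)
qed (rule additive_compose[OF additive_symm_diff additive_coef_diff]
    additive_neg[OF additive_compose[OF additive_coef_diff additive_symm_diff]])+


text \<open>The pair (j, l) cancels against (l, j). Putting symmetric \<open>g\<close> into
  \<open>sum_rem_sign_swap\<close> would only give x = - x, which says nothing in characteristic 2;
  hence the split into j < l and l < j.\<close>

lemma sum_rem_sign_zero:
  fixes g :: "'n::linorder \<Rightarrow> 'n \<Rightarrow> 'b \<Rightarrow>\<^sub>0 's::comm_ring_1"
  assumes "finite J" "\<And>j l. j \<in> J \<Longrightarrow> l \<in> J \<Longrightarrow> g j l = g l j"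
  shows "(\<Sum>j\<in>J. fscale (rem_sign J j) (\<Sum>l\<in>J - {j}. fscale (rem_sign (J - {j}) l) (g j l))) = 0"
proof -
  let ?t = "\<lambda>j l. fscale (rem_sign J j * rem_sign (J - {j}) l) (g j l)"
  have split: "J - {j} = {l \<in> J. j < l} \<union> {l \<in> J. l < j}" for j by auto
  have "(\<Sum>j\<in>J. fscale (rem_sign J j) (\<Sum>l\<in>J - {j}. fscale (rem_sign (J - {j}) l) (g j l))) =
      (\<Sum>j\<in>J. \<Sum>l\<in>J - {j}. ?t j l)"
    by (simp add: fmod.scale_sum_right)
  also have "\<dots> = (\<Sum>j\<in>J. (\<Sum>l\<in>{l \<in> J. j < l}. ?t j l) + (\<Sum>l\<in>{l \<in> J. l < j}. ?t j l))"
    by (intro sum.cong refl, subst split, rule sum.union_disjoint) (use assms in auto)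
  also have "\<dots> = (\<Sum>j\<in>J. \<Sum>l\<in>{l \<in> J. j < l}. ?t j l) + (\<Sum>j\<in>J. \<Sum>l\<in>{l \<in> J. l < j}. ?t j l)"
    by (rule sum.distrib)
  also have "(\<Sum>j\<in>J. \<Sum>l\<in>{l \<in> J. l < j}. ?t j l) = (\<Sum>l\<in>J. \<Sum>j\<in>{j \<in> J. l < j}. ?t j l)"
    by (rule sum.swap_restrict) (use assms in auto)
  also have "\<dots> = (\<Sum>l\<in>J. \<Sum>j\<in>{j \<in> J. l < j}. - ?t l j)"
  proof (intro sum.cong refl)
    fix l j assume "l \<in> J" "j \<in> {j \<in> J. l < j}"
    then have "rem_sign J j * rem_sign (J - {j}) l = - (rem_sign J l * rem_sign (J - {l}) j :: 's)"
      by (intro rem_sign_swap) (use assms in auto)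
    then show "?t j l = - ?t l j"
      using assms(2) \<open>l \<in> J\<close> \<open>j \<in> {j \<in> J. l < j}\<close> by (simp add: fmod.scale_minus_left)
  qed
  finally show ?thesis by (simp add: sum_negf)
qed

lemma symm_diff_symm_diff:
  fixes f :: "'n::{finite,linorder} lbasis \<Rightarrow>\<^sub>0 's::comm_ring_1"
  shows "symm_diff (symm_diff f) = 0"
proof (rule additive_eqI[where F = "\<lambda>f. symm_diff (symm_diff f)" and G = "\<lambda>f. 0"])
  fix b :: "'n lbasis"
  show "symm_diff (symm_diff (single b (lookup f b))) = 0"
  proof (cases b)
    case (Some c)
    obtain J \<alpha> where c: "c = (J, \<alpha>)" by (cases c)
    have "symm_diff (symm_diff (single b (lookup f b))) =
       (\<Sum>j\<in>J. fscale (rem_sign J j) (\<Sum>l\<in>J - {j}. fscale (rem_sign (J - {j}) l)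
          (single (Some (J - {j} - {l}, \<alpha> + single j 1 + single l 1)) (lookup f b))))"
      unfolding Some c symm_diff_single symm_diff_sum symm_diff_fscale symm_diff_single ..
    also have "\<dots> = 0"
      by (rule sum_rem_sign_zero)
        (simp, subst Diff_swap, simp only: add.assoc add.commute[of "single _ _" "single _ _"])
    finally show ?thesis .
  qed (simp add: symm_diff_zero)
qed (rule additive_compose[OF additive_symm_diff additive_symm_diff] additive_const_zero)+

lemma coef_diff_coef_diff:
  fixes f :: "'n::{finite,linorder} lbasis \<Rightarrow>\<^sub>0 ('n, 'k::field) mpol"
  shows "coef_diff (coef_diff f) = 0"
proof (rule additive_eqI[where F = "\<lambda>f. coef_diff (coef_diff f)" and G = "\<lambda>f. 0"])
  fix b :: "'n lbasis"
  show "coef_diff (coef_diff (single b (lookup f b))) = 0"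
  proof (cases b)
    case (Some c)
    obtain J \<alpha> where c: "c = (J, \<alpha>)" by (cases c)
    have "coef_diff (coef_diff (single b (lookup f b))) =
       (\<Sum>j\<in>J. fscale (rem_sign J j) (\<Sum>l\<in>J - {j}. fscale (rem_sign (J - {j}) l)
          (single (Some (J - {j} - {l}, \<alpha>)) (xvar l * (xvar j * lookup f b)))))"
      unfolding Some c coef_diff_single coef_diff_sum coef_diff_fscale coef_diff_single ..
    also have "\<dots> = 0"
      by (rule sum_rem_sign_zero)
        (simp, subst Diff_swap, simp only: mult.left_commute)
    finally show ?thesis .
  qed (simp add: coef_diff_zero)
qed (rule additive_compose[OF additive_coef_diff additive_coef_diff] additive_const_zero)+

section \<open>Total degrees and the bigraded pieces\<close>

lemma total_plus: "total (a + b) = total a + total b"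
  by (simp add: total_def lookup_add sum.distrib)

lemma total_single [simp]: "total (single i c) = c"
  by (simp add: total_def lookup_single when_def)

lemma total_zero [simp]: "total 0 = 0"
  by (simp add: total_def)

lemma total_eq_0_iff: "total a = 0 \<longleftrightarrow> a = 0"
  by (auto simp: total_def intro: poly_mapping_eqI)

lemma total_sum: "total (\<Sum>i\<in>I. f i) = (\<Sum>i\<in>I. total (f i))"
  by (induction I rule: infinite_finite_induct) (auto simp: total_plus)

lemma diff_single_add:
  assumes "i \<in> keys a" shows "a - single i 1 + single i 1 = (a :: 'n expo)"
  using assms by (intro poly_mapping_eqI) (auto simp: lookup_add lookup_minus lookup_single when_def in_keys_iff)

lemma total_diff_single: "i \<in> keys a \<Longrightarrow> Suc (total (a - single i 1)) = total a"
  using total_plus[of "a - single i 1" "single i 1"] by (simp add: diff_single_add)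

lemma keys_diff_single_subset: "keys ((a :: 'n expo) - b) \<subseteq> keys a"
  by (auto simp: in_keys_iff lookup_minus)

lemma mem_wedge_sym: "f \<in> wedge_sym a b \<longleftrightarrow> (\<forall>c\<in>keys f. \<exists>J \<alpha>. c = Some (J, \<alpha>) \<and> card J = a \<and> total \<alpha> = b)"
  by (auto simp: wedge_sym_def mem_free_on)

lemma symm_diff_wedge:
  assumes "f \<in> wedge_sym (Suc a) b" shows "symm_diff f \<in> wedge_sym a (Suc b)"
  unfolding symm_diff_def wedge_sym_def
  by (rule lin_ext_in_free_on[OF assms[unfolded wedge_sym_def]])
    (auto intro!: free_on_sum free_on_single simp: total_plus)

lemma coef_diff_wedge:
  assumes "f \<in> wedge_sym (Suc a) b" shows "coef_diff f \<in> wedge_sym a b"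
  unfolding coef_diff_def wedge_sym_def
  by (rule lin_ext_in_free_on[OF assms[unfolded wedge_sym_def]])
    (auto intro!: free_on_sum free_on_single)

lemma wedge_empty_set: "f \<in> wedge_sym 0 b \<Longrightarrow> c \<in> keys f \<Longrightarrow> \<exists>\<alpha>. c = Some ({}, \<alpha>)"
  for f :: "'n::finite lbasis \<Rightarrow>\<^sub>0 's::comm_ring_1"
  by (force simp: mem_wedge_sym)

lemma symm_diff_wedge_0:
  fixes f :: "'n::{finite,linorder} lbasis \<Rightarrow>\<^sub>0 's::comm_ring_1"
  assumes "f \<in> wedge_sym 0 b" shows "symm_diff f = 0"
proof -
  have "symm_diff f = lin_ext (\<lambda>_. 0) f"
    unfolding symm_diff_def by (rule lin_ext_cong) (use wedge_empty_set[OF assms] in force)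
  then show ?thesis by (simp add: lin_ext_def)
qed

text \<open>The elements of J below and above j number a - 1 together, so moving f_j to the end
  instead of the front costs a sign that depends on a alone.\<close>

lemma kappa_eq_symm_diff:
  fixes f :: "'n::{finite,linorder} lbasis \<Rightarrow>\<^sub>0 's::comm_ring_1"
  assumes "f \<in> wedge_sym a b"
  shows "kappa f = fscale ((- 1) ^ Suc a) (symm_diff f)"
  unfolding kappa_def symm_diff_def lin_ext_fscale[symmetric]
proof -
  have "lin_ext (\<lambda>b. case b of None \<Rightarrow> 0 | Some (J, \<alpha>) \<Rightarrow>
      \<Sum>j\<in>J. single (Some (J - {j}, \<alpha> + single j 1)) ((- 1) ^ card {l \<in> J. j < l})) f =
    lin_ext (\<lambda>b. fscale ((- 1) ^ Suc a) (case b of None \<Rightarrow> 0 | Some (J, \<alpha>) \<Rightarrow>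
      \<Sum>j\<in>J. single (Some (J - {j}, \<alpha> + single j 1)) (rem_sign J j))) f" (is "lin_ext ?g f = lin_ext ?h f")
  proof (rule lin_ext_cong)
    fix c assume "c \<in> keys f"
    then obtain J \<alpha> where c: "c = Some (J, \<alpha>)" and J: "card J = a"
      using assms by (auto simp: mem_wedge_sym)
    have "(- 1) ^ card {l \<in> J. j < l} = (- 1) ^ Suc a * (rem_sign J j :: 's)" if "j \<in> J" for j
    proof -
      have "J = insert j ({l \<in> J. l < j} \<union> {l \<in> J. j < l})" using that by auto
      then have "card J = Suc (card ({l \<in> J. l < j} \<union> {l \<in> J. j < l}))"
        by (metis (no_types, lifting) Un_iff card_insert_disjoint finite less_irrefl mem_Collect_eq)
      also have "card ({l \<in> J. l < j} \<union> {l \<in> J. j < l}) = card {l \<in> J. l < j} + card {l \<in> J. j < l}"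
        by (rule card_Un_disjoint) auto
      finally have "Suc a + card {l \<in> J. l < j} = card {l \<in> J. j < l} + 2 * Suc (card {l \<in> J. l < j})"
        using J by simp
      then have "(- 1) ^ (Suc a + card {l \<in> J. l < j}) = ((- 1) ^ card {l \<in> J. j < l} :: 's)"
        by (simp only: power_add power_mult power2_minus power_one mult_1_right)
      then show ?thesis by (simp add: power_add rem_sign_def)
    qed
    then show "?g c = ?h c"
      by (simp add: c fmod.scale_sum_right)
  qed
  also have "\<dots> = lin_ext (\<lambda>b. case b of None \<Rightarrow> 0 | Some (J, \<alpha>) \<Rightarrow>
      \<Sum>j\<in>J. single (Some (J - {j}, \<alpha> + single j 1)) (rem_sign J j)) (fscale ((- 1) ^ Suc a) f)"
    unfolding lin_ext_fscale lin_ext_def[of _ f] fmod.scale_sum_right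
    by (simp only: fmod.scale_left_commute)
  finally show "lin_ext (\<lambda>b. case b of None \<Rightarrow> 0 | Some (J, \<alpha>) \<Rightarrow>
      \<Sum>j\<in>J. single (Some (J - {j}, \<alpha> + single j 1)) ((- 1) ^ card {l \<in> J. j < l})) f = \<dots>" .
qed

lemma L_module_eq:
  "(L_module a b :: ('n::{finite,linorder} lbasis \<Rightarrow>\<^sub>0 's::comm_ring_1) set) = {f \<in> wedge_sym a b. symm_diff f = 0}"
proof -
  have "fscale ((- 1) ^ k) g = 0 \<longleftrightarrow> g = 0" for k and g :: "'n lbasis \<Rightarrow>\<^sub>0 's::comm_ring_1"
    by (cases "even k") (auto simp: fmod.scale_minus_left)
  then show ?thesis
    unfolding L_module_def by (auto simp: kappa_eq_symm_diff simp del: power_Suc)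
qed

text \<open>The sign in \<open>koszul_tensor_id\<close> counts j itself and so has one factor - 1
  more than \<open>rem_sign\<close>.\<close>

lemma koszul_eq_coef_diff:
  fixes f :: "'n::{finite,linorder} lbasis \<Rightarrow>\<^sub>0 ('n, 'k::field) mpol"
  shows "koszul_tensor_id xvar f = - coef_diff f"
proof -
  have *: "(- 1) ^ card {l \<in> J. l \<le> j} * xvar j = - (rem_sign J j * xvar j :: ('n, 'k) mpol)" if "j \<in> J" for J j
  proof -
    have "{l \<in> J. l \<le> j} = insert j {l \<in> J. l < j}" using that by auto
    then show ?thesis by (simp add: rem_sign_def)
  qed
  have "koszul_tensor_id xvar f = lin_ext (\<lambda>b. - (case b of None \<Rightarrow> 0
    | Some (J, \<alpha>) \<Rightarrow> \<Sum>j\<in>J. single (Some (J - {j}, \<alpha>)) (rem_sign J j * xvar j))) f"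
    unfolding koszul_tensor_id_def
    by (intro lin_ext_cong) (auto simp: * single_uminus sum_negf split: option.splits)
  then show ?thesis
    by (simp add: coef_diff_def lin_ext_def fmod.scale_minus_right sum_negf)
qed

section \<open>The contraction of the symmetric differential\<close>

definition lead :: "'n::{finite,linorder} expo \<Rightarrow> 'n set \<Rightarrow> bool"
  where "lead a J \<longleftrightarrow> (\<forall>i\<in>keys a. Min J \<le> i)"

text \<open>For a + b > 0 the span of this set is mapped isomorphically onto
  \<open>L_module a b\<close> by \<open>symm_diff\<close>, with inverse \<open>symm_htpy\<close>.
  Writing |\<alpha>| = b - 1 as \<open>Suc (total \<alpha>) = b\<close> leaves the set empty for b =
  0.\<close>

definition lead_basis :: "nat \<Rightarrow> nat \<Rightarrow> ('n::{finite,linorder}) lbasis set"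
  where "lead_basis a b = {Some (J, \<alpha>) |J \<alpha>. card J = Suc a \<and> Suc (total \<alpha>) = b \<and> lead \<alpha> J}"

definition symm_htpy :: "('n::{finite,linorder} lbasis \<Rightarrow>\<^sub>0 's::comm_ring_1) \<Rightarrow> 'n lbasis \<Rightarrow>\<^sub>0 's"
  where "symm_htpy = lin_ext (\<lambda>b. case b of None \<Rightarrow> 0 | Some (J, u) \<Rightarrow>
    if J = {} \<and> u = 0 \<or> Min (J \<union> keys u) \<in> J then 0
    else basis_elt (insert (Min (J \<union> keys u)) J) (u - single (Min (J \<union> keys u)) 1))"

lemma additive_symm_htpy: "Modules.additive symm_htpy"
  unfolding symm_htpy_def by (rule additive_lin_ext)

lemmas symm_htpy_zero = Modules.additive.zero[OF additive_symm_htpy]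

lemma symm_htpy_single:
  "symm_htpy (single (Some (J, u)) r) = (if J = {} \<and> u = 0 \<or> Min (J \<union> keys u) \<in> J then 0
    else single (Some (insert (Min (J \<union> keys u)) J, u - single (Min (J \<union> keys u)) 1)) r)"
  by (simp add: symm_htpy_def)

lemma symm_contraction:
  fixes f :: "'n::{finite,linorder} lbasis \<Rightarrow>\<^sub>0 's::comm_ring_1"
  assumes "f \<in> wedge_sym a b" "a + b > 0"
  shows "symm_diff (symm_htpy f) + symm_htpy (symm_diff f) = f"
proof (rule additive_eqI[where F = "\<lambda>f. symm_diff (symm_htpy f) + symm_htpy (symm_diff f)" and G = "\<lambda>f. f"])
  fix c assume "c \<in> keys f"
  then obtain J u where c: "c = Some (J, u)" "card J = a" "total u = b"
    using assms by (auto simp: mem_wedge_sym)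
  have "J \<noteq> {} \<or> u \<noteq> 0" using assms(2) c by auto
  then show "symm_diff (symm_htpy (single c (lookup f c))) + symm_htpy (symm_diff (single c (lookup f c))) = single c (lookup f c)"
    unfolding c
    by (rule koszul_contraction[where e = "\<lambda>J u. single (Some (J, u)) _",
          OF additive_symm_diff symm_diff_single additive_symm_htpy symm_htpy_single])
qed (rule additive_plus[OF additive_compose[OF additive_symm_diff additive_symm_htpy]
  additive_compose[OF additive_symm_htpy additive_symm_diff]] additive_ident)+

text \<open>The inserted index is minimal in J together with the whole support, so it becomes the
  minimum of the new set and stays below what remains of the exponent.\<close>

lemma symm_htpy_lead:
  fixes f :: "'n::{finite,linorder} lbasis \<Rightarrow>\<^sub>0 's::comm_ring_1"
  assumes "f \<in> wedge_sym a b"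
  shows "symm_htpy f \<in> free_on (lead_basis a b)"
  unfolding symm_htpy_def
proof (rule lin_ext_in_free_on[OF assms[unfolded wedge_sym_def]], goal_cases)
  case (1 c)
  then obtain J u where c: "c = Some (J, u)" "card J = a" "total u = b" by auto
  let ?m = "Min (J \<union> keys u)"
  show ?case
  proof (cases "J = {} \<and> u = 0 \<or> ?m \<in> J")
    case False
    then have "J \<union> keys u \<noteq> {}" by auto
    then have "?m \<in> J \<union> keys u" by (intro Min_in) auto
    then have m: "?m \<in> keys u" "?m \<notin> J" using False by auto
    have le: "?m \<le> i" if "i \<in> J \<union> keys u" for i using that by (intro Min_le) auto
    then have "Min (insert ?m J) = ?m" by (intro Min_eqI) auto
    moreover have "?m \<le> i" if "i \<in> keys (u - single ?m 1)" for i
      using that keys_diff_single_subset[of u "single ?m 1"] le by blast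
    ultimately have "Some (insert ?m J, u - single ?m 1) \<in> lead_basis a b"
      using m c by (auto simp: lead_basis_def lead_def total_diff_single simp del: Min_insert)
    then show ?thesis using False c by (auto intro: free_on_single)
  qed (use c in auto)
qed

lemma lead_basis_wedge: "f \<in> free_on (lead_basis a (Suc b)) \<Longrightarrow> f \<in> wedge_sym (Suc a) b"
  by (auto simp: wedge_sym_def mem_free_on lead_basis_def)

lemma symm_htpy_wedge: "f \<in> wedge_sym a (Suc b) \<Longrightarrow> symm_htpy f \<in> wedge_sym (Suc a) b"
  by (intro lead_basis_wedge symm_htpy_lead)

text \<open>When Min J lies below the support, the minimum of both is already in J. With
  \<open>symm_contraction\<close> this makes \<open>symm_htpy\<close> a left inverse of
  \<open>symm_diff\<close> on the leading span.\<close>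

lemma symm_htpy_lead_zero:
  assumes "f \<in> free_on (lead_basis a b)"
  shows "symm_htpy f = 0"
proof -
  have "symm_htpy f = lin_ext (\<lambda>_. 0) f"
    unfolding symm_htpy_def
  proof (rule lin_ext_cong)
    fix c assume "c \<in> keys f"
    then obtain J u where c: "c = Some (J, u)" "card J = Suc a" "lead u J"
      using assms by (auto simp: lead_basis_def mem_free_on)
    then have J: "J \<noteq> {}" by auto
    then have "Min (J \<union> keys u) = Min J"
      by (intro Min_eqI) (use c J in \<open>auto simp: lead_def\<close>)
    then have "Min (J \<union> keys u) \<in> J" using J by simp
    then show "(case c of None \<Rightarrow> 0 | Some (J, u) \<Rightarrow>
      if J = {} \<and> u = 0 \<or> Min (J \<union> keys u) \<in> J then 0
      else basis_elt (insert (Min (J \<union> keys u)) J) (u - single (Min (J \<union> keys u)) 1)) = 0"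
      by (simp add: c)
  qed
  then show ?thesis by (simp add: lin_ext_def)
qed

section \<open>The contraction of the Koszul differential in the coefficients\<close>

lemma xvar_mult_single: "xvar j * single u c = single (u + single j 1) c"
  by (simp add: xvar_def mult_single add.commute)

text \<open>The recipe of \<open>symm_htpy\<close> with the monomial u of the coefficient in the
  role of the symmetric exponent, while \<open>\<alpha>\<close> stays inert. It works monomial by
  monomial, hence the nested \<open>add_ext\<close>.\<close>

definition coef_htpy :: "('n::{finite,linorder} lbasis \<Rightarrow>\<^sub>0 ('n, 'k::field) mpol) \<Rightarrow> ('n, 'k) L_elt"
  where "coef_htpy = add_ext (\<lambda>b. case b of None \<Rightarrow> (\<lambda>_. 0) | Some (J, \<alpha>) \<Rightarrow> add_ext (\<lambda>u c.
    if J = {} \<and> u = 0 \<or> Min (J \<union> keys u) \<in> J then 0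
    else single (Some (insert (Min (J \<union> keys u)) J, \<alpha>)) (single (u - single (Min (J \<union> keys u)) 1) c)))"

lemma additive_coef_htpy: "Modules.additive coef_htpy"
  unfolding coef_htpy_def
proof (rule additive_add_ext)
  fix b :: "'a lbasis"
  show "Modules.additive (case b of None \<Rightarrow> (\<lambda>_. 0) | Some (J, \<alpha>) \<Rightarrow> add_ext (\<lambda>u c.
    if J = {} \<and> u = 0 \<or> Min (J \<union> keys u) \<in> J then 0
    else single (Some (insert (Min (J \<union> keys u)) J, \<alpha>)) (single (u - single (Min (J \<union> keys u)) 1) c)))"
  proof (cases b)
    case (Some c)
    then show ?thesis
      by (cases c) (simp, rule additive_add_ext, auto simp: Modules.additive_def single_add)
  qed (simp add: additive_const_zero)
qed

lemmas coef_htpy_zero = Modules.additive.zero[OF additive_coef_htpy]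

lemma coef_htpy_single:
  "coef_htpy (single (Some (J, \<alpha>)) (single u c)) = (if J = {} \<and> u = 0 \<or> Min (J \<union> keys u) \<in> J then 0
    else single (Some (insert (Min (J \<union> keys u)) J, \<alpha>)) (single (u - single (Min (J \<union> keys u)) 1) c))"
  unfolding coef_htpy_def
  by (subst add_ext_single) (auto simp: add_ext_single split: option.splits, simp_all add: add_ext_def)

text \<open>Exterior degree at least 1 excludes the one exceptional case of the contraction, J = {}
  with constant coefficient.\<close>

lemma coef_contraction:
  fixes f :: "'n::{finite,linorder} lbasis \<Rightarrow>\<^sub>0 ('n, 'k::field) mpol"
  assumes "f \<in> wedge_sym (Suc a) b"
  shows "coef_diff (coef_htpy f) + coef_htpy (coef_diff f) = f"
proof (rule additive_double_eqI[where F = "\<lambda>f. coef_diff (coef_htpy f) + coef_htpy (coef_diff f)" and G = "\<lambda>f. f"])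
  fix c :: "'n lbasis" and u :: "'n expo" and r :: 'k assume "c \<in> keys f"
  then obtain J \<alpha> where c: "c = Some (J, \<alpha>)" "card J = Suc a"
    using assms by (auto simp: mem_wedge_sym)
  then have "J \<noteq> {} \<or> u \<noteq> 0" by auto
  then show "coef_diff (coef_htpy (single c (single u r))) + coef_htpy (coef_diff (single c (single u r))) = single c (single u r)"
    unfolding c
    by (intro koszul_contraction[where e = "\<lambda>J u. single (Some (J, \<alpha>)) (single u r)"])
      (rule additive_coef_diff additive_coef_htpy coef_htpy_single
        | simp only: coef_diff_single xvar_mult_single)+
qed (rule additive_plus[OF additive_compose[OF additive_coef_diff additive_coef_htpy]
  additive_compose[OF additive_coef_htpy additive_coef_diff]] additive_ident)+

lemma coef_htpy_wedge:
  fixes f :: "'n::{finite,linorder} lbasis \<Rightarrow>\<^sub>0 ('n, 'k::field) mpol"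
  assumes "f \<in> wedge_sym a b"
  shows "coef_htpy f \<in> wedge_sym (Suc a) b"
  unfolding coef_htpy_def add_ext_def wedge_sym_def
proof (rule free_on_sum, goal_cases)
  case (1 c)
  then obtain J \<alpha> where c: "c = Some (J, \<alpha>)" "card J = a" "total \<alpha> = b"
    using assms by (auto simp: mem_wedge_sym)
  then show ?case
  proof (simp, intro free_on_sum, goal_cases)
    case (1 u)
    then have "J \<union> keys u = {} \<longleftrightarrow> J = {} \<and> u = 0" by auto
    then show ?case using c by (auto intro!: free_on_single)
  qed
qed

section \<open>Exactness of the \<open>L\<close>-complex\<close>

lemma prod_xvar: "(\<Prod>i\<in>UNIV. xvar i ^ lookup \<alpha> i) = (single \<alpha> 1 :: ('n::finite, 'k::field) mpol)"
proof -
  have pow: "xvar i ^ k = (single (single i k) 1 :: ('n, 'k) mpol)" for i k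
    by (induction k) (simp_all add: xvar_def mult_single plus_1_eq_Suc flip: single_add)
  have prod: "(\<Prod>i\<in>I. single (f i) 1) = (single (\<Sum>i\<in>I. f i) 1 :: ('n, 'k) mpol)" for I and f :: "'n \<Rightarrow> 'n expo"
    by (induction I rule: infinite_finite_induct) (simp_all add: mult_single)
  have "(\<Sum>i\<in>UNIV. single i (lookup \<alpha> i)) = \<alpha>"
    by (rule poly_mapping_eqI) (simp add: lookup_sum lookup_single when_def)
  then show ?thesis by (simp add: pow prod)
qed

definition sym_eval :: "('n::finite lbasis \<Rightarrow>\<^sub>0 ('n, 'k::field) mpol) \<Rightarrow> ('n, 'k) L_elt"
  where "sym_eval = sym_power_map xvar"

lemma sym_eval_single:
  "sym_eval (single (Some (J, \<alpha>)) r) = (if J = {} then single None (r * single \<alpha> 1) else 0)"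
  by (simp add: sym_eval_def sym_power_map_def prod_xvar)

lemma additive_sym_eval: "Modules.additive sym_eval"
  unfolding sym_eval_def sym_power_map_def by (rule additive_lin_ext)

lemmas sym_eval_minus = Modules.additive.minus[OF additive_sym_eval]
  and sym_eval_sum = Modules.additive.sum[OF additive_sym_eval]
  and sym_eval_zero = Modules.additive.zero[OF additive_sym_eval]

lemma sym_eval_fscale: "sym_eval (fscale r f) = fscale r (sym_eval f)"
  unfolding sym_eval_def sym_power_map_def by (rule lin_ext_fscale)

text \<open>For J = {j} one side puts x_j into the coefficient and the other puts f_j into the
  symmetric factor; evaluation gives the same monomial.\<close>

lemma sym_eval_coef_diff:
  fixes f :: "'n::{finite,linorder} lbasis \<Rightarrow>\<^sub>0 ('n, 'k::field) mpol"
  assumes "f \<in> wedge_sym (Suc 0) b"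
  shows "sym_eval (coef_diff f) = sym_eval (symm_diff f)"
proof (rule additive_eqI[where F = "\<lambda>f. sym_eval (coef_diff f)" and G = "\<lambda>f. sym_eval (symm_diff f)"])
  fix c assume "c \<in> keys f"
  then obtain J \<alpha> where c: "c = Some (J, \<alpha>)" "card J = Suc 0"
    using assms by (auto simp: mem_wedge_sym)
  then obtain j where J: "J = {j}" by (auto simp: card_Suc_eq)
  have *: "xvar j * (single \<alpha> 1 :: ('n, 'k) mpol) = single (\<alpha> + single j 1) 1"
    by (rule xvar_mult_single)
  have "sym_eval (coef_diff (single c (lookup f c))) = fscale (rem_sign {j} j) (single None (xvar j * lookup f c * single \<alpha> 1))"
    unfolding c(1) J coef_diff_single sym_eval_sum sym_eval_fscale
    by (simp add: sym_eval_single)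
  moreover have "sym_eval (symm_diff (single c (lookup f c))) = fscale (rem_sign {j} j) (single None (lookup f c * single (\<alpha> + single j 1) 1))"
    unfolding c(1) J symm_diff_single sym_eval_sum sym_eval_fscale
    by (simp add: sym_eval_single)
  ultimately show "sym_eval (coef_diff (single c (lookup f c))) = sym_eval (symm_diff (single c (lookup f c)))"
    by (simp only: flip: * mult.assoc, simp only: mult.commute[of "xvar j"])
qed (rule additive_compose[OF additive_sym_eval additive_coef_diff]
  additive_compose[OF additive_sym_eval additive_symm_diff])+

lemma L_module_uminus: "f \<in> L_module a b \<Longrightarrow> - f \<in> L_module a b"
  by (auto simp: L_module_eq wedge_sym_def intro: free_on_uminus simp: symm_diff_minus)

lemma wedge_sym_diff: "f \<in> wedge_sym a b \<Longrightarrow> g \<in> wedge_sym a b \<Longrightarrow> f - g \<in> wedge_sym a b"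
  by (auto simp: wedge_sym_def intro: free_on_diff)

lemma symm_diff_htpy_L:
  assumes "z \<in> L_module a b" "a + b > 0"
  shows "symm_diff (symm_htpy z) = z"
  using symm_contraction[of z a b] assms
  by (simp add: L_module_eq symm_htpy_zero)

text \<open>A diagram chase: w - w' is a cycle of \<open>coef_diff\<close>, hence the
  \<open>coef_diff\<close> of some element; applying \<open>symm_diff\<close>, which kills w', and
  anticommuting shows that minus the \<open>symm_diff\<close> of that element is the required
  preimage. It lies in the kernel because \<open>symm_diff\<close> squares to zero.\<close>

lemma coef_cycle_lift:
  fixes w w' :: "'n::{finite,linorder} lbasis \<Rightarrow>\<^sub>0 ('n, 'k::field) mpol"
  assumes "w \<in> wedge_sym (Suc a) b" "w' \<in> L_module (Suc a) b" "coef_diff w' = coef_diff w"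
  shows "\<exists>t\<in>L_module (Suc a) (Suc b). coef_diff t = symm_diff w"
proof -
  let ?t = "coef_htpy (w - w')"
  have w': "w' \<in> wedge_sym (Suc a) b" "symm_diff w' = 0" using assms(2) by (auto simp: L_module_eq)
  have "coef_diff (w - w') = 0"
    by (simp add: coef_diff_diff assms(3))
  then have "coef_diff ?t = w - w'"
    using coef_contraction[OF wedge_sym_diff[OF assms(1) w'(1)]]
    by (simp add: coef_htpy_zero)
  then have "coef_diff (- symm_diff ?t) = symm_diff w"
    using symm_diff_coef_diff[of ?t] w'(2)
    by (simp add: coef_diff_minus symm_diff_diff)
  moreover have "symm_diff ?t \<in> L_module (Suc a) (Suc b)"
    using symm_diff_wedge[OF coef_htpy_wedge[OF wedge_sym_diff[OF assms(1) w'(1)]]]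
    by (simp add: L_module_eq symm_diff_symm_diff)
  ultimately show ?thesis using L_module_uminus by blast
qed

text \<open>Induction on the symmetric degree: a cycle \<open>z\<close> is \<open>symm_diff w\<close>, and \<open>coef_diff w\<close> is a cycle
  of the \<open>L\<close>-complex one symmetric degree lower.\<close>

lemma L_exact:
  fixes z :: "'n::{finite,linorder} lbasis \<Rightarrow>\<^sub>0 ('n, 'k::field) mpol"
  assumes "z \<in> L_module a b" "if a = 0 then sym_eval z = 0 else coef_diff z = 0"
  shows "\<exists>t\<in>L_module (Suc a) b. coef_diff t = z"
  using assms
proof (induction b arbitrary: a z)
  case 0
  \<comment> \<open>In symmetric degree 0 the module is S for a = 0, where evaluation is injective,
    and zero for a > 0.\<close>
  have "z = 0"
  proof (cases "a = 0")
    case True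
    then have "keys z \<subseteq> {Some ({}, 0)}"
      using 0(1) by (auto simp: L_module_eq mem_wedge_sym total_eq_0_iff)
    then have *: "z = single (Some ({}, 0)) (lookup z (Some ({}, 0)))"
    proof (intro poly_mapping_eqI[where f = z])
      fix k
      have "k = Some ({}, 0) \<or> lookup z k = 0"
        using \<open>keys z \<subseteq> _\<close> by (metis in_keys_iff insertE singletonD subsetD)
      then show "lookup z k = lookup (single (Some ({}, 0)) (lookup z (Some ({}, 0)))) k"
        by (metis lookup_single_eq lookup_single_not_eq)
    qed
    have "sym_eval z = single None (lookup z (Some ({}, 0)))"
      by (subst *) (simp add: sym_eval_single)
    then have "lookup z (Some ({}, 0)) = 0"
      using 0(2) True by (metis lookup_single_eq lookup_zero)
    then show ?thesis by (subst *) simp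
  next
    case False
    have "symm_htpy z \<in> free_on (lead_basis a 0)"
      using 0(1) by (intro symm_htpy_lead) (simp add: L_module_eq)
    then have "symm_htpy z = 0"
      by (auto simp: lead_basis_def mem_free_on)
    then show ?thesis
      using symm_diff_htpy_L[OF 0(1)] False by (simp add: symm_diff_zero)
  qed
  moreover have "(0 :: ('n, 'k) L_elt) \<in> L_module (Suc a) 0"
    by (simp add: L_module_eq wedge_sym_def symm_diff_zero)
  ultimately show ?case
    using coef_diff_zero by blast
next
  case (Suc b)
  define w where "w = symm_htpy z"
  have zw: "symm_diff w = z"
    unfolding w_def using symm_diff_htpy_L[OF Suc.prems(1)] by simp
  have w: "w \<in> wedge_sym (Suc a) b"
    unfolding w_def using Suc.prems(1) by (intro symm_htpy_wedge) (simp add: L_module_eq)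
  have cw: "coef_diff w \<in> wedge_sym a b" using w by (rule coef_diff_wedge)
  have "coef_diff w \<in> L_module a b \<and> (if a = 0 then sym_eval (coef_diff w) = 0 else coef_diff (coef_diff w) = 0)"
  proof (cases "a = 0")
    case True
    have "symm_diff (coef_diff w) = 0"
      using cw True symm_diff_wedge_0 by blast
    \<comment> \<open>In exterior degree 0 the cycle condition is about evaluation, which cannot
      tell \<open>coef_diff w\<close> from \<open>symm_diff w\<close>, that is, from z.\<close>
    moreover have "sym_eval (coef_diff w) = 0"
      using w True sym_eval_coef_diff[of w b] zw Suc.prems(2) by simp
    ultimately show ?thesis using cw True by (simp add: L_module_eq)
  next
    case False
    then have "symm_diff (coef_diff w) = 0"
      using Suc.prems(2) by (simp add: symm_diff_coef_diff zw)
    then show ?thesis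
      using cw False by (simp add: L_module_eq coef_diff_coef_diff)
  qed
  then obtain w' where w': "w' \<in> L_module (Suc a) b" "coef_diff w' = coef_diff w"
    using Suc.IH[of "coef_diff w" a] by blast
  show ?case
    using coef_cycle_lift[OF w w'] unfolding zw .
qed

lemma sym_eval_coef_diff_L:
  fixes f :: "'n::{finite,linorder} lbasis \<Rightarrow>\<^sub>0 ('n, 'k::field) mpol"
  assumes "f \<in> L_module (Suc 0) b"
  shows "sym_eval (coef_diff f) = 0"
proof -
  have f: "f \<in> wedge_sym (Suc 0) b" "symm_diff f = 0" using assms by (auto simp: L_module_eq)
  show ?thesis
    unfolding sym_eval_coef_diff[OF f(1)] f(2) by (rule sym_eval_zero)
qed

section \<open>Geometry of the hypersimplicial complex\<close>

definition expo_vec :: "'n::finite expo \<Rightarrow> real ^ 'n"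
  where "expo_vec a = (\<chi> i. real (lookup a i))"

definition ind_vec :: "'n::finite set \<Rightarrow> real ^ 'n"
  where "ind_vec L = (\<chi> i. if i \<in> L then 1 else 0)"

text \<open>The space of directions of a positive-dimensional cell with free coordinates J.\<close>

definition sum_zero :: "'n::finite set \<Rightarrow> (real ^ 'n) set"
  where "sum_zero J = {v. (\<forall>i. i \<notin> J \<longrightarrow> vec_nth v i = 0) \<and> (\<Sum>i\<in>J. vec_nth v i) = 0}"

lemma expo_vec_nth [simp]: "vec_nth (expo_vec a) i = real (lookup a i)"
  by (simp add: expo_vec_def)

lemma ind_vec_nth [simp]: "vec_nth (ind_vec L) i = (if i \<in> L then 1 else 0)"
  by (simp add: ind_vec_def)

lemma expo_vec_add_single: "expo_vec (a + single i 1) = expo_vec a + ind_vec {i}"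
  by (simp add: Finite_Cartesian_Product.vec_eq_iff lookup_add lookup_single when_def)

lemma hyper_cell_eq:
  fixes a :: "'n::finite expo"
  shows "hyper_cell d (a, J) = convex hull {expo_vec a + ind_vec L |L. L \<subseteq> J \<and> total a + card L = d}"
proof -
  have vec: "(\<Sum>j\<in>J. real (l j) *\<^sub>R axis j 1) = (ind_vec {j \<in> J. l j = 1} :: real ^ 'n)"
    if "\<forall>j\<in>J. l j \<in> {0, 1}" for l
    using that by (auto simp: Finite_Cartesian_Product.vec_eq_iff axis_def if_distrib cong: if_cong)
  have card: "(\<Sum>j\<in>J. l j) = card {j \<in> J. l j = 1}" if "\<forall>j\<in>J. l j \<in> {0, 1}" for l
  proof -
    have "(\<Sum>j\<in>J. l j) = (\<Sum>j\<in>J. if l j = 1 then 1 else 0)"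
      by (intro sum.cong) (use that in auto)
    then show ?thesis by (simp flip: sum.inter_filter)
  qed
  have "{(\<chi> i. real (lookup a i)) + (\<Sum>j\<in>J. real (l j) *\<^sub>R axis j 1) |l :: 'n \<Rightarrow> nat.
      (\<forall>j\<in>J. l j \<in> {0, 1}) \<and> int (\<Sum>j\<in>J. l j) = int d - int (total a)} =
    {expo_vec a + ind_vec L |L. L \<subseteq> J \<and> total a + card L = d}" (is "?A = ?B")
  proof (intro equalityI subsetI)
    fix x assume "x \<in> ?A"
    then obtain l :: "'n \<Rightarrow> nat" where l: "\<forall>j\<in>J. l j \<in> {0, 1}" "int (\<Sum>j\<in>J. l j) = int d - int (total a)"
      and x: "x = (\<chi> i. real (lookup a i)) + (\<Sum>j\<in>J. real (l j) *\<^sub>R axis j 1)" by blast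
    have "x = expo_vec a + ind_vec {j \<in> J. l j = 1}"
      unfolding x vec[OF l(1)] by (simp add: expo_vec_def)
    moreover have "total a + card {j \<in> J. l j = 1} = d"
      using l(2) unfolding card[OF l(1)] by linarith
    ultimately show "x \<in> ?B" by blast
  next
    fix x assume "x \<in> ?B"
    then obtain L where L: "L \<subseteq> J" "total a + card L = d" and x: "x = expo_vec a + ind_vec L" by blast
    define l :: "'n \<Rightarrow> nat" where "l j = (if j \<in> L then 1 else 0)" for j
    have l: "\<forall>j\<in>J. l j \<in> {0, 1}" by (simp add: l_def)
    have Leq: "{j \<in> J. l j = 1} = L" using L(1) by (auto simp: l_def)
    have "x = (\<chi> i. real (lookup a i)) + (\<Sum>j\<in>J. real (l j) *\<^sub>R axis j 1)"
      unfolding vec[OF l] Leq x by (simp add: expo_vec_def)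
    moreover have "int (\<Sum>j\<in>J. l j) = int d - int (total a)"
      unfolding card[OF l] Leq using L(2) by linarith
    ultimately show "x \<in> ?A" using l by blast
  qed
  then show ?thesis by (simp add: hyper_cell_def)
qed

lemma hyper_cell_vertex:
  "L \<subseteq> J \<Longrightarrow> total a + card L = d \<Longrightarrow> expo_vec a + ind_vec L \<in> hyper_cell d (a, J)"
  unfolding hyper_cell_eq by (rule hull_inc) blast

lemma sum_ind_vec: "L \<subseteq> J \<Longrightarrow> (\<Sum>i\<in>J. if i \<in> L then 1 else 0 :: real) = real (card L)"
  for J :: "'n::finite set"
  by (simp flip: sum.inter_filter add: Collect_conj_eq Int_absorb1 Int_absorb2)

text \<open>The conditions are convex and hold at the vertices. They are strong enough to recover
  faces from inclusions and the sides of facets from coordinates.\<close>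

lemma hyper_cell_bounds:
  assumes y: "y \<in> hyper_cell d (a, J)"
  shows "i \<notin> J \<Longrightarrow> vec_nth y i = real (lookup a i)"
    and "real (lookup a i) \<le> vec_nth y i" "vec_nth y i \<le> real (lookup a i) + 1"
    and "(\<Sum>i\<in>J. vec_nth y i - real (lookup a i)) = real d - real (total a)"
proof -
  let ?P = "{y :: real ^ 'a. (\<forall>i. (i \<notin> J \<longrightarrow> vec_nth y i = real (lookup a i)) \<and>
    real (lookup a i) \<le> vec_nth y i \<and> vec_nth y i \<le> real (lookup a i) + 1) \<and>
    (\<Sum>i\<in>J. vec_nth y i - real (lookup a i)) = real d - real (total a)}"
  have "convex ?P"
  proof (rule convexI)
    fix x y :: "real ^ 'a" and u v :: real
    assume xP: "x \<in> ?P" and yP: "y \<in> ?P" and u: "0 \<le> u" and v: "0 \<le> v" and uv: "u + v = 1"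
    have r: "u * t + v * t = t" for t using uv by (metis distrib_right mult_1)
    have eq: "vec_nth (u *\<^sub>R x + v *\<^sub>R y) i = u * vec_nth x i + v * vec_nth y i" for i by simp
    have "vec_nth (u *\<^sub>R x + v *\<^sub>R y) i = real (lookup a i)" if "i \<notin> J" for i
    proof -
      have "vec_nth x i = real (lookup a i)" "vec_nth y i = real (lookup a i)" using xP yP that by blast+
      then show ?thesis by (simp add: r)
    qed
    moreover have "real (lookup a i) \<le> vec_nth (u *\<^sub>R x + v *\<^sub>R y) i" for i
    proof -
      have "real (lookup a i) \<le> vec_nth x i" "real (lookup a i) \<le> vec_nth y i" using xP yP by blast+
      then have "u * real (lookup a i) + v * real (lookup a i) \<le> u * vec_nth x i + v * vec_nth y i"
        using u v by (intro add_mono mult_left_mono)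
      then show ?thesis unfolding eq r .
    qed
    moreover have "vec_nth (u *\<^sub>R x + v *\<^sub>R y) i \<le> real (lookup a i) + 1" for i
    proof -
      have "vec_nth x i \<le> real (lookup a i) + 1" "vec_nth y i \<le> real (lookup a i) + 1" using xP yP by blast+
      then have "u * vec_nth x i + v * vec_nth y i \<le> u * (real (lookup a i) + 1) + v * (real (lookup a i) + 1)"
        using u v by (intro add_mono mult_left_mono)
      then show ?thesis unfolding eq r .
    qed
    moreover have "(\<Sum>i\<in>J. vec_nth (u *\<^sub>R x + v *\<^sub>R y) i - real (lookup a i)) = real d - real (total a)"
    proof -
      have "vec_nth (u *\<^sub>R x + v *\<^sub>R y) i - real (lookup a i) =
          u * (vec_nth x i - real (lookup a i)) + v * (vec_nth y i - real (lookup a i))" for i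
        using r[of "real (lookup a i)"] unfolding eq by argo
      then have "(\<Sum>i\<in>J. vec_nth (u *\<^sub>R x + v *\<^sub>R y) i - real (lookup a i)) =
          u * (\<Sum>i\<in>J. vec_nth x i - real (lookup a i)) + v * (\<Sum>i\<in>J. vec_nth y i - real (lookup a i))"
        by (simp only: sum.distrib sum_distrib_left)
      also have "(\<Sum>i\<in>J. vec_nth x i - real (lookup a i)) = real d - real (total a)" using xP by blast
      also have "(\<Sum>i\<in>J. vec_nth y i - real (lookup a i)) = real d - real (total a)" using yP by blast
      finally show ?thesis unfolding r .
    qed
    ultimately show "u *\<^sub>R x + v *\<^sub>R y \<in> ?P" by blast
  qed
  moreover have "{expo_vec a + ind_vec L |L. L \<subseteq> J \<and> total a + card L = d} \<subseteq> ?P"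
    by (auto simp: sum_ind_vec)
  ultimately have "convex hull {expo_vec a + ind_vec L |L. L \<subseteq> J \<and> total a + card L = d} \<subseteq> ?P"
    by (intro hull_minimal)
  then have "y \<in> ?P"
    using y unfolding hyper_cell_eq by (rule subsetD)
  then show "i \<notin> J \<Longrightarrow> vec_nth y i = real (lookup a i)"
    and "real (lookup a i) \<le> vec_nth y i" "vec_nth y i \<le> real (lookup a i) + 1"
    and "(\<Sum>i\<in>J. vec_nth y i - real (lookup a i)) = real d - real (total a)" by blast+
qed

lemma subspace_sum_zero: "subspace (sum_zero J)"
  by (auto simp: subspace_def sum_zero_def sum.distrib simp flip: sum_distrib_left)

lemma sum_zero_expand:
  fixes v :: "real ^ 'n"
  assumes "v \<in> sum_zero J" "i0 \<in> J"
  shows "v = (\<Sum>i\<in>J. vec_nth v i *\<^sub>R (axis i 1 - axis i0 1))"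
proof -
  have "v = (\<Sum>i\<in>J. vec_nth v i *\<^sub>R axis i 1)"
    using assms(1) by (auto simp: Finite_Cartesian_Product.vec_eq_iff axis_def sum_zero_def if_distrib cong: if_cong)
  moreover have "(\<Sum>i\<in>J. vec_nth v i *\<^sub>R axis i0 1) = (0 :: real ^ 'n)"
    using assms(1) by (simp add: sum_zero_def flip: scaleR_sum_left)
  ultimately show ?thesis by (simp add: scaleR_diff_right sum_subtractf)
qed

text \<open>Supplies vertices of a cell that separate two coordinates; r is the amount d - |a| to
  distribute, which is neither 0 nor all of J.\<close>

lemma exists_subset_between:
  fixes J :: "'n::finite set"
  assumes "i \<in> J" "j \<in> J" "i \<noteq> j" "1 \<le> r" "Suc r \<le> card J"
  shows "\<exists>L\<subseteq>J. card L = r \<and> i \<in> L \<and> j \<notin> L"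
proof -
  have "card (J - {i, j}) = card J - 2" using assms by (simp add: card_Diff_subset)
  then have "r - 1 \<le> card (J - {i, j})" using assms by linarith
  then obtain M where M: "M \<subseteq> J - {i, j}" "card M = r - 1"
    by (meson obtain_subset_with_card_n)
  then have "card (insert i M) = r"
    using assms by (subst card_insert_disjoint) auto
  then show ?thesis using M assms by (intro exI[of _ "insert i M"]) auto
qed

text \<open>Exchanging i for i0 in the set of raised coordinates moves between two vertices in the
  direction axis i - axis i0, and these directions span.\<close>

lemma span_differences_hyper_cell:
  fixes a :: "'n::finite expo"
  assumes "total a < d" "d < total a + card J"
  shows "span {p - q |p q. p \<in> hyper_cell d (a, J) \<and> q \<in> hyper_cell d (a, J)} = sum_zero J" (is "span ?D = _")
proof
  have "?D \<subseteq> sum_zero J"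
  proof safe
    fix p q assume pq: "p \<in> hyper_cell d (a, J)" "q \<in> hyper_cell d (a, J)"
    have "(\<Sum>i\<in>J. vec_nth (p - q) i) = (\<Sum>i\<in>J. vec_nth p i - real (lookup a i)) - (\<Sum>i\<in>J. vec_nth q i - real (lookup a i))"
      by (simp add: sum_subtractf)
    then show "p - q \<in> sum_zero J"
      using hyper_cell_bounds(1,4)[OF pq(1)] hyper_cell_bounds(1,4)[OF pq(2)] by (simp add: sum_zero_def)
  qed
  then show "span ?D \<subseteq> sum_zero J"
    by (rule span_minimal) (rule subspace_sum_zero)
  show "sum_zero J \<subseteq> span ?D"
  proof
    fix v assume v: "v \<in> sum_zero J"
    have "card J \<noteq> 0" using assms by linarith
    then obtain i0 where i0: "i0 \<in> J" by fastforce
    have "axis i 1 - axis i0 1 \<in> span ?D" if i: "i \<in> J" for i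
    proof (cases "i = i0")
      case False
      have "1 \<le> d - total a" "Suc (d - total a) \<le> card J" using assms by linarith+
      then obtain L where L: "L \<subseteq> J" "card L = d - total a" "i \<in> L" "i0 \<notin> L"
        using exists_subset_between[OF i i0 False] by blast
      let ?L = "insert i0 (L - {i})"
      have "card ?L = Suc (card (L - {i}))" using L by (intro card_insert_disjoint) auto
      then have "card ?L = d - total a" using L card_Suc_Diff1[of L i] by simp
      then have "expo_vec a + ind_vec ?L \<in> hyper_cell d (a, J)"
        using L i0 assms by (intro hyper_cell_vertex) auto
      moreover have "expo_vec a + ind_vec L \<in> hyper_cell d (a, J)"
        using L assms by (intro hyper_cell_vertex) auto
      moreover have "axis i 1 - axis i0 1 = (expo_vec a + ind_vec L) - (expo_vec a + ind_vec ?L)"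
        using L False by (auto simp: Finite_Cartesian_Product.vec_eq_iff axis_def)
      ultimately show ?thesis by (intro span_base) blast
    qed (simp add: span_zero)
    then have "(\<Sum>i\<in>J. vec_nth v i *\<^sub>R (axis i 1 - axis i0 1)) \<in> span ?D"
      by (intro span_sum span_scale)
    then show "v \<in> span ?D" by (subst sum_zero_expand[OF v i0])
  qed
qed

text \<open>Adjoining a single coordinate vector of J yields the whole coordinate space of
  J.\<close>

lemma dim_sum_zero:
  fixes J :: "'n::finite set"
  assumes "J \<noteq> {}"
  shows "Suc (dim (sum_zero J)) = card J"
proof -
  obtain i0 where i0: "i0 \<in> J" using assms by blast
  let ?e = "\<lambda>i. axis i 1 :: real ^ 'n"
  have "?e i0 \<notin> span (sum_zero J)"
    using subspace_sum_zero[of J] i0 by (simp add: span_eq_iff[THEN iffD2] sum_zero_def axis_def)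
  then have "dim (insert (?e i0) (sum_zero J)) = Suc (dim (sum_zero J))"
    by (simp add: dim_insert)
  moreover have "span (insert (?e i0) (sum_zero J)) = span (?e ` J)"
  proof (intro span_eq[THEN iffD2] conjI)
    show "insert (?e i0) (sum_zero J) \<subseteq> span (?e ` J)"
    proof (safe)
      show "?e i0 \<in> span (?e ` J)" using i0 by (intro span_base) auto
      fix v assume v: "v \<in> sum_zero J"
      have "(\<Sum>i\<in>J. vec_nth v i *\<^sub>R (?e i - ?e i0)) \<in> span (?e ` J)"
        using i0 by (intro span_sum span_scale span_diff span_base) auto
      then show "v \<in> span (?e ` J)" by (subst sum_zero_expand[OF v i0])
    qed
    have "?e i \<in> span (insert (?e i0) (sum_zero J))" if "i \<in> J" for i
    proof -
      have "?e i - ?e i0 \<in> sum_zero J"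
        using that i0 by (auto simp: sum_zero_def axis_def sum_subtractf)
      then have "?e i0 + (?e i - ?e i0) \<in> span (insert (?e i0) (sum_zero J))"
        by (intro span_add span_base) auto
      then show ?thesis by simp
    qed
    then show "?e ` J \<subseteq> span (insert (?e i0) (sum_zero J))" by auto
  qed
  moreover have "dim (?e ` J) = card J"
  proof -
    have "independent (?e ` J)"
      by (rule independent_mono[OF independent_Basis]) (auto simp: axis_in_Basis_iff)
    moreover have "inj_on ?e J" by (auto simp: inj_on_def axis_eq_axis)
    ultimately show ?thesis by (simp add: dim_eq_card_independent card_image)
  qed
  ultimately show ?thesis by (metis dim_span)
qed

lemma span_differences_base:
  fixes S :: "'a::euclidean_space set"
  assumes "p \<in> S"
  shows "span {x - y |x y. x \<in> S \<and> y \<in> S} = span {x - p |x. x \<in> S}"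
proof (intro span_eq[THEN iffD2] conjI)
  show "{x - y |x y. x \<in> S \<and> y \<in> S} \<subseteq> span {x - p |x. x \<in> S}"
  proof safe
    fix x y assume "x \<in> S" "y \<in> S"
    then have "(x - p) - (y - p) \<in> span {x - p |x. x \<in> S}"
      by (intro span_diff span_base) auto
    then show "x - y \<in> span {x - p |x. x \<in> S}" by simp
  qed
  show "{x - p |x. x \<in> S} \<subseteq> span {x - y |x y. x \<in> S \<and> y \<in> S}"
    using assms by (auto intro: span_base)
qed

lemma aff_dim_eq_dim_span_differences:
  fixes S :: "'a::euclidean_space set"
  assumes "p \<in> S"
  shows "aff_dim S = int (dim (span {x - y |x y. x \<in> S \<and> y \<in> S}))"
proof -
  have "(+) (- p) ` S = {x - p |x. x \<in> S}" by auto
  moreover have "aff_dim S = int (dim ((+) (- p) ` S))"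
    by (rule aff_dim_eq_dim) (use assms in \<open>simp add: hull_inc\<close>)
  ultimately show ?thesis by (simp add: span_differences_base[OF assms])
qed

lemma affine_hull_of_span_differences:
  fixes S :: "'a::euclidean_space set"
  assumes "p \<in> S" "q - p \<in> span {x - y |x y. x \<in> S \<and> y \<in> S}"
  shows "q \<in> affine hull S"
proof -
  have "{x - p |x. x \<in> S} \<subseteq> insert 0 {x - p |x. x \<in> S - {p}}" by auto
  then have "span {x - p |x. x \<in> S} \<subseteq> span {x - p |x. x \<in> S - {p}}"
    by (metis (no_types, lifting) span_insert_0 span_mono)
  then have "q - p \<in> span {x - p |x. x \<in> S - {p}}"
    using assms by (auto simp: span_differences_base)
  then show ?thesis
    unfolding affine_hull_span[OF assms(1)] by (intro CollectI exI[of _ "q - p"]) simp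
qed

section \<open>Cells, their dimensions and their facets\<close>

lemma card_pos_nonempty: "0 < card A \<Longrightarrow> A \<noteq> {}"
  by auto

lemma lookup_total_le: "lookup a i \<le> total a" for a :: "'n::finite expo"
  unfolding total_def by (rule member_le_sum) auto

lemma hyper_cell_point:
  assumes "total a = d" shows "hyper_cell d (a, {}) = {expo_vec a}"
proof -
  have "{expo_vec a + ind_vec L |L. L \<subseteq> {} \<and> total a + card L = d} = {expo_vec a}"
    using assms by (auto simp: Finite_Cartesian_Product.vec_eq_iff)
  then show ?thesis by (simp add: hyper_cell_eq)
qed

lemma cells_hypersimplicial:
  "(a, J) \<in> cells (hypersimplicial d) \<longleftrightarrow> total a = d \<and> J = {} \<or> total a < d \<and> d < total a + card J"
  by (auto simp: hypersimplicial_def)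

lemma pol_hypersimplicial: "pol (hypersimplicial d) = hyper_cell d"
  by (simp add: hypersimplicial_def)

lemma mdeg_hypersimplicial: "mdeg (hypersimplicial d) (a, J) = a + (\<Sum>j\<in>J. single j 1)"
  by (simp add: hypersimplicial_def)

lemma hyper_cell_nonempty:
  assumes "total a \<le> d" "d \<le> total a + card J"
  shows "\<exists>L\<subseteq>J. total a + card L = d"
proof -
  have "d - total a \<le> card J" using assms by linarith
  then obtain L where "L \<subseteq> J" "card L = d - total a" by (meson obtain_subset_with_card_n)
  then show ?thesis using assms by auto
qed

lemma cdim_hypersimplicial:
  assumes "(a, J) \<in> cells (hypersimplicial d)"
  shows "cdim (hypersimplicial d) (a, J) = (if J = {} then 0 else int (card J) - 1)"
proof (cases "total a = d \<and> J = {}")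
  case True
  then show ?thesis by (simp add: cdim_def pol_hypersimplicial hyper_cell_point)
next
  case False
  then have *: "total a < d" "d < total a + card J" using assms by (auto simp: cells_hypersimplicial)
  then have "J \<noteq> {}" by auto
  obtain L where "L \<subseteq> J" "total a + card L = d"
    using hyper_cell_nonempty[of a d J] * by auto
  then have "expo_vec a + ind_vec L \<in> hyper_cell d (a, J)" by (rule hyper_cell_vertex)
  then have "aff_dim (hyper_cell d (a, J)) = int (dim (sum_zero J))"
    by (simp only: aff_dim_eq_dim_span_differences span_differences_hyper_cell[OF *])
  then show ?thesis
    using dim_sum_zero[OF \<open>J \<noteq> {}\<close>] \<open>J \<noteq> {}\<close> by (simp add: cdim_def pol_hypersimplicial)
qed

lemma cells_card_ge_2:
  "(a, J) \<in> cells (hypersimplicial d) \<Longrightarrow> J \<noteq> {} \<Longrightarrow> 2 \<le> card J"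
  by (auto simp: cells_hypersimplicial)

text \<open>The face of a hypersimplex cell on which a coordinate is constant, where a singleton \<open>K\<close>
  stands for the vertex \<open>a + \<epsilon>\<^sub>k\<close>.\<close>

definition cell_of :: "'n::finite expo \<Rightarrow> 'n set \<Rightarrow> 'n hcell"
  where "cell_of a K = (if card K = 1 then (a + (\<Sum>k\<in>K. single k 1), {}) else (a, K))"

lemma cell_of_singleton [simp]: "cell_of a {k} = (a + single k 1, {})"
  by (simp add: cell_of_def)

lemma cell_of_card: "card K \<noteq> 1 \<Longrightarrow> cell_of a K = (a, K)"
  by (simp add: cell_of_def)

lemma mdeg_cell_of: "mdeg (hypersimplicial d) (cell_of a K) = a + (\<Sum>j\<in>K. single j 1)"
  by (auto simp: cell_of_def mdeg_hypersimplicial)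

text \<open>A facet lies on y_j = a_j or on y_j = a_j + 1. The side conditions discard faces of too
  small a dimension: y_j = a_j keeps a hypersimplex if d - |a| < card J - 1, and also if d - |a| =
  1, where card J = 2 gives the end of an edge; y_j = a_j + 1 requires d - |a| > 1.\<close>

definition is_facet :: "nat \<Rightarrow> 'n::finite hcell \<Rightarrow> 'n hcell \<Rightarrow> bool"
  where "is_facet d = (\<lambda>(a, J) c'. \<exists>j\<in>J.
    c' = cell_of a (J - {j}) \<and> (d = Suc (total a) \<or> Suc d < total a + card J) \<or>
    c' = (a + single j 1, J - {j}) \<and> Suc (total a) < d)"

lemma facet_in_face_graph:
  assumes c: "(a, J) \<in> cells (hypersimplicial d)" and J: "J \<noteq> {}" and f: "is_facet d (a, J) c'"
  shows "((a, J), c') \<in> face_graph (hypersimplicial d)"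
proof -
  have *: "total a < d" "d < total a + card J" using c J by (auto simp: cells_hypersimplicial)
  obtain j where j: "j \<in> J" and alt: "c' = cell_of a (J - {j}) \<and> (d = Suc (total a) \<or> Suc d < total a + card J) \<or>
    c' = (a + single j 1, J - {j}) \<and> Suc (total a) < d"
    using f unfolding is_facet_def by blast
  from alt have "c' \<in> cells (hypersimplicial d) \<and> hyper_cell d c' \<subseteq> hyper_cell d (a, J) \<and>
      cdim (hypersimplicial d) c' = int (card J) - 2"
  proof
    assume "c' = cell_of a (J - {j}) \<and> (d = Suc (total a) \<or> Suc d < total a + card J)"
    then have c': "c' = cell_of a (J - {j})" and r: "d = Suc (total a) \<or> Suc d < total a + card J" by auto
    have cardJ: "card (J - {j}) = card J - 1" using j by simp
    show ?thesis
    proof (cases "card (J - {j}) = 1")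
      case True
      then obtain k where k: "J - {j} = {k}" by (rule card_1_singletonE)
      then have c'k: "c' = (a + single k 1, {})" by (simp add: c')
      have cJ: "card J = 2" using True cardJ by linarith
      then have d: "d = Suc (total a)" using * by linarith
      then have cell: "c' \<in> cells (hypersimplicial d)" by (simp add: c'k cells_hypersimplicial total_plus)
      have "expo_vec (a + single k 1) \<in> hyper_cell d (a, J)"
        unfolding expo_vec_add_single by (rule hyper_cell_vertex) (use k d in auto)
      then have "hyper_cell d c' \<subseteq> hyper_cell d (a, J)"
        using d by (simp add: c'k hyper_cell_point total_plus)
      then show ?thesis
        using cell cJ cdim_hypersimplicial[OF cell[unfolded c'k]] by (simp add: c'k)
    next
      case False
      then have c'k: "c' = (a, J - {j})" by (simp add: c' cell_of_card)
      have "card J \<ge> 3" using False cardJ * by linarith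
      then have "J - {j} \<noteq> {}" using cardJ by (intro card_pos_nonempty) linarith
      have "total a < d" "d < total a + card (J - {j})" using * r cardJ \<open>3 \<le> card J\<close> by linarith+
      then have cell: "c' \<in> cells (hypersimplicial d)" by (simp add: c'k cells_hypersimplicial)
      have "hyper_cell d c' \<subseteq> hyper_cell d (a, J)"
        unfolding c'k hyper_cell_eq by (rule hull_mono) auto
      then show ?thesis
        using cell cdim_hypersimplicial[OF cell[unfolded c'k]] \<open>J - {j} \<noteq> {}\<close> cardJ \<open>card J \<ge> 3\<close>
        by (simp add: c'k of_nat_diff)
    qed
  next
    assume "c' = (a + single j 1, J - {j}) \<and> Suc (total a) < d"
    then have c': "c' = (a + single j 1, J - {j})" and r: "Suc (total a) < d" by auto
    have cell: "c' \<in> cells (hypersimplicial d)"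
      using * j r by (simp add: c' cells_hypersimplicial total_plus)
    have "card J \<ge> 3" using * r by linarith
    then have "2 \<le> card (J - {j})" using j by simp
    then have "J - {j} \<noteq> {}" by (intro card_pos_nonempty) linarith
    then have "cdim (hypersimplicial d) c' = int (card J) - 2"
      using cdim_hypersimplicial[OF cell[unfolded c']] j \<open>card J \<ge> 3\<close> by (simp add: c' of_nat_diff)
    moreover have "hyper_cell d c' \<subseteq> hyper_cell d (a, J)"
      unfolding c' hyper_cell_eq
    proof (intro hull_mono subsetI)
      fix x assume "x \<in> {expo_vec (a + single j 1) + ind_vec L |L. L \<subseteq> J - {j} \<and> total (a + single j 1) + card L = d}"
      then obtain L where L: "L \<subseteq> J - {j}" "total a + Suc (card L) = d"
        and x: "x = expo_vec (a + single j 1) + ind_vec L" by (auto simp: total_plus)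
      have "x = expo_vec a + ind_vec (insert j L)"
        using L(1) by (auto simp: x expo_vec_add_single Finite_Cartesian_Product.vec_eq_iff)
      moreover have "card (insert j L) = Suc (card L)" using L(1) by (intro card_insert_disjoint) auto
      ultimately show "x \<in> {expo_vec a + ind_vec L |L. L \<subseteq> J \<and> total a + card L = d}"
        using L j by (intro CollectI exI[of _ "insert j L"]) auto
    qed
    ultimately show ?thesis using cell by blast
  qed
  then show ?thesis
    using c cdim_hypersimplicial[OF c] J by (simp add: face_graph_def pol_hypersimplicial)
qed

text \<open>Over the vertices of the smaller cell a coordinate i in J' takes two values one apart;
  they fit into the range of the larger cell only if i lies in J and a'_i = a_i. By dimension J'
  misses exactly one j of J, and only a'_j is left to determine.\<close>

lemma face_graph_facet:
  assumes "((a, J), (a', J')) \<in> face_graph (hypersimplicial d)"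
  shows "J \<noteq> {} \<and> is_facet d (a, J) (a', J')"
proof -
  have c: "(a, J) \<in> cells (hypersimplicial d)" and c': "(a', J') \<in> cells (hypersimplicial d)"
    and sub: "hyper_cell d (a', J') \<subseteq> hyper_cell d (a, J)"
    and dim: "cdim (hypersimplicial d) (a', J') = cdim (hypersimplicial d) (a, J) - 1"
    using assms by (auto simp: face_graph_def pol_hypersimplicial)
  have J: "J \<noteq> {}"
    using dim cdim_hypersimplicial[OF c] cdim_hypersimplicial[OF c'] cells_card_ge_2[OF c'] by (auto split: if_splits)
  have *: "total a < d" "d < total a + card J" using c J by (auto simp: cells_hypersimplicial)
  have eqI: "a' = a + single j 1"
    if "\<And>i. i \<noteq> j \<Longrightarrow> lookup a' i = lookup a i" "lookup a' j = lookup a j + 1" for j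
    by (rule poly_mapping_eqI) (use that in \<open>auto simp: lookup_add lookup_single when_def\<close>)
  show ?thesis
  proof (cases "J' = {}")
    case True
    then have cJ: "card J = 2"
      using dim cdim_hypersimplicial[OF c] cdim_hypersimplicial[OF c'] J by simp
    then have d: "d = Suc (total a)" using * by linarith
    have ta': "total a' = d" using c' True by (auto simp: cells_hypersimplicial)
    then have y: "expo_vec a' \<in> hyper_cell d (a, J)"
      using sub True by (simp add: hyper_cell_point)
    have le: "lookup a i \<le> lookup a' i" for i using hyper_cell_bounds(2)[OF y, of i] by simp
    have out: "lookup a' i = lookup a i" if "i \<notin> J" for i using hyper_cell_bounds(1)[OF y that] by simp
    \<comment> \<open>The coordinate bounds make this truncated difference exact. It has degree 1,
      so it is a unit vector.\<close>
    define b where "b = a' - a"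
    have a': "a' = a + b"
      unfolding b_def by (rule poly_mapping_eqI) (use le in \<open>simp add: lookup_add lookup_minus\<close>)
    then have tb: "total b = 1" using d ta' total_plus[of a b] by simp
    then have "b \<noteq> 0" by auto
    then obtain k where k: "k \<in> keys b" by fastforce
    then have "total (b - single k 1) = 0" using total_diff_single[OF k] tb by simp
    then have "b = single k 1" using diff_single_add[OF k] by (simp add: total_eq_0_iff)
    moreover have "k \<in> J"
      using out[of k] k by (auto simp: a' lookup_add in_keys_iff)
    moreover have "card (J - {k}) = 1" using cJ \<open>k \<in> J\<close> by simp
    then obtain j where "J - {k} = {j}" by (rule card_1_singletonE)
    ultimately have "j \<in> J" "J - {j} = {k}" by auto
    then have "is_facet d (a, J) (a', J')"
      unfolding is_facet_def prod.case
      using d True a' \<open>b = single k 1\<close> by (intro bexI[of _ j]) auto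
    then show ?thesis using J by simp
  next
    case False
    have st: "total a' < d" "d < total a' + card J'" using c' False by (auto simp: cells_hypersimplicial)
    have cJ': "card J = Suc (card J')"
      using dim cdim_hypersimplicial[OF c] cdim_hypersimplicial[OF c'] J False by simp
    have sep: "\<exists>L\<subseteq>J'. total a' + card L = d \<and> i \<in> L \<and> k \<notin> L" if ik: "i \<in> J'" "k \<in> J'" "i \<noteq> k" for i k
    proof -
      have "1 \<le> d - total a'" "Suc (d - total a') \<le> card J'" using st by linarith+
      then obtain L where L: "L \<subseteq> J'" "card L = d - total a'" "i \<in> L" "k \<notin> L"
        using exists_subset_between[OF ik] by blast
      then have "total a' + card L = d" using st by simp
      then show ?thesis using L by blast
    qed
    have two: "\<exists>k\<in>J'. k \<noteq> i" for i
    proof (rule ccontr)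
      assume "\<not> (\<exists>k\<in>J'. k \<noteq> i)"
      then have "J' \<subseteq> {i}" by blast
      then have "card J' \<le> 1" by (metis card_mono finite.emptyI finite_insert is_singletonI is_singleton_altdef)
      then show False using st by linarith
    qed
    have inside: "i \<in> J \<and> lookup a' i = lookup a i" if i: "i \<in> J'" for i
    proof -
      obtain k where k: "k \<in> J'" "k \<noteq> i" using two by blast
      obtain L1 where L1: "L1 \<subseteq> J'" "total a' + card L1 = d" "i \<in> L1" using sep[OF i k(1)] k by blast
      obtain L2 where L2: "L2 \<subseteq> J'" "total a' + card L2 = d" "i \<notin> L2" using sep[OF k(1) i k(2)] by blast
      have y1: "expo_vec a' + ind_vec L1 \<in> hyper_cell d (a, J)"
        using hyper_cell_vertex[OF L1(1,2)] sub by blast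
      have y2: "expo_vec a' + ind_vec L2 \<in> hyper_cell d (a, J)"
        using hyper_cell_vertex[OF L2(1,2)] sub by blast
      have "i \<in> J"
        using hyper_cell_bounds(1)[OF y1, of i] hyper_cell_bounds(1)[OF y2, of i] L1 L2 by auto
      moreover have "lookup a' i = lookup a i"
        using hyper_cell_bounds(3)[OF y1, of i] hyper_cell_bounds(2)[OF y2, of i] L1 L2 by simp
      ultimately show ?thesis by blast
    qed
    then have "J' \<subseteq> J" by blast
    then have "card (J - J') = 1" using cJ' by (simp add: card_Diff_subset)
    then obtain j where "J - J' = {j}" by (rule card_1_singletonE)
    then have j: "j \<in> J" "J' = J - {j}" using \<open>J' \<subseteq> J\<close> by auto
    obtain L where L: "L \<subseteq> J'" "total a' + card L = d"
      using hyper_cell_nonempty[of a' d J'] st by auto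
    then have y: "expo_vec a' + ind_vec L \<in> hyper_cell d (a, J)" using hyper_cell_vertex sub by blast
    have other: "lookup a' i = lookup a i" if "i \<noteq> j" for i
    proof (cases "i \<in> J'")
      case False
      then have "i \<notin> J" using that j by blast
      moreover have "i \<notin> L" using False L by blast
      ultimately show ?thesis using hyper_cell_bounds(1)[OF y, of i] by simp
    qed (use inside in blast)
    have "j \<notin> L" using L j by blast
    then have "lookup a' j = lookup a j \<or> lookup a' j = lookup a j + 1"
      using hyper_cell_bounds(2,3)[OF y, of j] by simp linarith
    then have "a' = a \<or> a' = a + single j 1"
    proof
      assume "lookup a' j = lookup a j"
      then have "a' = a" using other by (intro poly_mapping_eqI) metis
      then show ?thesis ..
    qed (use eqI other in blast)
    moreover have "card J' = card J - 1" "card J' \<noteq> 1" using cJ' st by auto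
    ultimately have "is_facet d (a, J) (a', J')"
    proof (elim disjE)
      assume "a' = a" "card J' \<noteq> 1"
      moreover from this have "Suc d < total a + card J" using st cJ' by simp
      ultimately show ?thesis
        unfolding is_facet_def prod.case using j by (intro bexI[of _ j]) (simp_all add: cell_of_card)
    next
      assume "a' = a + single j 1"
      moreover from this have "Suc (total a) < d" using st by (simp add: total_plus)
      ultimately show ?thesis
        unfolding is_facet_def prod.case using j by (intro bexI[of _ j]) simp_all
    qed
    then show ?thesis using J by simp
  qed
qed

lemma face_graph_iff:
  "(c, c') \<in> face_graph (hypersimplicial d) \<longleftrightarrow>
    c \<in> cells (hypersimplicial d) \<and> snd c \<noteq> {} \<and> is_facet d c c'"
proof
  assume e: "(c, c') \<in> face_graph (hypersimplicial d)"
  then show "c \<in> cells (hypersimplicial d) \<and> snd c \<noteq> {} \<and> is_facet d c c'"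
    using face_graph_facet[of "fst c" "snd c" "fst c'" "snd c'" d] by (simp add: face_graph_def)
next
  assume "c \<in> cells (hypersimplicial d) \<and> snd c \<noteq> {} \<and> is_facet d c c'"
  then show "(c, c') \<in> face_graph (hypersimplicial d)"
    using facet_in_face_graph[of "fst c" "snd c" d c'] by simp
qed

section \<open>Orientations and incidence numbers\<close>

definition coord_det :: "'n::finite list \<Rightarrow> (real ^ 'n) list \<Rightarrow> real"
  where "coord_det js ws = Determinant.det (Matrix.mat (length js) (length js) (\<lambda>(a, b). vec_nth (ws ! b) (js ! a)))"

text \<open>On \<open>sum_zero J\<close> the coordinate at the smallest element of \<open>J\<close> is redundant.\<close>

definition orient_det :: "'n::{finite,linorder} set \<Rightarrow> (real ^ 'n::{finite,linorder}) list \<Rightarrow> real"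
  where "orient_det J ws = coord_det (tl (sorted_list_of_set J)) ws"

definition int_sgn :: "real \<Rightarrow> int"
  where "int_sgn x = (if x > 0 then 1 else if x < 0 then - 1 else 0)"

lemma int_sgn_mult: "int_sgn (x * y) = int_sgn x * int_sgn y"
  by (auto simp: int_sgn_def zero_less_mult_iff mult_less_0_iff)

lemma int_sgn_one [simp]: "int_sgn 1 = 1" "int_sgn (- 1) = - 1"
  by (simp_all add: int_sgn_def)

lemma int_sgn_sq: "x \<noteq> 0 \<Longrightarrow> int_sgn x * int_sgn x = 1"
  by (auto simp: int_sgn_def)

lemma int_sgn_rem_sign [simp]: "int_sgn (rem_sign J j) = rem_sign J j"
proof -
  have "int_sgn ((- 1) ^ k) = (- 1) ^ k" for k
    by (cases "even k") simp_all
  then show ?thesis by (simp add: rem_sign_def)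
qed

lemma coord_det_Nil [simp]: "coord_det [] ws = 1"
  by (simp add: coord_det_def det_def sign_def)

text \<open>The coordinate matrix of ws is that of vs times the matrix of representations, whose
  determinant is the one that \<open>orientation_sign\<close> looks at.\<close>

lemma coord_det_basis_change:
  assumes vs: "distinct vs" "independent (set vs)" "length vs = length js"
    and ws: "set ws \<subseteq> span (set vs)" "length ws = length js"
  shows "coord_det js ws = coord_det js vs * Determinant.det (Matrix.mat (length vs) (length vs)
    (\<lambda>(i, j). representation (set vs) (ws ! j) (vs ! i)))"
proof -
  let ?m = "length vs"
  let ?M = "\<lambda>ws :: (real ^ 'a) list. Matrix.mat ?m ?m (\<lambda>(a, b). vec_nth (ws ! b) (js ! a))"
  let ?R = "Matrix.mat ?m ?m (\<lambda>(i, j). representation (set vs) (ws ! j) (vs ! i))"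
  have "?M ws = ?M vs * ?R"
  proof (rule eq_matI)
    fix a b assume "a < dim_row (?M vs * ?R)" "b < dim_col (?M vs * ?R)"
    then have ab: "a < ?m" "b < ?m" by auto
    then have "ws ! b \<in> span (set vs)" using ws vs by (auto simp: subset_iff)
    then have "ws ! b = (\<Sum>v\<in>set vs. representation (set vs) (ws ! b) v *\<^sub>R v)"
      by (intro sum_representation_eq[symmetric] vs) auto
    also have "\<dots> = (\<Sum>i<?m. representation (set vs) (ws ! b) (vs ! i) *\<^sub>R (vs ! i))"
      by (rule sum.reindex_bij_betw[symmetric]) (use vs(1) in \<open>simp add: bij_betw_nth\<close>)
    finally have "vec_nth (ws ! b) (js ! a) =
        vec_nth (\<Sum>i<?m. representation (set vs) (ws ! b) (vs ! i) *\<^sub>R (vs ! i)) (js ! a)"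
      by (rule arg_cong)
    also have "\<dots> = (\<Sum>i<?m. representation (set vs) (ws ! b) (vs ! i) * vec_nth (vs ! i) (js ! a))"
      by simp
    finally have "vec_nth (ws ! b) (js ! a) =
        (\<Sum>i<?m. representation (set vs) (ws ! b) (vs ! i) * vec_nth (vs ! i) (js ! a))" .
    then show "?M ws $$ (a, b) = (?M vs * ?R) $$ (a, b)"
      using ab by (simp add: scalar_prod_def atLeast0LessThan mult.commute)
  qed auto
  then have "Determinant.det (?M ws) = Determinant.det (?M vs) * Determinant.det ?R"
    by (simp add: det_mult[of _ ?m])
  then show ?thesis using vs ws by (simp add: coord_det_def)
qed

lemma tl_sorted_list:
  fixes J :: "'n::{finite,linorder} set"
  assumes "J \<noteq> {}"
  shows "sorted_list_of_set J = Min J # tl (sorted_list_of_set J)"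
    "length (tl (sorted_list_of_set J)) = card J - 1"
    "distinct (tl (sorted_list_of_set J))" "set (tl (sorted_list_of_set J)) = J - {Min J}"
proof -
  have *: "sorted_list_of_set J = Min J # sorted_list_of_set (J - {Min J})"
    using sorted_list_of_set_nonempty[of J] assms by simp
  show "sorted_list_of_set J = Min J # tl (sorted_list_of_set J)" using * by simp
  show "length (tl (sorted_list_of_set J)) = card J - 1" by simp
  show "distinct (tl (sorted_list_of_set J))" unfolding * by simp
  show "set (tl (sorted_list_of_set J)) = J - {Min J}" unfolding * by simp
qed

text \<open>Measuring both bases against the coordinates splits the sign of a change of basis into a
  product. The determinant of vs cannot vanish, for the vectors axis j - axis (Min J) lie in the
  span of vs and have coordinate determinant 1.\<close>

lemma orient_det_nonzero_and_sign:
  fixes J :: "'n::{finite,linorder} set"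
  assumes J: "J \<noteq> {}" and vs: "distinct vs" "independent (set vs)" "span (set vs) = sum_zero J"
  shows "Suc (length vs) = card J" "orient_det J vs \<noteq> 0"
    "set ws \<subseteq> sum_zero J \<Longrightarrow> length ws = length vs \<Longrightarrow>
      orientation_sign vs ws = int_sgn (orient_det J vs) * int_sgn (orient_det J ws)"
proof -
  have "length vs = card (set vs)" using vs(1) by (simp add: distinct_card)
  also have "\<dots> = dim (sum_zero J)" using vs(2,3) by (metis dim_span_eq_card_independent)
  finally show len: "Suc (length vs) = card J" using dim_sum_zero[OF J] by simp
  let ?js = "tl (sorted_list_of_set J)"
  have len': "length vs = length ?js" using len by simp
  define ws0 where "ws0 = map (\<lambda>j. axis j 1 - axis (Min J) 1 :: real ^ 'n::{finite,linorder}) ?js"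
  have "coord_det ?js ws0 = 1"
  proof -
    have "Matrix.mat (length ?js) (length ?js) (\<lambda>(a, b). vec_nth (ws0 ! b) (?js ! a)) = 1\<^sub>m (length ?js)"
    proof (rule eq_matI)
      fix a b assume "a < dim_row (1\<^sub>m (length ?js) :: real mat)" "b < dim_col (1\<^sub>m (length ?js) :: real mat)"
      then have ab: "a < length ?js" "b < length ?js" by auto
      then have "?js ! a \<noteq> Min J" using tl_sorted_list(4)[OF J] nth_mem by blast
      moreover have "?js ! a = ?js ! b \<longleftrightarrow> a = b"
        using ab tl_sorted_list(3)[OF J] nth_eq_iff_index_eq by blast
      ultimately show "Matrix.mat (length ?js) (length ?js) (\<lambda>(a, b). vec_nth (ws0 ! b) (?js ! a)) $$ (a, b)
          = 1\<^sub>m (length ?js) $$ (a, b)"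
        using ab by (simp add: ws0_def axis_def)
    qed auto
    then show ?thesis by (simp add: coord_det_def)
  qed
  moreover have "set ws0 \<subseteq> span (set vs)"
  proof
    fix w assume "w \<in> set ws0"
    then obtain j where "j \<in> set ?js" and w: "w = axis j 1 - axis (Min J) 1" by (auto simp: ws0_def)
    then have j: "j \<in> J" "Min J \<in> J" using tl_sorted_list(4)[OF J] J by auto
    then have "(\<Sum>i\<in>J. vec_nth w i) = 0" by (simp add: w sum_subtractf axis_def)
    then show "w \<in> span (set vs)" unfolding vs(3) using j by (auto simp: sum_zero_def w axis_def)
  qed
  ultimately have "coord_det ?js vs * Determinant.det (Matrix.mat (length vs) (length vs)
    (\<lambda>(i, j). representation (set vs) (ws0 ! j) (vs ! i))) = 1"
    using coord_det_basis_change[OF vs(1,2) len', of ws0] by (simp add: ws0_def)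
  then show nz: "orient_det J vs \<noteq> 0" unfolding orient_det_def by auto
  assume ws: "set ws \<subseteq> sum_zero J" "length ws = length vs"
  have "int_sgn (orient_det J ws) = int_sgn (orient_det J vs) * orientation_sign vs ws"
    using coord_det_basis_change[OF vs(1,2) len', of ws] ws len' vs(3)
    by (simp add: orient_det_def int_sgn_mult orientation_sign_def Let_def) (simp add: int_sgn_def)
  then show "orientation_sign vs ws = int_sgn (orient_det J vs) * int_sgn (orient_det J ws)"
    using int_sgn_sq[OF nz] by (simp flip: mult.assoc)
qed

text \<open>Adding all rows to the first one clears it except for the leading entry.\<close>

lemma coord_det_Cons:
  fixes u :: "real ^ 'n::finite"
  assumes len: "length js = Suc (length ws)" and dist: "distinct js"
    and ws: "\<And>w. w \<in> set ws \<Longrightarrow> (\<Sum>j\<in>set js. vec_nth w j) = 0"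
  shows "coord_det js (u # ws) = (\<Sum>j\<in>set js. vec_nth u j) * coord_det (tl js) ws"
proof -
  let ?p = "length js"
  let ?M = "Matrix.mat ?p ?p (\<lambda>(a, b). vec_nth ((u # ws) ! b) (js ! a))"
  let ?P = "Matrix.mat ?p ?p (\<lambda>(a, b). if a = 0 \<or> a = b then 1 else 0 :: real)"
  have p: "0 < ?p" using len by simp
  have sum_js: "(\<Sum>i<?p. f (js ! i)) = (\<Sum>j\<in>set js. f j)" for f :: "'n \<Rightarrow> real"
    by (rule sum.reindex_bij_betw) (use dist in \<open>simp add: bij_betw_nth\<close>)
  have detP: "Determinant.det ?P = 1"
  proof -
    have "Determinant.det ?P = prod_list (diag_mat ?P)"
      by (rule det_upper_triangular[of _ ?p]) (auto simp: upper_triangular_def)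
    also have "diag_mat ?P = map (\<lambda>i. 1) [0..<?p]"
      unfolding diag_mat_def by (rule map_cong) auto
    finally show ?thesis by (simp add: prod_list_replicate map_replicate_const)
  qed
  have PM: "(?P * ?M) $$ (a, b) = (if a = 0 then (\<Sum>j\<in>set js. vec_nth ((u # ws) ! b) j) else vec_nth ((u # ws) ! b) (js ! a))"
    if "a < ?p" "b < ?p" for a b
  proof -
    have "(?P * ?M) $$ (a, b) = (\<Sum>i<?p. (if a = 0 \<or> a = i then 1 else 0) * vec_nth ((u # ws) ! b) (js ! i))"
      using that by (simp add: scalar_prod_def atLeast0LessThan)
    also have "\<dots> = (if a = 0 then (\<Sum>i<?p. vec_nth ((u # ws) ! b) (js ! i)) else vec_nth ((u # ws) ! b) (js ! a))"
      using that by (auto simp: if_distrib[of "\<lambda>x. x * _"] cong: if_cong)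
    finally show ?thesis by (simp only: sum_js)
  qed
  have "Determinant.det (?P * ?M) = (\<Sum>b<?p. (?P * ?M) $$ (0, b) * cofactor (?P * ?M) 0 b)"
    by (rule laplace_expansion_row) (use p in auto)
  also have "\<dots> = (\<Sum>b<?p. if b = 0 then (\<Sum>j\<in>set js. vec_nth u j) * cofactor (?P * ?M) 0 0 else 0)"
  proof (intro sum.cong refl)
    fix b assume b: "b \<in> {..<?p}"
    show "(?P * ?M) $$ (0, b) * cofactor (?P * ?M) 0 b = (if b = 0 then (\<Sum>j\<in>set js. vec_nth u j) * cofactor (?P * ?M) 0 0 else 0)"
    proof (cases "b = 0")
      case False
      then have "(u # ws) ! b \<in> set ws" using b len by (simp add: nth_Cons')
      then show ?thesis using PM[of 0 b] p b False ws by simp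
    qed (use PM[of 0 0] p in simp)
  qed
  also have "\<dots> = (\<Sum>j\<in>set js. vec_nth u j) * cofactor (?P * ?M) 0 0"
    using p by simp
  also have "cofactor (?P * ?M) 0 0 = coord_det (tl js) ws"
  proof -
    have "mat_delete (?P * ?M) 0 0 = Matrix.mat (length (tl js)) (length (tl js)) (\<lambda>(a, b). vec_nth (ws ! b) (tl js ! a))"
    proof (rule eq_matI)
      fix a b assume "a < dim_row (Matrix.mat (length (tl js)) (length (tl js)) (\<lambda>(a, b). vec_nth (ws ! b) (tl js ! a)))"
        "b < dim_col (Matrix.mat (length (tl js)) (length (tl js)) (\<lambda>(a, b). vec_nth (ws ! b) (tl js ! a)))"
      then have ab: "Suc a < ?p" "Suc b < ?p" by auto
      then have "mat_delete (?P * ?M) 0 0 $$ (a, b) = (?P * ?M) $$ (Suc a, Suc b)"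
        by (simp add: mat_delete_def)
      also have "\<dots> = vec_nth (ws ! b) (js ! Suc a)" using PM[OF ab] by simp
      finally show "mat_delete (?P * ?M) 0 0 $$ (a, b) =
          Matrix.mat (length (tl js)) (length (tl js)) (\<lambda>(a, b). vec_nth (ws ! b) (tl js ! a)) $$ (a, b)"
        using ab by (simp add: nth_tl)
    qed (auto simp: mat_delete_def)
    then show ?thesis by (simp add: cofactor_def coord_det_def)
  qed
  finally have "Determinant.det ?P * Determinant.det ?M = (\<Sum>j\<in>set js. vec_nth u j) * coord_det (tl js) ws"
    by (simp add: det_mult[of _ ?p])
  then show ?thesis by (simp add: detP coord_det_def)
qed

lemma sum_zero_mono: "K \<subseteq> J \<Longrightarrow> sum_zero K \<subseteq> sum_zero J"
  for J :: "'n::finite set"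
proof
  fix v assume K: "K \<subseteq> J" and v: "v \<in> sum_zero K"
  have "(\<Sum>i\<in>J. vec_nth v i) = (\<Sum>i\<in>K. vec_nth v i)"
    by (rule sum.mono_neutral_right) (use K v in \<open>auto simp: sum_zero_def\<close>)
  then show "v \<in> sum_zero J" using K v by (auto simp: sum_zero_def)
qed

text \<open>Locates j as the row deleted in a Laplace expansion; its position is the exponent of
  \<open>rem_sign\<close>.\<close>

lemma sorted_list_of_set_delete:
  fixes J :: "'n::{finite,linorder} set"
  assumes j: "j \<in> J"
  defines "js \<equiv> sorted_list_of_set J" and "a \<equiv> card {l \<in> J. l < j}"
  shows "a < length js" "js ! a = j" "sorted_list_of_set (J - {j}) = take a js @ drop (Suc a) js"
proof -
  obtain b where b: "b < length js" "js ! b = j"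
    using j by (metis finite in_set_conv_nth js_def set_sorted_list_of_set)
  have strict: "js ! i < js ! k \<longleftrightarrow> i < k" if "i < length js" "k < length js" for i k
  proof -
    have "sorted_wrt (<) js" by (simp add: js_def)
    then show ?thesis using that sorted_wrt_nth_less[of "(<)" js] by (metis linorder_neqE_nat order.asym)
  qed
  have "{l \<in> J. l < j} = (\<lambda>i. js ! i) ` {..<b}"
  proof (intro equalityI subsetI)
    fix l assume "l \<in> {l \<in> J. l < j}"
    then obtain i where "i < length js" "js ! i = l" "l < j"
      by (metis (no_types, lifting) finite in_set_conv_nth js_def mem_Collect_eq set_sorted_list_of_set)
    then show "l \<in> (\<lambda>i. js ! i) ` {..<b}" using strict b by auto
  next
    fix l assume "l \<in> (\<lambda>i. js ! i) ` {..<b}"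
    then obtain i where i: "i < b" "l = js ! i" by auto
    then have "l \<in> set js" "l < j" using strict[of i b] b by auto
    then show "l \<in> {l \<in> J. l < j}" by (simp add: js_def)
  qed
  moreover have "inj_on (\<lambda>i. js ! i) {..<b}"
    using strict b by (intro inj_onI) (metis lessThan_iff less_trans linorder_neqE_nat order_less_irrefl)
  ultimately have ab: "a = b" by (simp add: a_def card_image)
  then show a: "a < length js" "js ! a = j" using b by auto
  have "js = take a js @ j # drop (Suc a) js" using id_take_nth_drop[of a js] a by simp
  moreover have "j \<notin> set (take a js)"
    using strict a by (auto simp: in_set_conv_nth) (metis less_irrefl nth_take order.strict_trans)
  ultimately have "remove1 j js = take a js @ drop (Suc a) js"
    by (metis remove1.simps(2) remove1_append)
  then show "sorted_list_of_set (J - {j}) = take a js @ drop (Suc a) js"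
    by (simp add: sorted_list_of_set_remove js_def)
qed

text \<open>Only v has an entry at j, so expansion along the row of j leaves one cofactor. As
  \<open>orient_det\<close> omits the row of the minimum, which may be j itself, an auxiliary vector
  is put in front to restore the full square matrix and is stripped off again over J - {j}.\<close>

lemma orient_det_Cons:
  fixes J :: "'n::{finite,linorder} set"
  assumes j: "j \<in> J" and v: "v \<in> sum_zero J" and ws: "set ws \<subseteq> sum_zero (J - {j})"
    and len: "card J = Suc (Suc (length ws))"
  shows "orient_det J (v # ws) = - vec_nth v j * rem_sign J j * orient_det (J - {j}) ws"
proof -
  have "card (J - {j}) = Suc (length ws)" using len j by simp
  then have "J - {j} \<noteq> {}" by (intro card_pos_nonempty) simp
  then obtain k where k: "k \<in> J" "k \<noteq> j" by blast
  \<comment> \<open>Any k in J other than j serves: the coordinate sum is 1 over J as well as over J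
    - {j}, and the entry at j is 0.\<close>
  define u where "u = (axis k 1 :: real ^ 'n::{finite,linorder})"
  define js where "js = sorted_list_of_set J"
  define a where "a = card {l \<in> J. l < j}"
  have js: "set js = J" "distinct js" "length js = card J" by (simp_all add: js_def)
  have a: "a < length js" "js ! a = j" and del: "sorted_list_of_set (J - {j}) = take a js @ drop (Suc a) js"
    using sorted_list_of_set_delete[OF j] unfolding js_def a_def by auto
  have wsJ: "set ws \<subseteq> sum_zero J" using ws sum_zero_mono[of "J - {j}" J] by blast
  have sum_u: "(\<Sum>i\<in>J. vec_nth u i) = 1" "(\<Sum>i\<in>J - {j}. vec_nth u i) = 1"
    using k by (simp_all add: u_def axis_def)
  let ?p = "length js"
  let ?M = "Matrix.mat ?p ?p (\<lambda>(a, b). vec_nth ((u # v # ws) ! b) (js ! a))"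
  have "orient_det J (v # ws) = coord_det js (u # v # ws)"
  proof -
    have "(\<Sum>i\<in>set js. vec_nth w i) = 0" if "w \<in> set (v # ws)" for w
    proof -
      have "w \<in> sum_zero J" using that v wsJ by auto
      then show ?thesis by (simp add: sum_zero_def js)
    qed
    then have "coord_det js (u # v # ws) = (\<Sum>j\<in>set js. vec_nth u j) * coord_det (tl js) (v # ws)"
      by (intro coord_det_Cons) (use js len in auto)
    then show ?thesis by (simp add: js(1) sum_u orient_det_def js_def)
  qed
  also have "\<dots> = Determinant.det ?M" by (simp add: coord_det_def)
  also have "\<dots> = (\<Sum>b<?p. ?M $$ (a, b) * cofactor ?M a b)"
    by (rule laplace_expansion_row) (use a in auto)
  also have "\<dots> = (\<Sum>b<?p. if b = 1 then vec_nth v j * cofactor ?M a 1 else 0)"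
  proof (intro sum.cong refl)
    fix b assume b: "b \<in> {..<?p}"
    have "?M $$ (a, b) = vec_nth ((u # v # ws) ! b) j" using b a by simp
    also have "\<dots> = (if b = 1 then vec_nth v j else 0)"
    proof -
      consider "b = 0" | "b = 1" | i where "b = Suc (Suc i)" by (metis One_nat_def not0_implies_Suc)
      then show ?thesis
      proof cases
        case 1 then show ?thesis using k by (simp add: u_def axis_def)
      next
        case 3
        then have "ws ! i \<in> set ws" using b len js by simp
        then have "vec_nth (ws ! i) j = 0" using ws by (auto simp: sum_zero_def)
        then show ?thesis using 3 by simp
      qed simp
    qed
    finally show "?M $$ (a, b) * cofactor ?M a b = (if b = 1 then vec_nth v j * cofactor ?M a 1 else 0)" by simp
  qed
  also have "\<dots> = vec_nth v j * cofactor ?M a 1"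
  proof -
    have "1 < ?p" using len js by simp
    then show ?thesis by (simp only: sum.delta finite_lessThan lessThan_iff if_True)
  qed
  \<comment> \<open>Behind u the vector v occupies column 1, and this is the origin of the minus
    sign in the statement.\<close>
  also have "cofactor ?M a 1 = (- 1) ^ (a + 1) * coord_det (sorted_list_of_set (J - {j})) (u # ws)"
  proof -
    let ?js' = "sorted_list_of_set (J - {j})"
    have len': "Suc (length ?js') = ?p" unfolding del using a by simp
    have "mat_delete ?M a 1 = Matrix.mat (length ?js') (length ?js') (\<lambda>(a, b). vec_nth ((u # ws) ! b) (?js' ! a))" (is "_ = ?N")
    proof (rule eq_matI)
      fix i b assume "i < dim_row ?N" "b < dim_col ?N"
      then have ib: "i < length ?js'" "b < length ?js'" by auto
      then have "mat_delete ?M a 1 $$ (i, b) = ?M $$ (if i < a then i else Suc i, if b < 1 then b else Suc b)"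
        using len' by (simp add: mat_delete_def)
      also have "\<dots> = vec_nth ((u # v # ws) ! (if b < 1 then b else Suc b)) (js ! (if i < a then i else Suc i))"
      proof -
        have "(if i < a then i else Suc i) < ?p" "(if b < 1 then b else Suc b) < ?p" using ib len' by auto
        then show ?thesis by (simp only: index_mat(1) prod.case)
      qed
      also have "(u # v # ws) ! (if b < 1 then b else Suc b) = (u # ws) ! b"
        by (cases b) auto
      also have "js ! (if i < a then i else Suc i) = ?js' ! i"
        unfolding del using a ib len' by (auto simp: nth_append)
      finally show "mat_delete ?M a 1 $$ (i, b) = ?N $$ (i, b)" using ib by simp
    qed (use len' in \<open>auto simp: mat_delete_def\<close>)
    then show ?thesis by (simp add: cofactor_def coord_det_def)
  qed
  also have "coord_det (sorted_list_of_set (J - {j})) (u # ws) = orient_det (J - {j}) ws"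
  proof -
    have "coord_det (sorted_list_of_set (J - {j})) (u # ws) =
        (\<Sum>i\<in>set (sorted_list_of_set (J - {j})). vec_nth u i) * coord_det (tl (sorted_list_of_set (J - {j}))) ws"
    proof (rule coord_det_Cons)
      fix w assume "w \<in> set ws"
      then show "(\<Sum>i\<in>set (sorted_list_of_set (J - {j})). vec_nth w i) = 0"
        using ws by (auto simp: sum_zero_def)
    qed (use len j in \<open>simp_all\<close>)
    then show ?thesis by (simp add: sum_u orient_det_def)
  qed
  finally show ?thesis by (simp add: rem_sign_def a_def power_add)
qed


text \<open>Compares the chosen orientation with the coordinate one. These signs form the diagonal
  change of basis that absorbs the choice of \<open>ori\<close>.\<close>

definition cell_sign :: "('n::{finite,linorder} hcell \<Rightarrow> (real ^ 'n::{finite,linorder}) list) \<Rightarrow> 'n hcell \<Rightarrow> int"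
  where "cell_sign ori c = int_sgn (if snd c = {} then 1 else orient_det (snd c) (ori c))"

lemma pol_differences:
  assumes "(a, J) \<in> cells (hypersimplicial d)"
  shows "span {p - q |p q. p \<in> hyper_cell d (a, J) \<and> q \<in> hyper_cell d (a, J)} = (if J = {} then {0} else sum_zero J)"
proof (cases "J = {}")
  case True
  then have "hyper_cell d (a, J) = {expo_vec a}"
    using assms hyper_cell_point[of a d] by (auto simp: cells_hypersimplicial)
  then show ?thesis using True by simp
next
  case False
  then show ?thesis using assms by (simp add: cells_hypersimplicial span_differences_hyper_cell)
qed

lemma sum_zero_singleton: "sum_zero {k} = {0}"
  by (auto simp: sum_zero_def Finite_Cartesian_Product.vec_eq_iff)

context
  fixes d :: nat and ori :: "'n::{finite,linorder} hcell \<Rightarrow> (real ^ 'n::{finite,linorder}) list"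
  assumes ori: "oriented (hypersimplicial d) ori"
begin

lemma ori_basis:
  assumes c: "(a, J) \<in> cells (hypersimplicial d)" and J: "J \<noteq> {}"
  shows "distinct (ori (a, J))" "independent (set (ori (a, J)))" "span (set (ori (a, J))) = sum_zero J"
  using ori c pol_differences[OF c] J unfolding oriented_def by (auto simp: pol_hypersimplicial)

lemma ori_vertex:
  assumes c: "(a, {}) \<in> cells (hypersimplicial d)"
  shows "ori (a, {}) = []"
proof -
  have "independent (set (ori (a, {})))" "span (set (ori (a, {}))) = {0}"
    using ori c pol_differences[OF c] unfolding oriented_def by (auto simp: pol_hypersimplicial)
  then have "set (ori (a, {})) \<subseteq> {0}" "0 \<notin> set (ori (a, {}))"
    using span_superset dependent_zero by blast+
  then show ?thesis by (metis set_empty subset_singletonD singletonI)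
qed

lemma cell_sign_sq:
  assumes c: "c \<in> cells (hypersimplicial d)"
  shows "cell_sign ori c * cell_sign ori c = 1"
proof -
  obtain a J where aJ: "c = (a, J)" by (cases c)
  show ?thesis
  proof (cases "J = {}")
    case False
    then show ?thesis
      using orient_det_nonzero_and_sign(2)[OF False ori_basis[OF c[unfolded aJ] False]]
      by (simp add: cell_sign_def aJ int_sgn_sq)
  qed (simp add: cell_sign_def aJ)
qed

text \<open>The outward vector is an arbitrary choice, but only the sign of its coordinate \<open>j\<close> matters.
  A singleton \<open>J - {j}\<close> stands for a vertex.\<close>

lemma incidence_facet:
  assumes e: "((a, J), c') \<in> face_graph (hypersimplicial d)" and j: "j \<in> J"
    and c': "snd c' = (if card (J - {j}) = 1 then {} else J - {j})"
    and t: "\<And>p. p \<in> hyper_cell d c' \<Longrightarrow> vec_nth p j = t"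
    and q0: "q0 \<in> hyper_cell d (a, J)" "vec_nth q0 j \<noteq> t"
    and s: "\<And>q. q \<in> hyper_cell d (a, J) \<Longrightarrow> vec_nth q j \<noteq> t \<Longrightarrow> int_sgn (vec_nth q j - t) = s"
  shows "incidence (hypersimplicial d) ori (a, J) c' = cell_sign ori (a, J) * cell_sign ori c' * (s * rem_sign J j)"
proof -
  have c: "(a, J) \<in> cells (hypersimplicial d)" and cell': "c' \<in> cells (hypersimplicial d)"
    and sub: "hyper_cell d c' \<subseteq> hyper_cell d (a, J)"
    using e by (auto simp: face_graph_def pol_hypersimplicial)
  have J: "J \<noteq> {}" using j by blast
  let ?K = "J - {j}"
  have "2 \<le> card J" using cells_card_ge_2[OF c J] .
  then have cardK: "card J = Suc (card ?K)" "?K \<noteq> {}"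
    using j by (simp, intro card_pos_nonempty) simp
  obtain a' where a': "c' = (a', if card ?K = 1 then {} else ?K)" using c' by (cases c') auto
  have span': "span {p - q |p q. p \<in> hyper_cell d c' \<and> q \<in> hyper_cell d c'} = sum_zero ?K"
  proof (cases "card ?K = 1")
    case True
    then obtain k where "?K = {k}" by (rule card_1_singletonE)
    then show ?thesis using pol_differences[of a' "{}" d] cell' True a' by (simp add: sum_zero_singleton)
  next
    case False
    then show ?thesis using pol_differences[of a' ?K d] cell' a' cardK(2) by simp
  qed
  have orient': "set (ori c') \<subseteq> sum_zero ?K" "Suc (length (ori c')) = card ?K"
    "int_sgn (orient_det ?K (ori c')) = cell_sign ori c'"
  proof -
    show "set (ori c') \<subseteq> sum_zero ?K"
    proof -
      have "span (set (ori c')) = sum_zero ?K"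
        using ori cell' unfolding oriented_def pol_hypersimplicial span'[symmetric] by blast
      then show ?thesis using span_superset by blast
    qed
    show "Suc (length (ori c')) = card ?K" 
    proof (cases "card ?K = 1")
      case True
      then show ?thesis using ori_vertex[of a'] cell' a' by simp
    next
      case False
      then show ?thesis
        using orient_det_nonzero_and_sign(1)[OF cardK(2) ori_basis[of a' ?K]] cell' a' cardK(2) by simp
    qed
    show "int_sgn (orient_det ?K (ori c')) = cell_sign ori c'"
    proof (cases "card ?K = 1")
      case True
      then obtain k where "?K = {k}" by (rule card_1_singletonE)
      then show ?thesis using True a' by (simp add: cell_sign_def orient_det_def)
    next
      case False
      then show ?thesis using a' cardK(2) by (simp add: cell_sign_def)
    qed
  qed
  define v where "v = outward (hypersimplicial d) (a, J) c'"
  obtain b K where bK: "c' = (b, K)" by (cases c')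
  then obtain L where "L \<subseteq> K" "total b + card L = d"
    using cell' hyper_cell_nonempty[of b d K] by (auto simp: cells_hypersimplicial)
  then have p0: "expo_vec b + ind_vec L \<in> hyper_cell d c'"
    unfolding bK by (rule hyper_cell_vertex)
  have "affine hull (hyper_cell d c') \<subseteq> {y. vec_nth y j = t}"
  proof (rule hull_minimal)
    show "affine {y :: real ^ 'n::{finite,linorder}. vec_nth y j = t}"
      by (auto simp: affine_def simp flip: distrib_right)
  qed (use t in blast)
  then have "q0 \<notin> affine hull (hyper_cell d c')" using q0 by blast
  then have "\<exists>v p q. p \<in> hyper_cell d c' \<and> q \<in> hyper_cell d (a, J) \<and> q \<notin> affine hull (hyper_cell d c') \<and> v = p - q"
    using p0 q0 by blast
  then have "\<exists>p q. p \<in> hyper_cell d c' \<and> q \<in> hyper_cell d (a, J) \<and> q \<notin> affine hull (hyper_cell d c') \<and> v = p - q"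
    unfolding v_def outward_def pol_hypersimplicial by (rule someI_ex)
  then obtain p q where pq: "p \<in> hyper_cell d c'" "q \<in> hyper_cell d (a, J)" "q \<notin> affine hull (hyper_cell d c')"
    and v: "v = p - q" by blast
  have diff: "q - p \<in> sum_zero J" "p - q \<in> sum_zero J"
  proof -
    have "span {p - q |p q. p \<in> hyper_cell d (a, J) \<and> q \<in> hyper_cell d (a, J)} = sum_zero J"
      using pol_differences[OF c] J by simp
    then show "q - p \<in> sum_zero J" "p - q \<in> sum_zero J"
      using pq sub by (blast intro: span_base)+
  qed
  \<comment> \<open>Otherwise q would differ from p by a direction of the facet and lie in its
    affine hull.\<close>
  have "vec_nth q j \<noteq> t"
  proof
    assume "vec_nth q j = t"
    then have "vec_nth (q - p) j = 0" using t pq by simp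
    then have "q - p \<in> sum_zero ?K"
      using diff(1) j sum.remove[of J j "vec_nth (q - p)"] by (auto simp: sum_zero_def)
    then show False using affine_hull_of_span_differences[OF pq(1), of q] pq(3) by (simp add: span')
  qed
  \<comment> \<open>The j-th coordinate of v is t - q_j, so the minus sign of
    \<open>orient_det_Cons\<close> turns it into the side s on which the cell lies.\<close>
  then have sq: "int_sgn (- vec_nth v j) = s" using s[OF pq(2)] t[OF pq(1)] by (simp add: v)
  have vJ: "v \<in> sum_zero J" using diff v by simp
  have "incidence (hypersimplicial d) ori (a, J) c' = orientation_sign (ori (a, J)) (v # ori c')"
    using e by (simp add: incidence_def v_def)
  also have "\<dots> = int_sgn (orient_det J (ori (a, J))) * int_sgn (orient_det J (v # ori c'))"
  proof (rule orient_det_nonzero_and_sign(3)[OF J ori_basis[OF c J]])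
    show "set (v # ori c') \<subseteq> sum_zero J" using vJ orient'(1) sum_zero_mono[of ?K J] by auto
    show "length (v # ori c') = length (ori (a, J))"
      using orient_det_nonzero_and_sign(1)[OF J ori_basis[OF c J]] orient'(2) cardK(1) by simp
  qed
  also have "orient_det J (v # ori c') = - vec_nth v j * rem_sign J j * orient_det ?K (ori c')"
    by (rule orient_det_Cons[OF j vJ orient'(1)]) (use orient'(2) cardK(1) in simp)
  also have "int_sgn \<dots> = s * rem_sign J j * cell_sign ori c'"
    by (simp only: int_sgn_mult sq int_sgn_rem_sign orient'(3))
  also have "int_sgn (orient_det J (ori (a, J))) = cell_sign ori (a, J)"
    using J by (simp add: cell_sign_def)
  finally show ?thesis by (simp only: mult.assoc mult.commute mult.left_commute)
qed

text \<open>The cell lies on the side y_j \<ge> a_j of this facet, so the side is s = 1.\<close>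

lemma incidence_zero_facet:
  assumes e: "((a, J), cell_of a (J - {j})) \<in> face_graph (hypersimplicial d)" and j: "j \<in> J"
  shows "incidence (hypersimplicial d) ori (a, J) (cell_of a (J - {j})) =
    cell_sign ori (a, J) * cell_sign ori (cell_of a (J - {j})) * rem_sign J j"
proof -
  have c: "(a, J) \<in> cells (hypersimplicial d)" using e by (simp add: face_graph_def)
  then have r: "total a < d" "d < total a + card J" using j by (auto simp: cells_hypersimplicial)
  have t: "vec_nth p j = real (lookup a j)" if "p \<in> hyper_cell d (cell_of a (J - {j}))" for p
  proof (cases "card (J - {j}) = 1")
    case True
    then obtain k where k: "J - {j} = {k}" by (rule card_1_singletonE)
    then have "k \<noteq> j" by blast
    then show ?thesis using hyper_cell_bounds(1)[of p d "a + single k 1" "{}" j] that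
      by (simp add: k lookup_add lookup_single)
  next
    case False
    then show ?thesis using hyper_cell_bounds(1)[of p d a "J - {j}" j] that by (simp add: cell_of_card)
  qed
  have "card J \<noteq> 0" using j by auto
  have "\<exists>L\<subseteq>J. total a + card L = d \<and> j \<in> L"
  proof -
    have "d - total a - 1 \<le> card (J - {j})" using r j by simp
    then obtain M where M: "M \<subseteq> J - {j}" "card M = d - total a - 1" by (meson obtain_subset_with_card_n)
    then have "card (insert j M) = Suc (card M)" by (intro card_insert_disjoint) auto
    then show ?thesis using M r j by (intro exI[of _ "insert j M"]) auto
  qed
  then obtain L where L: "L \<subseteq> J" "total a + card L = d" "j \<in> L" by blast
  have "incidence (hypersimplicial d) ori (a, J) (cell_of a (J - {j})) =
    cell_sign ori (a, J) * cell_sign ori (cell_of a (J - {j})) * (1 * rem_sign J j)"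
  proof (rule incidence_facet[OF e j _ t])
    show "snd (cell_of a (J - {j})) = (if card (J - {j}) = 1 then {} else J - {j})" by (simp add: cell_of_def)
    show "expo_vec a + ind_vec L \<in> hyper_cell d (a, J)" by (rule hyper_cell_vertex[OF L(1,2)])
    show "vec_nth (expo_vec a + ind_vec L) j \<noteq> real (lookup a j)" using L by simp
    show "int_sgn (vec_nth q j - real (lookup a j)) = 1"
      if "q \<in> hyper_cell d (a, J)" "vec_nth q j \<noteq> real (lookup a j)" for q
      using hyper_cell_bounds(2)[OF that(1), of j] that(2) by (simp add: int_sgn_def)
  qed
  then show ?thesis by simp
qed

text \<open>The cell lies below the facet y_j = a_j + 1, so the side is s = - 1, opposite to the
  facets y_j = a_j.\<close>

lemma incidence_one_facet:
  assumes e: "((a, J), (a + single j 1, J - {j})) \<in> face_graph (hypersimplicial d)" and j: "j \<in> J"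
    and r: "Suc (total a) < d"
  shows "incidence (hypersimplicial d) ori (a, J) (a + single j 1, J - {j}) =
    - (cell_sign ori (a, J) * cell_sign ori (a + single j 1, J - {j}) * rem_sign J j)"
proof -
  have c: "(a, J) \<in> cells (hypersimplicial d)" using e by (simp add: face_graph_def)
  then have r': "d < total a + card J" using j by (auto simp: cells_hypersimplicial)
  have t: "vec_nth p j = real (lookup a j) + 1" if "p \<in> hyper_cell d (a + single j 1, J - {j})" for p
    using hyper_cell_bounds(1)[OF that, of j] by (simp add: lookup_add)
  have "\<exists>L\<subseteq>J. total a + card L = d \<and> j \<notin> L"
  proof -
    have "d - total a \<le> card (J - {j})" using r r' j by simp
    then obtain M where "M \<subseteq> J - {j}" "card M = d - total a" by (meson obtain_subset_with_card_n)
    then show ?thesis using r by (intro exI[of _ M]) auto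
  qed
  then obtain L where L: "L \<subseteq> J" "total a + card L = d" "j \<notin> L" by blast
  have "incidence (hypersimplicial d) ori (a, J) (a + single j 1, J - {j}) =
    cell_sign ori (a, J) * cell_sign ori (a + single j 1, J - {j}) * (- 1 * rem_sign J j)"
  proof (rule incidence_facet[OF e j _ t])
    show "snd (a + single j 1, J - {j}) = (if card (J - {j}) = 1 then {} else J - {j})"
      using r r' j by auto
    show "expo_vec a + ind_vec L \<in> hyper_cell d (a, J)" by (rule hyper_cell_vertex[OF L(1,2)])
    show "vec_nth (expo_vec a + ind_vec L) j \<noteq> real (lookup a j) + 1" using L by simp
    show "int_sgn (vec_nth q j - (real (lookup a j) + 1)) = - 1"
      if "q \<in> hyper_cell d (a, J)" "vec_nth q j \<noteq> real (lookup a j) + 1" for q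
      using hyper_cell_bounds(3)[OF that(1), of j] that(2) by (simp add: int_sgn_def)
  qed
  then show ?thesis by simp
qed

end

section \<open>The matching\<close>

lemma Fin_Min_le_first: "Fin (Min J) \<le> first a \<longleftrightarrow> lead a J"
  by (auto simp: first_def lead_def Min_ge_iff)

lemma hyper_matching_eq:
  "hyper_matching d = {((a, J), (a + single (Min J) 1, J - {Min J})) |a J.
    Suc (total a) < d \<and> d < total a + card J \<and> lead a J}"
  unfolding hyper_matching_def Fin_Min_le_first by (intro Collect_cong ex_cong conj_cong refl) auto

text \<open>Among the cells these turn out to be the targets of the matching. Other cells of
  positive dimension are sources or critical, and vertices are unmatched.\<close>

definition unlead :: "'n::{finite,linorder} hcell \<Rightarrow> bool"
  where "unlead c \<longleftrightarrow> snd c \<noteq> {} \<and> \<not> lead (fst c) (snd c)"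

text \<open>Recovers the source of a matched edge from its target: the index passed into the
  exponent is the minimum of the support. On non-leading pairs this is the move made by
  \<open>symm_htpy\<close>.\<close>

definition partner :: "'n::{finite,linorder} expo \<Rightarrow> 'n set \<Rightarrow> 'n hcell"
  where "partner a J = (a - single (Min (keys a)) 1, insert (Min (keys a)) J)"

lemma keys_add_single: "keys (a + single j 1) = insert j (keys (a :: 'n expo))"
  by (auto simp: in_keys_iff lookup_add lookup_single when_def split: if_splits)

text \<open>Min J survives the removal of any other element, so a facet of a leading cell can cease
  to be leading only at j = Min J.\<close>

lemma lead_mono:
  assumes "lead a J" "j \<in> J" "j \<noteq> Min J"
  shows "lead a (J - {j})" "lead (a + single j 1) (J - {j})"
proof -
  have "Min J \<in> J" using assms(2) by (intro Min_in) auto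
  then have "Min (J - {j}) = Min J"
    using assms by (intro Min_eqI) auto
  then show "lead a (J - {j})" "lead (a + single j 1) (J - {j})"
    using assms(1,2) by (auto simp: lead_def keys_add_single)
qed

lemma source_not_unlead: "(c, c') \<in> hyper_matching d \<Longrightarrow> \<not> unlead c"
  by (auto simp: hyper_matching_eq unlead_def)

lemma Min_less_Min_remove:
  fixes J :: "'n::{finite,linorder} set"
  assumes "J \<noteq> {}" "J - {Min J} \<noteq> {}"
  shows "Min J < Min (J - {Min J})"
proof -
  have "Min (J - {Min J}) \<in> J - {Min J}" using assms(2) by (intro Min_in) auto
  then have "Min (J - {Min J}) \<in> J" "Min (J - {Min J}) \<noteq> Min J" by auto
  moreover from this have "Min J \<le> Min (J - {Min J})" by (intro Min_le) auto
  ultimately show ?thesis by (metis order_le_less)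
qed

text \<open>The index passed into the exponent was the minimum of the source and below its support.
  It is therefore below what remains of the set, which destroys the leading condition, and it is
  found again as the minimum of the new support.\<close>

lemma target_props:
  assumes e: "(c, (b, K)) \<in> hyper_matching d"
  shows "K \<noteq> {}" "total b < d" "d < total b + card K" "\<not> lead b K" "c = partner b K"
proof -
  obtain a J where c: "c = (a, J)" and b: "b = a + single (Min J) 1" and K: "K = J - {Min J}"
    and r: "Suc (total a) < d" "d < total a + card J" and l: "lead a J"
    using e by (auto simp: hyper_matching_eq)
  have J: "J \<noteq> {}" using r by auto
  then have mJ: "Min J \<in> J" by simp
  then have cK: "card J = Suc (card K)" using r by (simp add: K)
  have "card K > 0" using r cK by linarith
  then show K0: "K \<noteq> {}" by (rule card_pos_nonempty)
  show "total b < d" "d < total b + card K" using r cK by (auto simp: b total_plus)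
  have "Min J < Min K" using Min_less_Min_remove[OF J] K0 K by blast
  then show "\<not> lead b K" by (auto simp: lead_def b keys_add_single)
  have "Min (keys b) = Min J"
    using l by (intro Min_eqI) (auto simp: b keys_add_single lead_def)
  then show "c = partner b K"
    using mJ by (auto simp: partner_def c b K add_single_diff_single insert_absorb)
qed

lemma partner_props:
  assumes "total b < d" "d < total b + card K" "\<not> lead b K" "K \<noteq> {}"
  shows "Min (keys b) \<in> keys b" "Min (keys b) < Min K" "Min (insert (Min (keys b)) K) = Min (keys b)"
    "Min (keys b) \<notin> K" "Suc (total (b - single (Min (keys b)) 1)) = total b"
    "lead (b - single (Min (keys b)) 1) (insert (Min (keys b)) K)"
    "(partner b K, (b, K)) \<in> hyper_matching d"
proof -
  let ?f = "Min (keys b)"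
  obtain i where i: "i \<in> keys b" "i < Min K" using assms(3) by (auto simp: lead_def)
  then have ne: "keys b \<noteq> {}" by blast
  then show f: "?f \<in> keys b" by simp
  show less: "?f < Min K" using i by (meson Min_le finite_keys le_less_trans)
  show mi: "Min (insert ?f K) = ?f" using less assms(4) by simp
  show nin: "?f \<notin> K" using less by (metis Min_le finite not_less)
  show t: "Suc (total (b - single ?f 1)) = total b" by (rule total_diff_single[OF f])
  show l: "lead (b - single ?f 1) (insert ?f K)"
    unfolding lead_def mi using keys_diff_single_subset[of b "single ?f 1"] by (auto intro: Min_le)
  have "card (insert ?f K) = Suc (card K)" using nin by simp
  then show "(partner b K, (b, K)) \<in> hyper_matching d"
    unfolding hyper_matching_eq partner_def
    using assms(1,2) t l mi nin diff_single_add[OF f]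
    by (intro CollectI exI[of _ "b - single ?f 1"] exI[of _ "insert ?f K"]) auto
qed

lemma matching_subset_face_graph: "hyper_matching d \<subseteq> face_graph (hypersimplicial d)"
proof
  fix e assume e: "e \<in> hyper_matching d"
  then obtain a J where e: "e = ((a, J), (a + single (Min J) 1, J - {Min J}))"
    and r: "Suc (total a) < d" "d < total a + card J" by (auto simp: hyper_matching_eq)
  have J: "J \<noteq> {}" using r by auto
  show "e \<in> face_graph (hypersimplicial d)"
    unfolding e face_graph_iff
  proof (intro conjI)
    show "(a, J) \<in> cells (hypersimplicial d)" using r by (simp add: cells_hypersimplicial)
    show "is_facet d (a, J) (a + single (Min J) 1, J - {Min J})"
      unfolding is_facet_def prod.case using J r by (intro bexI[of _ "Min J"]) auto
  qed (use J in simp)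
qed

text \<open>Targets are non-leading and sources are leading, so two edges that meet share their
  sources or share their targets; each of the two determines the edge, the latter through
  \<open>partner\<close>.\<close>

lemma matching_unique:
  assumes e: "e \<in> hyper_matching d" "e' \<in> hyper_matching d" and ne: "{fst e, snd e} \<inter> {fst e', snd e'} \<noteq> {}"
  shows "e = e'"
proof -
  have unlead: "unlead (snd x)" if "x \<in> hyper_matching d" for x
    using target_props[of "fst x" "fst (snd x)" "snd (snd x)" d] that by (simp add: unlead_def)
  have nunlead: "\<not> unlead (fst x)" if "x \<in> hyper_matching d" for x
    using source_not_unlead[of "fst x" "snd x" d] that by simp
  have "fst e = fst e' \<or> snd e = snd e'"
    using ne unlead[OF e(1)] unlead[OF e(2)] nunlead[OF e(1)] nunlead[OF e(2)] by auto
  then show ?thesis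
  proof
    assume "fst e = fst e'"
    then show ?thesis using e by (auto simp: hyper_matching_eq)
  next
    assume s: "snd e = snd e'"
    have "fst e = partner (fst (snd e)) (snd (snd e))" "fst e' = partner (fst (snd e')) (snd (snd e'))"
      using target_props(5)[of "fst e" "fst (snd e)" "snd (snd e)" d] target_props(5)[of "fst e'" "fst (snd e')" "snd (snd e')" d] e
      by simp_all
    then show ?thesis using s by (simp add: prod_eq_iff)
  qed
qed

text \<open>Along every edge of the reversed graph this lexicographic measure decreases: it merges each
  matched pair into its larger cell.\<close>

definition cell_measure :: "('n::{finite,linorder} hcell \<times> 'n hcell) set"
  where "cell_measure = measures
    [\<lambda>c. card (snd c) + of_bool (unlead c), \<lambda>c. total (fst c) - of_bool (unlead c), \<lambda>c. of_bool (unlead c)]"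

lemma reversed_graph_decreasing:
  assumes e: "(c, c') \<in> reversed_graph (hypersimplicial d) (hyper_matching d)"
  shows "(c', c) \<in> cell_measure"
  using e unfolding reversed_graph_def
proof
  assume "(c, c') \<in> face_graph (hypersimplicial d) - hyper_matching d"
  then have f: "(c, c') \<in> face_graph (hypersimplicial d)" and nA: "(c, c') \<notin> hyper_matching d" by auto
  obtain a J where c: "c = (a, J)" by (cases c)
  have cell: "(a, J) \<in> cells (hypersimplicial d)" and J: "J \<noteq> {}" and fa: "is_facet d (a, J) c'"
    using f by (auto simp: face_graph_iff c)
  obtain j where j: "j \<in> J" and alt: "c' = cell_of a (J - {j}) \<or> c' = (a + single j 1, J - {j}) \<and> Suc (total a) < d"
    using fa by (auto simp: is_facet_def)
  have r: "d < total a + card J" using cell J by (simp add: cells_hypersimplicial)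
  have cardJ: "card J = Suc (card (J - {j}))" using j card_Suc_Diff1[of J j] by simp
  have less: "card (snd c') < card J" using alt cardJ by (auto simp: cell_of_def)
  show ?thesis
  proof (cases "unlead c")
    case True
    then have "card (snd c') + of_bool (unlead c') < card (snd c) + of_bool (unlead c)"
      using less by (simp add: c)
    then show ?thesis by (simp add: cell_measure_def)
  next
    case False
    then have l: "lead a J" using J by (simp add: unlead_def c)
    show ?thesis
    proof (cases "unlead c'")
      case True
      then have "snd c' \<noteq> {}" by (simp add: unlead_def)
      then have alt': "c' = (a, J - {j}) \<or> c' = (a + single j 1, J - {j}) \<and> Suc (total a) < d"
        using alt by (auto simp: cell_of_def split: if_splits)
      \<comment> \<open>A leading cell loses the condition only at its minimum. Of the two possible
        facets there, y_j = a_j + 1 is the matched target, so the edge goes to (a, J - {Min J}); the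
        first entry of the measure stays the same and the second drops by one.\<close>
      have jm: "j = Min J"
        using lead_mono[OF l j] alt' True by (auto simp: unlead_def)
      have "c' = (a, J - {j})"
        using alt' nA l r by (auto simp: hyper_matching_eq c jm)
      moreover have "a \<noteq> 0" using True calculation by (auto simp: unlead_def lead_def)
      then have "total a > 0" by (simp add: total_eq_0_iff flip: neq0_conv)
      ultimately show ?thesis using True False cardJ by (simp add: cell_measure_def c)
    qed (use False less in \<open>simp add: cell_measure_def c\<close>)
  qed
next
  assume "(c, c') \<in> (hyper_matching d)\<inverse>"
  then have A: "(c', c) \<in> hyper_matching d" by simp
  then have u: "\<not> unlead c'" by (rule source_not_unlead)
  have u': "unlead c" using target_props[of c' "fst c" "snd c" d] A by (simp add: unlead_def)
  obtain a J where c': "c' = (a, J)" and c: "c = (a + single (Min J) 1, J - {Min J})"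
    and r: "d < total a + card J" "Suc (total a) < d"
    using A by (auto simp: hyper_matching_eq)
  have "J \<noteq> {}" using r by auto
  then have "card J = Suc (card (J - {Min J}))" using card_Suc_Diff1[of J "Min J"] by simp
  then have "card (snd c') = Suc (card (snd c))" "total (fst c) = Suc (total (fst c'))"
    by (auto simp: c c' total_plus)
  then show ?thesis using u u' by (simp add: cell_measure_def)
qed

lemma acyclic_hyper_matching:
  "acyclic_matching (hypersimplicial d) (hyper_matching d :: ('n::{finite,linorder} hcell \<times> _) set)"
proof -
  have "wf ((reversed_graph (hypersimplicial d) (hyper_matching d :: ('n hcell \<times> _) set))\<inverse>)"
  proof (rule wf_subset[of cell_measure])
    show "wf (cell_measure :: ('n hcell \<times> _) set)" unfolding cell_measure_def by (rule wf_measures)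
  qed (use reversed_graph_decreasing in auto)
  then have "acyclic (reversed_graph (hypersimplicial d) (hyper_matching d :: ('n hcell \<times> _) set))"
    using wf_acyclic acyclic_converse by blast
  then show ?thesis
    unfolding acyclic_matching_def using matching_subset_face_graph matching_unique by blast
qed

lemma homogeneous_hyper_matching: "homogeneous_matching (hypersimplicial d) (hyper_matching d)"
proof -
  have "a + (\<Sum>j\<in>J. single j 1) = a + single (Min J) 1 + (\<Sum>j\<in>J - {Min J}. single j 1)"
    if "J \<noteq> {}" for a :: "'a expo" and J
    using that sum.remove[of J "Min J" "\<lambda>j. single j 1 :: 'a expo"] by (simp add: add.assoc)
  moreover have "J \<noteq> {}" if "d < total a + card J" "Suc (total a) < d" for a :: "'a expo" and J :: "'a set"
    using that by auto
  ultimately show ?thesis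
    unfolding homogeneous_matching_def by (auto simp: hyper_matching_eq mdeg_hypersimplicial)
qed

text \<open>For a vertex v the smallest index of the support gives the only splitting v = a +
  \<epsilon>_k in which {k} is leading over a. So this inverts \<open>cell_of\<close> on leading
  pairs.\<close>

definition pair_of :: "'n::{finite,linorder} hcell \<Rightarrow> 'n expo \<times> 'n set"
  where "pair_of c = (if snd c = {} then (fst c - single (Min (keys (fst c))) 1, {Min (keys (fst c))}) else c)"

lemma pair_of_cell_of:
  assumes "lead a K" "K \<noteq> {}"
  shows "pair_of (cell_of a K) = (a, K)"
proof (cases "card K = 1")
  case True
  then obtain k where k: "K = {k}" by (rule card_1_singletonE)
  have "Min (keys (a + single k 1)) = k"
    unfolding keys_add_single using assms(1) by (intro Min_eqI) (auto simp: lead_def k)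
  then show ?thesis by (simp add: pair_of_def k add_single_diff_single)
qed (use assms in \<open>simp add: pair_of_def cell_of_card\<close>)

text \<open>Non-leading cells are targets, and leading ones with |a| + 1 < d are sources; in
  positive dimension this leaves |a| = d - 1. A vertex gets |a| = d - 1 by splitting off one
  index.\<close>

lemma critical_props:
  assumes c: "c \<in> critical (hypersimplicial d) (hyper_matching d) i" and d: "d \<ge> 1" and pr: "pair_of c = (a, K)"
  shows "card K = Suc i" "Suc (total a) = d" "lead a K" "cell_of a K = c"
proof -
  obtain b L where bL: "c = (b, L)" by (cases c)
  have cell: "(b, L) \<in> cells (hypersimplicial d)" and dim: "cdim (hypersimplicial d) (b, L) = int i"
    and F: "(b, L) \<notin> Field (hyper_matching d)"
    using c by (auto simp: critical_def bL)
  have "card K = Suc i \<and> Suc (total a) = d \<and> lead a K \<and> cell_of a K = c"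
  proof (cases "L = {}")
    case True
    then have "total b = d" and i: "i = 0"
      using cell dim cdim_hypersimplicial[OF cell] by (auto simp: cells_hypersimplicial)
    then have "b \<noteq> 0" using d by auto
    then have m: "Min (keys b) \<in> keys b" by simp
    have "K = {Min (keys b)}" "a = b - single (Min (keys b)) 1"
      using pr True by (auto simp: pair_of_def bL)
    moreover have "Min (keys b) \<le> k" if "k \<in> keys (b - single (Min (keys b)) 1)" for k
      using subsetD[OF keys_diff_single_subset that] by (intro Min_le) auto
    ultimately show ?thesis
      using True total_diff_single[OF m] diff_single_add[OF m] \<open>total b = d\<close> i
      by (simp add: lead_def bL)
  next
    case False
    then have ab: "a = b" "K = L" using pr by (auto simp: pair_of_def bL)
    have r: "total b < d" "d < total b + card L" using cell False by (auto simp: cells_hypersimplicial)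
    have lead: "lead b L"
    proof (rule ccontr)
      assume "\<not> lead b L"
      then have "(partner b L, (b, L)) \<in> hyper_matching d" using partner_props(7) r False by blast
      then show False using F by (auto simp: Field_def)
    qed
    have "\<not> Suc (total b) < d"
    proof
      assume "Suc (total b) < d"
      then have "((b, L), (b + single (Min L) 1, L - {Min L})) \<in> hyper_matching d"
        using r lead by (auto simp: hyper_matching_eq)
      then show False using F by (auto simp: Field_def)
    qed
    then have "Suc (total b) = d" using r by simp
    moreover have "card L = Suc i" using dim cdim_hypersimplicial[OF cell] False by simp
    moreover have "card L \<noteq> 1" using r by linarith
    ultimately show ?thesis using lead ab bL by (simp add: cell_of_card)
  qed
  then show "card K = Suc i" "Suc (total a) = d" "lead a K" "cell_of a K = c" by auto
qed

lemma cell_of_critical: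
  assumes K: "card K = Suc i" and t: "Suc (total a) = d" and l: "lead a K"
  shows "cell_of a K \<in> critical (hypersimplicial d) (hyper_matching d) i"
proof (cases "card K = 1")
  case True
  then obtain k where k: "K = {k}" by (rule card_1_singletonE)
  then have c: "cell_of a K = (a + single k 1, {})" by simp
  have cell: "(a + single k 1, {}) \<in> cells (hypersimplicial d)" using t by (simp add: cells_hypersimplicial total_plus)
  have "(a + single k 1, {}) \<notin> Range (hyper_matching d)"
    using target_props(1)[of _ "a + single k 1" "{}" d] by blast
  moreover have "(a + single k 1, {}) \<notin> Domain (hyper_matching d)"
    by (auto simp: hyper_matching_eq)
  ultimately have "(a + single k 1, {}) \<notin> Field (hyper_matching d)"
    by (simp add: Field_def)
  then show ?thesis
    using cell cdim_hypersimplicial[OF cell] True K by (simp add: critical_def c)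
next
  case False
  then have c: "cell_of a K = (a, K)" by (rule cell_of_card)
  have "K \<noteq> {}" using K by auto
  have cell: "(a, K) \<in> cells (hypersimplicial d)" using t K False by (simp add: cells_hypersimplicial)
  have "(a, K) \<notin> Field (hyper_matching d)"
    using target_props(4)[of _ a K d] l t by (auto simp: Field_def hyper_matching_eq)
  then show ?thesis
    using cell cdim_hypersimplicial[OF cell] \<open>K \<noteq> {}\<close> K by (simp add: critical_def c)
qed

section \<open>The Morse differential\<close>

lemma prod_path_4:
  fixes g :: "'a \<Rightarrow> 'a \<Rightarrow> 'b::comm_monoid_mult"
  shows "(\<Prod>k<length [x0, x1, x2, x3] - 1. g ([x0, x1, x2, x3] ! k) ([x0, x1, x2, x3] ! Suc k)) =
    g x0 x1 * (g x1 x2 * g x2 x3)"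
  by (simp add: lessThan_Suc numeral_3_eq_3 mult_ac)

lemma total_diff_le: "total (u - v) \<le> total u"
  unfolding total_def by (rule sum_mono) (simp add: lookup_minus)

lemma reversed_graph_step:
  assumes e: "(x, y) \<in> reversed_graph (hypersimplicial d) (hyper_matching d)"
  shows "cdim (hypersimplicial d) y = cdim (hypersimplicial d) x - 1 \<and>
      (x, y) \<in> face_graph (hypersimplicial d) \<and> (x, y) \<notin> hyper_matching d \<or>
    cdim (hypersimplicial d) y = cdim (hypersimplicial d) x + 1 \<and> (y, x) \<in> hyper_matching d"
  using e matching_subset_face_graph[of d] by (auto simp: reversed_graph_def face_graph_def)

context
  fixes d i :: nat and c' :: "'n::{finite,linorder} hcell"
  assumes d: "d \<ge> 1"
    and c': "c' \<in> critical (hypersimplicial d) (hyper_matching d) i"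
begin

private abbreviation (input) "lower x \<equiv> cdim (hypersimplicial d) x = int i"
private abbreviation (input) "upper x \<equiv> cdim (hypersimplicial d) x = int i + 1"
private abbreviation (input) "edges \<equiv> reversed_graph (hypersimplicial d) (hyper_matching d :: ('n hcell \<times> _) set)"

text \<open>The start is left open so that nonempty suffixes of walks are walks again and can be
  analysed step by step.\<close>

definition walk :: "'n hcell list \<Rightarrow> bool"
  where "walk p \<longleftrightarrow> successively (\<lambda>x y. (x, y) \<in> edges) p \<and> (\<forall>x\<in>set p. upper x \<or> lower x) \<and> last p = c'"

lemma walk_Cons: "walk (x # y # q) \<longleftrightarrow> (x, y) \<in> edges \<and> (upper x \<or> lower x) \<and> walk (y # q)"
  by (auto simp: walk_def)

text \<open>Within two neighbouring dimensions the only way up is a reversed matched edge, and a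
  target determines its source.\<close>

lemma walk_lower_step:
  assumes w: "walk ((b, L) # y # q)" and l: "lower (b, L)"
  shows "y = partner b L \<and> (y, (b, L)) \<in> hyper_matching d \<and> upper y"
proof -
  have "upper y \<or> lower y" using w by (simp add: walk_def)
  then have "(y, (b, L)) \<in> hyper_matching d" "upper y"
    using reversed_graph_step[of "(b, L)" y d] w l by (auto simp: walk_Cons)
  then show ?thesis using target_props(5) by blast
qed

lemma walk_upper_step:
  assumes w: "walk ((b, L) # y # q)" and u: "upper (b, L)"
  shows "is_facet d (b, L) y \<and> ((b, L), y) \<notin> hyper_matching d \<and> lower y"
proof -
  have "upper y \<or> lower y" using w by (simp add: walk_def)
  then show ?thesis
    using reversed_graph_step[of "(b, L)" y d] w u by (auto simp: walk_Cons face_graph_iff)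
qed

lemma walk_nonempty_upper: "walk (x # q) \<Longrightarrow> upper x \<Longrightarrow> q \<noteq> []"
  using c' by (auto simp: walk_def critical_def)

text \<open>The number \<open>d - |b|\<close> never drops along a walk below the value 2, whereas it is at most 1 at \<open>c'\<close>.\<close>

lemma no_walk:
  assumes "walk ((b, L) # q)" "lower (b, L)" "Suc (total b) < d"
  shows False
  using assms
proof (induction "length q" arbitrary: b L q rule: less_induct)
  case less
  show False
  proof (cases q)
    case Nil
    then have "c' = (b, L)" using less.prems(1) by (simp add: walk_def)
    moreover have "Suc (total (fst (pair_of c'))) = d"
      using critical_props(2)[OF c' d] by (metis prod.collapse)
    moreover have "total (fst (pair_of (b, L))) \<le> total b"
      by (simp add: pair_of_def total_diff_le)
    ultimately show False using less.prems(3) by simp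
  next
    case (Cons s q')
    have s: "s = partner b L" "(s, (b, L)) \<in> hyper_matching d" "upper s"
      using walk_lower_step less.prems unfolding Cons by blast+
    let ?f = "Min (keys b)"
    note t = target_props[OF s(2)]
    note p = partner_props[OF t(2) t(3) t(4) t(1)]
    have ws: "walk (s # q')" using less.prems(1) by (simp add: Cons walk_Cons)
    obtain y q'' where q': "q' = y # q''"
      using walk_nonempty_upper[OF ws s(3)] by (cases q') auto
    have y: "is_facet d s y" "lower y"
      using walk_upper_step[of "fst s" "snd s" y q''] ws s(3) by (auto simp: q')
    have cM: "card (insert ?f L) = Suc (card L)" using p(4) by simp
    \<comment> \<open>Going up takes one from the exponent, and the facet chosen next gives back at
      most one. It is not a vertex, since L has at least two elements.\<close>
    have "total (fst y) \<le> total b"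
    proof -
      obtain j where j: "j \<in> insert ?f L" and
        alt: "y = cell_of (b - single ?f 1) (insert ?f L - {j}) \<or> y = (b - single ?f 1 + single j 1, insert ?f L - {j})"
        using y(1) unfolding is_facet_def s(1) partner_def prod.case by blast
      have "card (insert ?f L - {j}) = card L" using j cM by simp
      then have "card (insert ?f L - {j}) \<noteq> 1" using t(3) less.prems(3) by linarith
      then show ?thesis using alt p(5) by (auto simp: cell_of_card total_plus)
    qed
    then have "Suc (total (fst y)) < d" using less.prems(3) by linarith
    then show False
      using less.hyps[of q'' "fst y" "snd y"] ws y(2) by (simp add: Cons q' walk_Cons)
  qed
qed

context
  fixes a :: "'n expo" and K :: "'n set"
  assumes K: "card K = Suc (Suc i)" and t: "Suc (total a) = d" and l: "lead a K"
begin

private abbreviation (input) "m \<equiv> Min K"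
private abbreviation (input) "f \<equiv> Min (keys a)"
private abbreviation (input) "M \<equiv> insert f (K - {m})"
private abbreviation (input) "b \<equiv> a - single f 1"
private abbreviation (input) "turns \<equiv> card (K - {m}) \<noteq> 1 \<and> \<not> lead a (K - {m})"

lemma K_props: "K \<noteq> {}" "m \<in> K" "(a, K) \<in> cells (hypersimplicial d)" "upper (a, K)"
  "j \<in> K \<Longrightarrow> card (K - {j}) = Suc i"
proof -
  show 1: "K \<noteq> {}" using K by auto
  then show "m \<in> K" by simp
  show 2: "(a, K) \<in> cells (hypersimplicial d)" using K t by (simp add: cells_hypersimplicial)
  show "upper (a, K)" using cdim_hypersimplicial[OF 2] 1 K by simp
  show "card (K - {j}) = Suc i" if "j \<in> K" using K that by simp
qed

lemma not_matched: "((a, K), x) \<notin> hyper_matching d" "(x, (a, K)) \<notin> hyper_matching d"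
proof -
  show "((a, K), x) \<notin> hyper_matching d" using t by (auto simp: hyper_matching_eq)
  show "(x, (a, K)) \<notin> hyper_matching d" using target_props(4) l by blast
qed

text \<open>The smallest index f of the exponent lies below K - {m}, so the reversed matched edge
  goes up to (b, M). Excluding cardinality 1 keeps the facet from being a vertex, from which no edge
  leads up.\<close>

lemma turn_props:
  assumes "turns"
  shows "((b, M), (a, K - {m})) \<in> hyper_matching d" "f \<notin> K - {m}" "Min M = f" "b + single f 1 = a"
    "Suc (total b) = total a" "lead b M" "card M = Suc (Suc i)" "(b, M) \<in> cells (hypersimplicial d)"
    "upper (b, M)" "total a < d" "2 \<le> Suc i" "card (K - {m}) = Suc i"
proof -
  have cK: "card (K - {m}) = Suc i" by (rule K_props(5)[OF K_props(2)])
  then show "card (K - {m}) = Suc i" .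
  show i: "2 \<le> Suc i" using assms cK by simp
  have ne: "K - {m} \<noteq> {}" using cK by (intro card_pos_nonempty) simp
  have "total a < d" "d < total a + card (K - {m})" using t cK i by auto
  note p = partner_props[OF this _ ne]
  show "((b, M), (a, K - {m})) \<in> hyper_matching d" "f \<notin> K - {m}" "Min M = f" "Suc (total b) = total a" "lead b M"
    using p assms by (auto simp: partner_def)
  show "b + single f 1 = a" using p(1) assms by (intro diff_single_add) auto
  show cM: "card M = Suc (Suc i)" using p(4) assms cK by simp
  show cell: "(b, M) \<in> cells (hypersimplicial d)"
    using cM p(5) assms t i by (auto simp: cells_hypersimplicial)
  show "upper (b, M)" using cdim_hypersimplicial[OF cell] cM by simp
  show "total a < d" using t by simp
qed

lemma facet_a_K: "is_facet d (a, K) x \<longleftrightarrow> (\<exists>j\<in>K. x = cell_of a (K - {j}))"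
  using t by (auto simp: is_facet_def)

lemma edge_a_K: "j \<in> K \<Longrightarrow> ((a, K), cell_of a (K - {j})) \<in> face_graph (hypersimplicial d)"
  unfolding face_graph_iff facet_a_K using K_props(1,3) by auto

lemma edge_b_M:
  assumes "turns" "j \<in> M"
  shows "((b, M), (b + single j 1, M - {j})) \<in> face_graph (hypersimplicial d)"
  unfolding face_graph_iff using turn_props[OF assms(1)] assms(2) t
  by (auto simp: is_facet_def)

lemma lower_facet: "(x, y) \<in> face_graph (hypersimplicial d) \<Longrightarrow> upper x \<Longrightarrow> lower y"
  by (auto simp: face_graph_def)

text \<open>A walk can continue past the first facet only if that facet is non-leading, which forces
  j = m and the step up to (b, M). From there a facet (b, M - {k}) is a dead end by
  \<open>no_walk\<close>, the facet at f belongs to the matched edge just used, and every other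
  facet is leading, so the walk stops on it.\<close>

lemma walk_from_a_K:
  "walk ((a, K) # p) \<longleftrightarrow> (\<exists>j\<in>K. cell_of a (K - {j}) = c' \<and> p = [c']) \<or>
    turns \<and> (\<exists>j\<in>M - {f}. (b + single j 1, M - {j}) = c' \<and> p = [(a, K - {m}), (b, M), c'])" (is "_ \<longleftrightarrow> ?R")
proof
  assume w: "walk ((a, K) # p)"
  obtain x q where p: "p = x # q"
    using walk_nonempty_upper[OF w K_props(4)] by (cases p) auto
  have wx: "walk (x # q)" using w by (simp add: p walk_Cons)
  obtain j where j: "j \<in> K" and x: "x = cell_of a (K - {j})" and lx: "lower x"
    using walk_upper_step[of a K x q] w K_props(4) by (auto simp: p facet_a_K)
  show ?R
  proof (cases q)
    case Nil
    then show ?thesis using j x wx by (auto simp: p walk_def)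
  next
    case (Cons s q')
    have s: "s = partner (fst x) (snd x)" "(s, x) \<in> hyper_matching d" "upper s"
      using walk_lower_step[of "fst x" "snd x" s q'] wx lx by (auto simp: Cons)
    have "snd x \<noteq> {}" "\<not> lead (fst x) (snd x)"
      using target_props(1,4)[of s "fst x" "snd x" d] s(2) by auto
    then have x': "x = (a, K - {j})" "card (K - {j}) \<noteq> 1" "\<not> lead a (K - {j})"
      using x by (auto simp: cell_of_def split: if_splits)
    have "j = m" using lead_mono(1)[OF l j] x'(3) by blast
    then have tu: "turns" and x'': "x = (a, K - {m})" using x' by auto
    note tp = turn_props[OF tu]
    have s': "s = (b, M)" using s(1) by (simp add: x'' partner_def)
    have ws: "walk ((b, M) # q')" using wx by (simp add: Cons walk_Cons s')
    obtain y q'' where q': "q' = y # q''"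
      using walk_nonempty_upper[OF ws tp(9)] by (cases q') auto
    have wy: "walk (y # q'')" using ws by (simp add: q' walk_Cons)
    have y: "is_facet d (b, M) y" "((b, M), y) \<notin> hyper_matching d" "lower y"
      using walk_upper_step[of b M y q''] ws tp(9) by (auto simp: q')
    obtain k where k: "k \<in> M" and alt: "y = cell_of b (M - {k}) \<or> y = (b + single k 1, M - {k})"
      using y(1) unfolding is_facet_def prod.case by blast
    have "card (M - {k}) = Suc i" using tp(7) k by simp
    then have cMk: "card (M - {k}) \<noteq> 1" using tp(11) by linarith
    have "y \<noteq> (b, M - {k})"
    proof
      assume "y = (b, M - {k})"
      then show False using no_walk[of b "M - {k}" q''] wy y(3) tp(5) t by simp
    qed
    then have y': "y = (b + single k 1, M - {k})" using alt cMk by (simp add: cell_of_card)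
    have kf: "k \<noteq> f"
    proof
      assume "k = f"
      then have "y = (a, K - {m})" using y' tp(2,4) by simp
      then show False using y(2) tp(1) by simp
    qed
    have ly: "lead (b + single k 1) (M - {k})"
      using lead_mono(2)[OF tp(6) k] kf tp(3) by simp
    have "q'' = []"
    proof (rule ccontr)
      assume "q'' \<noteq> []"
      then obtain z r where "q'' = z # r" by (cases q'') auto
      then have "(z, y) \<in> hyper_matching d"
        using walk_lower_step[of "fst y" "snd y" z r] wy y(3) unfolding prod.collapse by blast
      then show False using target_props(4)[of z "fst y" "snd y" d] ly y' by simp
    qed
    moreover have "y = c'" using wy calculation by (simp add: walk_def)
    ultimately show ?thesis
      using tu k kf y' by (intro disjI2 conjI bexI[of _ k]) (auto simp: p Cons q' x'' s')
  qed
next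
  have up: "upper (a, K)" by (rule K_props(4))
  have lc: "lower c'" using c' by (simp add: critical_def)
  assume ?R
  then show "walk ((a, K) # p)"
  proof
    assume "\<exists>j\<in>K. cell_of a (K - {j}) = c' \<and> p = [c']"
    then obtain j where j: "j \<in> K" "cell_of a (K - {j}) = c'" "p = [c']" by blast
    have "((a, K), c') \<in> face_graph (hypersimplicial d)" using edge_a_K[OF j(1)] j(2) by simp
    then show ?thesis
      using up lc not_matched by (auto simp: walk_def j(3) reversed_graph_def)
  next
    assume "turns \<and> (\<exists>j\<in>M - {f}. (b + single j 1, M - {j}) = c' \<and> p = [(a, K - {m}), (b, M), c'])"
    then obtain j where tu: "turns" and j: "j \<in> M - {f}" "(b + single j 1, M - {j}) = c'"
      and p: "p = [(a, K - {m}), (b, M), c']" by blast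
    note tp = turn_props[OF tu]
    have e1: "((a, K), (a, K - {m})) \<in> face_graph (hypersimplicial d)"
      using edge_a_K[OF K_props(2)] tu by (simp add: cell_of_card)
    have e3: "((b, M), c') \<in> face_graph (hypersimplicial d)"
      using edge_b_M[OF tu, of j] j by auto
    have "((b, M), c') \<notin> hyper_matching d"
    proof
      assume "((b, M), c') \<in> hyper_matching d"
      then have "c' = (a, K - {m})"
        using matching_unique[of "((b, M), c')" d "((b, M), (a, K - {m}))"] tp(1) by simp
      then have "M - {j} = M - {f}" using j(2) tp(2) by auto
      then show False using j(1) by auto
    qed
    then show ?thesis
      using up lc lower_facet[OF e1 up] tp(1,9) e1 e3 not_matched
      by (auto simp: walk_def p reversed_graph_def)
  qed
qed

lemma cell_of_remove_inj: "j \<in> K \<Longrightarrow> k \<in> K \<Longrightarrow> cell_of a (K - {j}) = cell_of a (K - {k}) \<Longrightarrow> j = k"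
proof -
  assume jk: "j \<in> K" "k \<in> K" and eq: "cell_of a (K - {j}) = cell_of a (K - {k})"
  have c: "card (K - {j}) = Suc i" "card (K - {k}) = Suc i" using K_props(5) jk by auto
  have "K - {j} = K - {k}"
  proof (cases "i = 0")
    case True
    then obtain x y where xy: "K - {j} = {x}" "K - {k} = {y}"
      using c by (metis One_nat_def card_1_singletonE)
    then have "single x (1::nat) = single y 1" using eq by simp
    then have "x = y" by (metis lookup_single_eq lookup_single_not_eq zero_neq_one)
    then show ?thesis using xy by simp
  qed (use eq c in \<open>simp add: cell_of_card\<close>)
  then show "j = k" using jk by auto
qed

lemma morse_paths_eq:
  "morse_paths (hypersimplicial d) (hyper_matching d) (a, K) c' =
    (\<lambda>j. [(a, K), cell_of a (K - {j})]) ` {j \<in> K. cell_of a (K - {j}) = c'} \<union>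
    (if turns then (\<lambda>j. [(a, K), (a, K - {m}), (b, M), (b + single j 1, M - {j})]) `
      {j \<in> M - {f}. (b + single j 1, M - {j}) = c'} else {})"
proof -
  have "morse_paths (hypersimplicial d) (hyper_matching d) (a, K) c' = {(a, K) # p |p. walk ((a, K) # p)}"
  proof (intro equalityI subsetI)
    fix p assume p: "p \<in> morse_paths (hypersimplicial d) (hyper_matching d) (a, K) c'"
    then obtain q where q: "p = (a, K) # q" by (cases p) (auto simp: morse_paths_def)
    have "walk ((a, K) # q)"
      using p K_props(4) unfolding q morse_paths_def walk_def successively_conv_nth by auto
    then show "p \<in> {(a, K) # p |p. walk ((a, K) # p)}" using q by blast
  next
    fix p assume "p \<in> {(a, K) # p |p. walk ((a, K) # p)}"
    then obtain q where q: "p = (a, K) # q" "walk ((a, K) # q)" by blast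
    then show "p \<in> morse_paths (hypersimplicial d) (hyper_matching d) (a, K) c'"
      using K_props(4) unfolding q(1) morse_paths_def walk_def successively_conv_nth by auto
  qed
  then show ?thesis unfolding walk_from_a_K by auto
qed

text \<open>Each edge weight carries the \<open>cell_sign\<close> of both ends, and those of
  intermediate cells are squared away. On a turning path both facets of (b, M) are of the kind y_j =
  b_j + 1: one minus sign is undone by the weight of the reversed edge, the other remains.\<close>

lemma morse_incidence_eq:
  assumes ori: "oriented (hypersimplicial d) ori"
  shows "morse_incidence (hypersimplicial d) ori (hyper_matching d) (a, K) c' =
    cell_sign ori (a, K) * cell_sign ori c' *
      ((\<Sum>j\<in>K. if cell_of a (K - {j}) = c' then rem_sign K j else 0) +
       (if turns then \<Sum>j\<in>M - {f}. if (b + single j 1, M - {j}) = c' then - rem_sign M j else 0 else 0))"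
proof -
  let ?H = "hypersimplicial d :: ('n hcell, _, 'n) polycomplex" and ?A = "hyper_matching d :: ('n hcell \<times> _) set"
  let ?w = "\<lambda>p. \<Prod>k<length p - 1. edge_weight ?H ori ?A (p ! k) (p ! Suc k)"
  let ?P = "\<lambda>j. [(a, K), cell_of a (K - {j})]"
  let ?Q = "\<lambda>j. [(a, K), (a, K - {m}), (b, M), (b + single j 1, M - {j})]"
  let ?X = "{j \<in> K. cell_of a (K - {j}) = c'}"
  let ?Y = "{j \<in> M - {f}. (b + single j 1, M - {j}) = c'}"
  let ?s = "cell_sign ori (a, K) * cell_sign ori c'"
  have from_aK: "edge_weight ?H ori ?A (a, K) (cell_of a (K - {j})) =
      cell_sign ori (a, K) * cell_sign ori (cell_of a (K - {j})) * rem_sign K j" if "j \<in> K" for j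
    using incidence_zero_facet[OF ori edge_a_K[OF that] that] not_matched by (simp add: edge_weight_def)
  have wP: "?w (?P j) = ?s * rem_sign K j" if "j \<in> ?X" for j
    using from_aK[of j] that by simp
  have wQ: "?w (?Q j) = ?s * (- rem_sign M j)" if tu: turns and j: "j \<in> ?Y" for j
  proof -
    note tp = turn_props[OF tu]
    have M: "M - {f} = K - {m}" using tp(2) by auto
    have "cell_of a (K - {m}) = (a, K - {m})" using tu by (simp add: cell_of_card)
    moreover have "rem_sign K m = (1 :: int)" by (rule rem_sign_Min) simp
    ultimately have w1: "edge_weight ?H ori ?A (a, K) (a, K - {m}) = cell_sign ori (a, K) * cell_sign ori (a, K - {m})"
      using from_aK[OF K_props(2)] by simp
    have r: "Suc (total b) < d" using tp(5) t by simp
    have "rem_sign M f = (1 :: int)" by (rule rem_sign_Min) (metis Min_le finite tp(3))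
    then have "incidence ?H ori (b, M) (a, K - {m}) = - (cell_sign ori (b, M) * cell_sign ori (a, K - {m}))"
      using incidence_one_facet[OF ori edge_b_M[OF tu, of f] _ r] by (simp add: tp(4) M)
    then have w2: "edge_weight ?H ori ?A (a, K - {m}) (b, M) = cell_sign ori (b, M) * cell_sign ori (a, K - {m})"
      using tp(1) by (simp add: edge_weight_def)
    have "(x, (b, M)) \<notin> ?A" for x using target_props(4) tp(6) by blast
    then have w3: "edge_weight ?H ori ?A (b, M) c' = - (cell_sign ori (b, M) * cell_sign ori c' * rem_sign M j)"
      using incidence_one_facet[OF ori edge_b_M[OF tu, of j] _ r] j by (simp add: edge_weight_def)
    have "(a, K - {m}) \<in> cells ?H"
      using edge_a_K[OF K_props(2)] \<open>cell_of a (K - {m}) = _\<close> by (simp add: face_graph_def)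
    then have sq: "cell_sign ori (a, K - {m}) * cell_sign ori (a, K - {m}) = 1"
      "cell_sign ori (b, M) * cell_sign ori (b, M) = 1"
      using cell_sign_sq[OF ori] tp(8) by blast+
    have "?w (?Q j) = edge_weight ?H ori ?A (a, K) (a, K - {m}) * (edge_weight ?H ori ?A (a, K - {m}) (b, M) *
        edge_weight ?H ori ?A (b, M) c')"
    proof -
      have "?Q j = [(a, K), (a, K - {m}), (b, M), c']" using j by simp
      then show ?thesis by (simp only: prod_path_4)
    qed
    also have "\<dots> = ?s * (- rem_sign M j) * (cell_sign ori (a, K - {m}) * cell_sign ori (a, K - {m})) *
        (cell_sign ori (b, M) * cell_sign ori (b, M))"
      unfolding w1 w2 w3 by simp
    finally show ?thesis unfolding sq by simp
  qed
  have injP: "inj_on ?P ?X" using cell_of_remove_inj by (intro inj_onI) auto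
  have injQ: "inj_on ?Q ?Y" by (intro inj_onI) auto
  have sumP: "sum ?w (?P ` ?X) = ?s * (\<Sum>j\<in>K. if cell_of a (K - {j}) = c' then rem_sign K j else 0)"
  proof -
    have "sum ?w (?P ` ?X) = (\<Sum>j\<in>?X. ?s * rem_sign K j)"
      unfolding sum.reindex[OF injP] o_def by (rule sum.cong[OF refl wP])
    also have "\<dots> = ?s * (\<Sum>j\<in>?X. rem_sign K j)" by (rule sum_distrib_left[symmetric])
    also have "(\<Sum>j\<in>?X. rem_sign K j) = (\<Sum>j\<in>K. if cell_of a (K - {j}) = c' then rem_sign K j else 0 :: int)"
      by (rule sum.inter_filter) simp
    finally show ?thesis .
  qed
  have sumQ: "sum ?w (?Q ` ?Y) = ?s * (\<Sum>j\<in>M - {f}. if (b + single j 1, M - {j}) = c' then - rem_sign M j else 0)" if turns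
  proof -
    have "sum ?w (?Q ` ?Y) = (\<Sum>j\<in>?Y. ?s * (- rem_sign M j))"
      unfolding sum.reindex[OF injQ] o_def by (rule sum.cong[OF refl wQ[OF that]])
    also have "\<dots> = ?s * (\<Sum>j\<in>?Y. - rem_sign M j)" by (rule sum_distrib_left[symmetric])
    also have "(\<Sum>j\<in>?Y. - rem_sign M j) = (\<Sum>j\<in>M - {f}. if (b + single j 1, M - {j}) = c' then - rem_sign M j else 0 :: int)"
      by (rule sum.inter_filter) simp
    finally show ?thesis .
  qed
  have "morse_incidence ?H ori ?A (a, K) c' = sum ?w (?P ` ?X \<union> (if turns then ?Q ` ?Y else {}))"
    unfolding morse_incidence_def morse_paths_eq ..
  also have "\<dots> = sum ?w (?P ` ?X) + (if turns then sum ?w (?Q ` ?Y) else 0)"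
    by (cases turns) (auto intro!: sum.union_disjoint)
  finally have eq: "morse_incidence ?H ori ?A (a, K) c' = sum ?w (?P ` ?X) + (if turns then sum ?w (?Q ` ?Y) else 0)" .
  show ?thesis
  proof (cases turns)
    case True
    show ?thesis unfolding eq if_P[OF True] sumQ[OF True] sumP distrib_left ..
  next
    case False
    show ?thesis unfolding eq if_not_P[OF False] sumP by simp
  qed
qed

end

end

section \<open>Powers of the maximal ideal\<close>

text \<open>The power of the maximal ideal in monomial form, where membership can be tested term by
  term.\<close>

definition order_ge :: "nat \<Rightarrow> ('n::finite, 'k::field) mpol set"
  where "order_ge e = {p. \<forall>u\<in>keys p. e \<le> total u}"

lemma subspace_order_ge: "rmod.subspace (order_ge e)"
proof (rule rmod.subspaceI)
  fix c x :: "('n::finite, 'k::field) mpol"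
  assume x: "x \<in> order_ge e"
  show "c * x \<in> order_ge e"
    unfolding order_ge_def
  proof (intro CollectI ballI)
    fix u assume "u \<in> keys (c * x)"
    then obtain v w where "u = v + w" "w \<in> keys x" using keys_mult[of c x] by auto
    then show "e \<le> total u" using x by (auto simp: order_ge_def total_plus trans_le_add2)
  qed
qed (use keys_add in \<open>fastforce simp: order_ge_def\<close>)+

lemma order_ge_single: "single u c \<in> order_ge e \<longleftrightarrow> c = 0 \<or> e \<le> total u"
  by (auto simp: order_ge_def)

lemma mem_span_of_monomials:
  fixes p :: "('n, 'k::field) mpol"
  assumes "\<And>u. u \<in> keys p \<Longrightarrow> single u (lookup p u) \<in> rmod.span S"
  shows "p \<in> rmod.span S"
  by (subst poly_mapping_sum_single) (intro rmod.span_sum assms)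

lemma exists_divisor_of_total:
  assumes "e \<le> total u" shows "\<exists>v w. u = v + w \<and> total v = (e :: nat)"
  using assms
proof (induction "total u - e" arbitrary: u)
  case 0
  then show ?case by (intro exI[of _ u] exI[of _ 0]) auto
next
  case (Suc k)
  then have "u \<noteq> 0" by auto
  then obtain i where i: "i \<in> keys u" by fastforce
  have "k = total (u - single i 1) - e" "e \<le> total (u - single i 1)"
    using Suc.hyps(2) total_diff_single[OF i] by linarith+
  from Suc.hyps(1)[OF this] obtain v w where "u - single i 1 = v + w" "total v = e" by blast
  then show ?case using diff_single_add[OF i] by (intro exI[of _ v] exI[of _ "w + single i 1"]) (simp flip: add.assoc)
qed

lemma max_ideal_eq: "max_ideal = (order_ge 1 :: ('n::finite, 'k::field) mpol set)"
proof
  show "max_ideal \<subseteq> (order_ge 1 :: ('n, 'k) mpol set)"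
    unfolding max_ideal_def by (rule rmod.span_minimal) (auto simp: xvar_def order_ge_single subspace_order_ge)
  show "order_ge 1 \<subseteq> (max_ideal :: ('n, 'k) mpol set)"
  proof
    fix p :: "('n, 'k) mpol" assume p: "p \<in> order_ge 1"
    show "p \<in> max_ideal" unfolding max_ideal_def
    proof (rule mem_span_of_monomials)
      fix u assume "u \<in> keys p"
      then have "total u \<noteq> 0" using p by (auto simp: order_ge_def)
      then have "u \<noteq> 0" by auto
      then obtain i where i: "i \<in> keys u" by fastforce
      have "single (u - single i 1) (lookup p u) * xvar i = (single u (lookup p u) :: ('n, 'k) mpol)"
        using diff_single_add[OF i] by (simp add: xvar_def mult_single)
      moreover have "single (u - single i 1) (lookup p u) * xvar i \<in> rmod.span (range xvar)"
        by (intro rmod.span_scale rmod.span_base) auto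
      ultimately show "single u (lookup p u) \<in> rmod.span (range xvar)" by simp
    qed
  qed
qed

lemma ideal_power_max_ideal: "ideal_power max_ideal e = (order_ge e :: ('n::finite, 'k::field) mpol set)"
proof (induction e)
  case 0
  show ?case by (auto simp: order_ge_def)
next
  case (Suc e)
  have "{a * b |a b. a \<in> max_ideal \<and> b \<in> order_ge e} \<subseteq> (order_ge (Suc e) :: ('n, 'k) mpol set)"
  proof safe
    fix p q :: "('n, 'k) mpol" assume pq: "p \<in> max_ideal" "q \<in> order_ge e"
    show "p * q \<in> order_ge (Suc e)"
      unfolding order_ge_def
    proof (intro CollectI ballI)
      fix u assume "u \<in> keys (p * q)"
      then obtain v w where "u = v + w" "v \<in> keys p" "w \<in> keys q" using keys_mult[of p q] by auto
      moreover from this have "1 \<le> total v" "e \<le> total w" using pq by (auto simp: order_ge_def max_ideal_eq)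
      ultimately show "Suc e \<le> total u" by (simp add: total_plus)
    qed
  qed
  then have "rmod.span {a * b |a b. a \<in> max_ideal \<and> b \<in> order_ge e} \<subseteq> (order_ge (Suc e) :: ('n, 'k) mpol set)"
    by (rule rmod.span_minimal) (rule subspace_order_ge)
  moreover have "order_ge (Suc e) \<subseteq> rmod.span {a * b |a b. a \<in> max_ideal \<and> b \<in> (order_ge e :: ('n, 'k) mpol set)}"
  proof
    fix p :: "('n, 'k) mpol" assume p: "p \<in> order_ge (Suc e)"
    show "p \<in> rmod.span {a * b |a b. a \<in> max_ideal \<and> b \<in> order_ge e}"
    proof (rule mem_span_of_monomials)
      fix u assume u: "u \<in> keys p"
      then have tu: "Suc e \<le> total u" using p by (auto simp: order_ge_def)
      then have "u \<noteq> 0" by auto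
      then obtain i where i: "i \<in> keys u" by fastforce
      have "xvar i * single (u - single i 1) (lookup p u) = (single u (lookup p u) :: ('n, 'k) mpol)"
        unfolding xvar_mult_single diff_single_add[OF i] ..
      moreover have "xvar i \<in> (max_ideal :: ('n, 'k) mpol set)"
        by (simp add: max_ideal_eq xvar_def order_ge_single)
      moreover have "single (u - single i 1) (lookup p u) \<in> order_ge e"
        using tu total_diff_single[OF i] by (simp add: order_ge_single)
      ultimately show "single u (lookup p u) \<in> rmod.span {a * b |a b. a \<in> max_ideal \<and> b \<in> order_ge e}"
        by (intro rmod.span_base CollectI) metis
    qed
  qed
  ultimately show ?case by (simp add: Suc.IH)
qed

lemma min_gens_order_ge: "min_gens (order_ge e :: ('n::finite, 'k::field) mpol set) = {u. total u = e}"
proof (intro equalityI subsetI CollectI)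
  fix u assume u: "u \<in> min_gens (order_ge e :: ('n, 'k) mpol set)"
  then have "e \<le> total u" by (simp add: min_gens_def order_ge_single)
  then obtain v w where vw: "u = v + w" "total v = e" using exists_divisor_of_total by blast
  have "\<forall>v w. single v 1 \<in> (order_ge e :: ('n, 'k) mpol set) \<longrightarrow> u = v + w \<longrightarrow> v = u"
    using u unfolding min_gens_def by blast
  moreover have "single v 1 \<in> (order_ge e :: ('n, 'k) mpol set)" by (simp add: order_ge_single vw)
  ultimately have "v = u" using vw(1) by blast
  then show "total u = e" using vw(2) by simp
next
  fix u :: "'n expo" assume "u \<in> {u. total u = e}"
  then have u: "total u = e" by simp
  have "v = u" if "e \<le> total v" "u = v + w" for v w
  proof -
    have "total w = 0" using that u total_plus[of v w] by simp
    then have "w = 0" by (simp only: total_eq_0_iff)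
    then show ?thesis using that by simp
  qed
  then show "u \<in> min_gens (order_ge e :: ('n, 'k) mpol set)"
    using u by (auto simp: min_gens_def order_ge_single)
qed

lemma ideal_times_module_free_on:
  fixes g :: "'b \<Rightarrow>\<^sub>0 's::comm_ring_1"
  assumes "g \<in> free_on B" "\<And>b. lookup g b \<in> I"
  shows "g \<in> ideal_times_module I (free_on B)"
proof -
  have "(\<Sum>b\<in>keys g. fscale (lookup g b) (single b 1)) \<in> ideal_times_module I (free_on B)"
    unfolding ideal_times_module_def
  proof (intro fmod.span_sum fmod.span_base CollectI exI conjI)
    fix b assume "b \<in> keys g"
    then show "single b 1 \<in> free_on B" using assms(1) by (auto simp: mem_free_on)
  qed (use assms(2) in auto)
  then show ?thesis by (simp flip: poly_mapping_sum_single)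
qed

lemma linear_between_lin_ext:
  assumes "\<And>b. b \<in> B \<Longrightarrow> g b \<in> free_on B'"
  shows "linear_between fscale fscale (free_on B) (free_on B') (lin_ext g)"
  unfolding linear_between_def
  by (auto simp: lin_ext_add lin_ext_fscale intro!: lin_ext_in_free_on[OF _ assms])

section \<open>Comparison with the \<open>L\<close>-complex\<close>

lemma single_of_int_mult: "single u (of_int z) = of_int z * (single u 1 :: ('n, 'k::field) mpol)"
proof -
  have "of_int z * (single u 1 :: ('n, 'k) mpol) = single 0 (of_int z) * single u 1" by simp
  then show ?thesis by (simp only: mult_single) simp
qed

definition cell_gen :: "'n::{finite,linorder} hcell \<Rightarrow> 'n lbasis \<Rightarrow>\<^sub>0 's::comm_ring_1"
  where "cell_gen c = basis_elt (snd (pair_of c)) (fst (pair_of c))"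

lemma symm_diff_singleton: "symm_diff (basis_elt {k} a) = basis_elt {} (a + single k 1)"
proof -
  have "rem_sign {k} k = (1 :: 'b)" by (rule rem_sign_Min) simp
  then show ?thesis by (simp add: symm_diff_single)
qed

text \<open>If K is a singleton that is not leading, \<open>pair_of\<close> splits the vertex
  differently from (a, K); \<open>symm_diff\<close> forgets the splitting and returns the power
  given by the vertex.\<close>

lemma symm_diff_cell_gen_cell_of:
  assumes "lead a K \<or> card K = 1" "K \<noteq> {}"
  shows "symm_diff (cell_gen (cell_of a K)) = symm_diff (basis_elt K a)"
proof (cases "card K = 1")
  case True
  then obtain k where k: "K = {k}" by (rule card_1_singletonE)
  have "Min (keys (a + single k 1)) \<in> keys (a + single k 1)"
    by (intro Min_in) (auto simp: keys_add_single)
  then show ?thesis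
    unfolding k cell_of_singleton cell_gen_def pair_of_def
    by (simp add: symm_diff_singleton diff_single_add)
next
  case False
  then show ?thesis using assms by (simp add: cell_gen_def pair_of_cell_of)
qed

lemma finite_total: "finite {a :: 'n::finite expo. total a = k}"
proof (rule finite_imageD)
  have "lookup a \<in> Pi\<^sub>E UNIV (\<lambda>_. {..k})" if "total a = k" for a :: "'n expo"
  proof (rule PiE_I)
    show "lookup a x \<in> {..k}" for x using lookup_total_le[of a x] that by simp
  qed simp
  then have "lookup ` {a :: 'n expo. total a = k} \<subseteq> Pi\<^sub>E UNIV (\<lambda>_. {..k})" by blast
  moreover have "finite (Pi\<^sub>E UNIV (\<lambda>_ :: 'n. {..k}))" by (rule finite_PiE) simp_all
  ultimately show "finite (lookup ` {a :: 'n expo. total a = k})" by (rule finite_subset)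
  show "inj_on lookup {a :: 'n expo. total a = k}" by (rule inj_onI) (simp only: poly_mapping_eq_iff)
qed

text \<open>The cellular differential is a sum over cells, which by convention would be 0 over an
  infinite set.\<close>

lemma finite_critical:
  assumes d: "d \<ge> 1"
  shows "finite (critical (hypersimplicial d) (hyper_matching d :: ('n::{finite,linorder} hcell \<times> _) set) i)"
proof (rule finite_subset)
  let ?P = "{a :: 'n expo. total a = d - 1} \<times> (UNIV :: 'n set set)"
  show "critical (hypersimplicial d) (hyper_matching d :: ('n hcell \<times> _) set) i \<subseteq> (\<lambda>(a, K). cell_of a K) ` ?P"
  proof
    fix c assume c: "c \<in> critical (hypersimplicial d) (hyper_matching d :: ('n hcell \<times> _) set) i"
    obtain a K where p: "pair_of c = (a, K)" by (cases "pair_of c")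
    have "(a, K) \<in> ?P" "c = (\<lambda>(a, K). cell_of a K) (a, K)"
      using critical_props(2,4)[OF c d p] by auto
    then show "c \<in> (\<lambda>(a, K). cell_of a K) ` ?P" by (rule rev_image_eqI)
  qed
  show "finite ((\<lambda>(a, K). cell_of a K) ` ?P)" by (intro finite_imageI finite_cartesian_product finite_total) simp
qed

definition to_L_basis ::
    "('n::{finite,linorder} hcell \<Rightarrow> (real ^ 'n::{finite,linorder}) list) \<Rightarrow> 'n hcell option \<Rightarrow> ('n, 'k::field) L_elt"
  where "to_L_basis ori b = (case b of None \<Rightarrow> single None 1
    | Some c \<Rightarrow> fscale (of_int (cell_sign ori c)) (symm_diff (cell_gen c)))"

definition to_L ::
    "('n::{finite,linorder} hcell \<Rightarrow> (real ^ 'n::{finite,linorder}) list) \<Rightarrow>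
      (('n, 'k::field) cell_elt) \<Rightarrow> ('n, 'k) L_elt"
  where "to_L ori = lin_ext (to_L_basis ori)"

lemma free_on_None:
  assumes "f \<in> free_on {None}" shows "f = single None (lookup f None)"
proof (rule poly_mapping_eqI)
  fix k
  have "k = None \<or> lookup f k = 0" using assms by (auto simp: mem_free_on simp flip: not_in_keys_iff_lookup_eq_zero)
  then show "lookup f k = lookup (single None (lookup f None)) k"
    by (metis lookup_single_eq lookup_single_not_eq)
qed

context
  fixes d :: nat and ori :: "'n::{finite,linorder} hcell \<Rightarrow> (real ^ 'n::{finite,linorder}) list"
  assumes d: "d \<ge> 1" and ori: "oriented (hypersimplicial d) ori"
begin

private abbreviation (input) "crit \<equiv> critical (hypersimplicial d) (hyper_matching d :: ('n hcell \<times> _) set)"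
private abbreviation (input) "inc \<equiv> morse_incidence (hypersimplicial d) ori (hyper_matching d)"
private abbreviation (input) "deg \<equiv> mdeg (hypersimplicial d :: ('n hcell, _, 'n) polycomplex)"
private abbreviation (input) "cs \<equiv> cell_sign ori"
private abbreviation (input) "Y \<equiv> morse_complex (hypersimplicial d) ori (hyper_matching d)"

lemma crit_cells: "c \<in> crit i \<Longrightarrow> c \<in> cells (hypersimplicial d)"
  by (simp add: critical_def)

lemma crit_pos:
  assumes "c \<in> crit (Suc i)"
  obtains a K where "c = (a, K)" "card K = Suc (Suc i)" "Suc (total a) = d" "lead a K" "pair_of c = (a, K)"
proof -
  obtain a K where p: "pair_of c = (a, K)" by (cases "pair_of c")
  note cp = critical_props[OF assms d p]
  then have "c = (a, K)" by (auto simp: cell_of_def split: if_splits)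
  then show ?thesis using that cp p by blast
qed

lemma deg_remove:
  assumes "j \<in> K" shows "deg (a, K) = single j 1 + deg (cell_of a (K - {j}))"
  using assms sum.remove[of K j "\<lambda>j. single j 1 :: 'n expo"]
  by (simp add: mdeg_cell_of mdeg_hypersimplicial ac_simps)

text \<open>After the first step of a turning path, every step only moves an index between exponent
  and set. So the whole path costs one variable, that of Min K.\<close>

lemma deg_turn:
  assumes "Min K \<in> K" "f \<notin> K - {Min K}" "b + single f 1 = a" "j \<in> insert f (K - {Min K})"
  shows "deg (a, K) = single (Min K) 1 + deg (b + single j 1, insert f (K - {Min K}) - {j})"
proof -
  let ?M = "insert f (K - {Min K})" and ?s = "\<lambda>j. single j 1 :: 'n expo"
  have "deg (b + single j 1, ?M - {j}) = b + sum ?s ?M"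
    using assms(4) sum.remove[of ?M j ?s] by (simp add: mdeg_hypersimplicial add.assoc del: insert_Diff_single)
  also have "\<dots> = b + (?s f + sum ?s (K - {Min K}))" using assms(2) by (subst sum.insert) auto
  also have "\<dots> = a + sum ?s (K - {Min K})" using assms(3) by (simp flip: add.assoc)
  finally show ?thesis
    using assms(1) sum.remove[of K "Min K" ?s] by (simp add: mdeg_hypersimplicial ac_simps)
qed

text \<open>Replaces the quotient of multidegrees by a variable: x_j for the direct facet at j, x_m
  for every turning path. The extra factor \<open>cs c'\<close> is the one in
  \<open>to_L_basis\<close> and squares away against the incidence number. The second claim is the
  source of multihomogeneity and minimality in positive dimension.\<close>

lemma incidence_coefficient:
  assumes c: "(a, K) \<in> crit (Suc i)" "card K = Suc (Suc i)" "Suc (total a) = d" "lead a K" and c': "c' \<in> crit i"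
  defines "m \<equiv> Min K" and "f \<equiv> Min (keys a)"
  defines "M \<equiv> insert f (K - {m})" and "b \<equiv> a - single f 1"
    and "turns \<equiv> card (K - {m}) \<noteq> 1 \<and> \<not> lead a (K - {m})"
  shows "single (deg (a, K) - deg c') (of_int (inc (a, K) c')) * of_int (cs c') =
    (of_int (cs (a, K)) * ((\<Sum>j\<in>K. if cell_of a (K - {j}) = c' then rem_sign K j * xvar j else 0) +
      (if turns then \<Sum>j\<in>M - {f}. if (b + single j 1, M - {j}) = c' then - rem_sign M j * xvar m else 0 else 0)) :: ('n, 'k::field) mpol)"
    and "inc (a, K) c' \<noteq> 0 \<Longrightarrow> \<exists>j. deg (a, K) = single j 1 + deg c'"
proof -
  let ?N1 = "\<Sum>j\<in>K. if cell_of a (K - {j}) = c' then rem_sign K j else 0 :: int"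
  let ?N2 = "if turns then \<Sum>j\<in>M - {f}. if (b + single j 1, M - {j}) = c' then - rem_sign M j else 0 else 0 :: int"
  have inc: "inc (a, K) c' = cs (a, K) * cs c' * (?N1 + ?N2)"
    unfolding m_def f_def M_def b_def turns_def by (rule morse_incidence_eq[OF d c' c(2-4) ori])
  have d1: "deg (a, K) = single j 1 + deg c'" if "j \<in> K" "cell_of a (K - {j}) = c'" for j
    using deg_remove[OF that(1), of a] that(2) by simp
  have d2: "deg (a, K) = single m 1 + deg c'" if tu: "turns" and "j \<in> M - {f}" "(b + single j 1, M - {j}) = c'" for j
  proof -
    have "K \<noteq> {}" using c(2) by auto
    then have "Min K \<in> K" by simp
    moreover note turn_props(2,4)[OF d c' c(2-4)]
    ultimately show ?thesis
      using deg_turn[of K f b a j] tu that(2,3) unfolding m_def f_def M_def b_def turns_def by auto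
  qed
  have e1: "of_int ?N1 * single (deg (a, K) - deg c') 1 =
      (\<Sum>j\<in>K. if cell_of a (K - {j}) = c' then rem_sign K j * xvar j else 0 :: ('n, 'k) mpol)"
    unfolding of_int_sum sum_distrib_right
  proof (intro sum.cong refl)
    fix j assume "j \<in> K"
    then show "of_int (if cell_of a (K - {j}) = c' then rem_sign K j else 0) * single (deg (a, K) - deg c') 1 =
        (if cell_of a (K - {j}) = c' then rem_sign K j * xvar j else 0 :: ('n, 'k) mpol)"
      using d1[of j] by (simp add: xvar_def)
  qed
  have e2: "of_int ?N2 * single (deg (a, K) - deg c') 1 =
      (if turns then \<Sum>j\<in>M - {f}. if (b + single j 1, M - {j}) = c' then - rem_sign M j * xvar m else 0 else 0 :: ('n, 'k) mpol)"
  proof (cases turns)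
    case True
    show ?thesis
      unfolding if_P[OF True] of_int_sum sum_distrib_right
    proof (intro sum.cong refl)
      fix j assume j: "j \<in> M - {f}"
      show "of_int (if (b + single j 1, M - {j}) = c' then - rem_sign M j else 0) * single (deg (a, K) - deg c') 1 =
          (if (b + single j 1, M - {j}) = c' then - rem_sign M j * xvar m else 0 :: ('n, 'k) mpol)"
      proof (cases "(b + single j 1, M - {j}) = c'")
        case eq: True
        show ?thesis unfolding if_P[OF eq] d2[OF True j eq] by (simp add: xvar_def)
      qed simp
    qed
  qed simp
  have sq: "cs c' * cs c' = 1" using cell_sign_sq[OF ori crit_cells[OF c']] .
  have "single (deg (a, K) - deg c') (of_int (inc (a, K) c')) * of_int (cs c') =
      of_int (inc (a, K) c' * cs c') * (single (deg (a, K) - deg c') 1 :: ('n, 'k) mpol)"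
    unfolding single_of_int_mult[of _ "inc (a, K) c'"] of_int_mult by (simp only: mult_ac)
  also have "inc (a, K) c' * cs c' = cs (a, K) * (?N1 + ?N2) * (cs c' * cs c')"
    unfolding inc by (simp only: mult_ac)
  also have "of_int \<dots> * (single (deg (a, K) - deg c') 1 :: ('n, 'k) mpol) =
      of_int (cs (a, K)) * (of_int ?N1 * single (deg (a, K) - deg c') 1 + of_int ?N2 * single (deg (a, K) - deg c') 1)"
    unfolding sq of_int_mult of_int_add by (simp only: mult.assoc distrib_right of_int_1 mult_1_right mult_1_left)
  finally show "single (deg (a, K) - deg c') (of_int (inc (a, K) c')) * of_int (cs c') =
    (of_int (cs (a, K)) * ((\<Sum>j\<in>K. if cell_of a (K - {j}) = c' then rem_sign K j * xvar j else 0) +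
      (if turns then \<Sum>j\<in>M - {f}. if (b + single j 1, M - {j}) = c' then - rem_sign M j * xvar m else 0 else 0)) :: ('n, 'k::field) mpol)"
    unfolding e1 e2 .
  assume "inc (a, K) c' \<noteq> 0"
  then have "?N1 \<noteq> 0 \<or> ?N2 \<noteq> 0" using inc by auto
  then show "\<exists>j. deg (a, K) = single j 1 + deg c'"
  proof
    assume "?N1 \<noteq> 0"
    then obtain j where "j \<in> K" "(if cell_of a (K - {j}) = c' then rem_sign K j else 0 :: int) \<noteq> 0"
      by (rule sum.not_neutral_contains_not_neutral)
    then show ?thesis using d1[of j] by (auto split: if_splits)
  next
    assume N2: "?N2 \<noteq> 0"
    then have tu: turns by (cases turns) simp_all
    have "(\<Sum>j\<in>M - {f}. if (b + single j 1, M - {j}) = c' then - rem_sign M j else 0 :: int) \<noteq> 0"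
      using N2 unfolding if_P[OF tu] .
    then obtain j where "j \<in> M - {f}" "(if (b + single j 1, M - {j}) = c' then - rem_sign M j else 0 :: int) \<noteq> 0"
      by (rule sum.not_neutral_contains_not_neutral)
    then show ?thesis using d2[OF tu, of j] by (auto split: if_splits)
  qed
qed

text \<open>The relation \<open>symm_diff (symm_diff (f\<^sub>M \<otimes> f\<^sup>b)) = 0\<close> accounts for the paths of length three.\<close>

lemma symm_diff_turn:
  fixes K :: "'n set"
  assumes "f \<notin> L" "\<And>l. l \<in> L \<Longrightarrow> f < l" "b + single f 1 = a"
  shows "symm_diff (basis_elt L a) = (\<Sum>j\<in>insert f L - {f}. fscale (- rem_sign (insert f L) j)
    (symm_diff (basis_elt (insert f L - {j}) (b + single j 1) :: 'n lbasis \<Rightarrow>\<^sub>0 's::comm_ring_1)))"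
proof -
  let ?M = "insert f L"
  let ?t = "\<lambda>j. fscale (rem_sign ?M j) (symm_diff (basis_elt (?M - {j}) (b + single j 1) :: 'n lbasis \<Rightarrow>\<^sub>0 's))"
  have "0 = symm_diff (symm_diff (basis_elt ?M b :: 'n lbasis \<Rightarrow>\<^sub>0 's))" by (simp only: symm_diff_symm_diff)
  also have "\<dots> = (\<Sum>j\<in>?M. ?t j)"
    unfolding symm_diff_single[of ?M] symm_diff_sum symm_diff_fscale ..
  also have "\<dots> = ?t f + (\<Sum>j\<in>?M - {f}. ?t j)" by (rule sum.remove) auto
  also have "?t f = symm_diff (basis_elt L a)"
  proof -
    have "rem_sign ?M f = (1 :: 's)" by (rule rem_sign_Min) (use assms(2) in \<open>auto intro: less_imp_le\<close>)
    moreover have "?M - {f} = L" using assms(1) by auto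
    ultimately show ?thesis using assms(3) by simp
  qed
  finally have "symm_diff (basis_elt L a) = - (\<Sum>j\<in>?M - {f}. ?t j)" by (simp only: eq_neg_iff_add_eq_0)
  then show ?thesis by (simp only: fmod.scale_minus_left sum_negf)
qed

text \<open>The sum over critical facets reassembles the sum over j in K of x_j times
  \<open>symm_diff\<close> of f_(K - {j}) \<otimes> f^a, with its signs; this is
  \<open>symm_diff\<close> of \<open>coef_diff\<close>, and the two anticommute. Direct facets
  supply every critical j. If the facet at m is not critical, the turning paths supply the missing
  term through \<open>symm_diff_turn\<close>.\<close>

lemma to_L_morse_boundary:
  assumes c: "c \<in> crit (Suc i)"
  shows "(\<Sum>c'\<in>crit i. fscale (single (deg c - deg c') (of_int (inc c c'))) (to_L_basis ori (Some c'))) =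
    - coef_diff (to_L_basis ori (Some c) :: ('n, 'k::field) L_elt)"
proof -
  obtain a K where aK: "c = (a, K)" and K: "card K = Suc (Suc i)" and t: "Suc (total a) = d" and l: "lead a K"
    and pr: "pair_of c = (a, K)" using crit_pos[OF c] .
  define m f where "m = Min K" and "f = Min (keys a)"
  define M b where "M = insert f (K - {m})" and "b = a - single f 1"
  define turns where "turns \<longleftrightarrow> card (K - {m}) \<noteq> 1 \<and> \<not> lead a (K - {m})"
  let ?D = "\<lambda>c'. symm_diff (cell_gen c') :: ('n, 'k) L_elt"
  let ?T = "\<lambda>j. fscale (rem_sign K j * xvar j) (symm_diff (basis_elt (K - {j}) a)) :: ('n, 'k) L_elt"
  have ne: "K \<noteq> {}" using K by auto
  then have mK: "m \<in> K" by (simp add: m_def)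
  have card_rem: "card (K - {j}) = Suc i" "K - {j} \<noteq> {}" if "j \<in> K" for j
  proof -
    show "card (K - {j}) = Suc i" using K that by simp
    then show "K - {j} \<noteq> {}" by (intro card_pos_nonempty) simp
  qed
  have fin: "finite (crit i)" by (rule finite_critical[OF d])
  have "fscale (single (deg c - deg c') (of_int (inc c c'))) (to_L_basis ori (Some c')) =
      fscale (of_int (cs c)) ((\<Sum>j\<in>K. if cell_of a (K - {j}) = c' then fscale (rem_sign K j * xvar j) (?D c') else 0) +
       (if turns then \<Sum>j\<in>M - {f}. if (b + single j 1, M - {j}) = c' then fscale (- rem_sign M j * xvar m) (?D c') else 0 else 0))"
    if c': "c' \<in> crit i" for c'
  proof -
    have if_scale: "fscale (if P then x else 0) y = (if P then fscale x y else 0)"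
      for P and x :: "('n, 'k) mpol" and y :: "('n, 'k) L_elt" by simp
    show ?thesis
      unfolding to_L_basis_def option.case fmod.scale_scale aK
        incidence_coefficient(1)[OF c[unfolded aK] K t l c', folded m_def f_def, folded M_def b_def turns_def]
      by (simp only: fmod.scale_left_distrib fmod.scale_sum_left if_scale flip: fmod.scale_scale[of "of_int _"])
  qed
  then have "(\<Sum>c'\<in>crit i. fscale (single (deg c - deg c') (of_int (inc c c'))) (to_L_basis ori (Some c'))) =
      fscale (of_int (cs c)) (\<Sum>c'\<in>crit i. (\<Sum>j\<in>K. if cell_of a (K - {j}) = c' then fscale (rem_sign K j * xvar j) (?D c') else 0) +
       (if turns then \<Sum>j\<in>M - {f}. if (b + single j 1, M - {j}) = c' then fscale (- rem_sign M j * xvar m) (?D c') else 0 else 0))"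
    unfolding fmod.scale_sum_right by (intro sum.cong refl)
  also have "(\<Sum>c'\<in>crit i. (\<Sum>j\<in>K. if cell_of a (K - {j}) = c' then fscale (rem_sign K j * xvar j) (?D c') else 0) +
       (if turns then \<Sum>j\<in>M - {f}. if (b + single j 1, M - {j}) = c' then fscale (- rem_sign M j * xvar m) (?D c') else 0 else 0)) =
     (\<Sum>j\<in>K. \<Sum>c'\<in>crit i. if cell_of a (K - {j}) = c' then fscale (rem_sign K j * xvar j) (?D c') else 0) +
       (if turns then \<Sum>j\<in>M - {f}. \<Sum>c'\<in>crit i. if (b + single j 1, M - {j}) = c' then fscale (- rem_sign M j * xvar m) (?D c') else 0 else 0)"
    (is "_ = ?S1 + ?S2")
    unfolding sum.distrib
    by (intro arg_cong2[where f = "(+)"] sum.swap) (cases turns, simp_all only: if_True if_False sum.neutral_const simp_thms, rule sum.swap)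
  also have "?S1 = (\<Sum>j\<in>K. if cell_of a (K - {j}) \<in> crit i then fscale (rem_sign K j * xvar j) (?D (cell_of a (K - {j}))) else 0)"
    using fin by (simp only: sum.delta')
  also have "?S2 = (if turns then \<Sum>j\<in>M - {f}. if (b + single j 1, M - {j}) \<in> crit i
      then fscale (- rem_sign M j * xvar m) (?D (b + single j 1, M - {j})) else 0 else 0)"
    using fin by (simp only: sum.delta')
  also have "(\<Sum>j\<in>K. if cell_of a (K - {j}) \<in> crit i then fscale (rem_sign K j * xvar j) (?D (cell_of a (K - {j}))) else 0) +
      (if turns then \<Sum>j\<in>M - {f}. if (b + single j 1, M - {j}) \<in> crit i
      then fscale (- rem_sign M j * xvar m) (?D (b + single j 1, M - {j})) else 0 else 0) = (\<Sum>j\<in>K. ?T j)"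
  proof -
    have good: "(if cell_of a (K - {j}) \<in> crit i then fscale (rem_sign K j * xvar j) (?D (cell_of a (K - {j}))) else 0) = ?T j"
      if j: "j \<in> K" and lj: "lead a (K - {j}) \<or> card (K - {j}) = 1" for j
    proof -
      have "cell_of a (K - {j}) \<in> crit i"
      proof (cases "card (K - {j}) = 1")
        case True
        then obtain k where k: "K - {j} = {k}" by (rule card_1_singletonE)
        \<comment> \<open>Here {k} need not be leading over a, so criticality is shown through the
          pair that splits off the smallest index of the vertex.\<close>
        let ?v = "a + single k 1"
        let ?n = "Min (keys ?v)"
        have n: "?n \<in> keys ?v" by (intro Min_in) (auto simp: keys_add_single)
        have "cell_of (?v - single ?n 1) {?n} \<in> crit i"
        proof (rule cell_of_critical)
          show "card {?n} = Suc i" using True card_rem[OF j] by simp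
          show "Suc (total (?v - single ?n 1)) = d" unfolding total_diff_single[OF n] using t by (simp add: total_plus)
          show "lead (?v - single ?n 1) {?n}"
            using keys_diff_single_subset[of ?v "single ?n 1"] by (auto simp: lead_def intro!: Min_le)
        qed
        then show ?thesis unfolding k cell_of_singleton diff_single_add[OF n] .
      next
        case False
        then show ?thesis using lj card_rem[OF j] t by (intro cell_of_critical) auto
      qed
      moreover have "?D (cell_of a (K - {j})) = symm_diff (basis_elt (K - {j}) a)"
        using lj card_rem(2)[OF j] by (rule symm_diff_cell_gen_cell_of)
      ultimately show ?thesis by simp
    qed
    have lead_rem: "lead a (K - {j})" if "j \<in> K" "j \<noteq> m" for j
      using lead_mono(1)[OF l that(1)] that(2) by (simp add: m_def)
    show ?thesis
    proof (cases turns)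
      case False
      have all_good: "lead a (K - {j}) \<or> card (K - {j}) = 1" if "j \<in> K" for j
        by (cases "j = m") (use lead_rem False that in \<open>auto simp: turns_def\<close>)
      show ?thesis
        unfolding if_not_P[OF False] by (simp only: add_0_right) (rule sum.cong[OF refl good], use all_good in auto)
    next
      case True
      obtain c' where "c' = cell_of a (K - {m})" by blast
      have ne': "K - {m} \<noteq> {}" and ci: "card (K - {m}) = Suc i" using card_rem[OF mK] by auto
      have i2: "2 \<le> Suc i" using True ci by (simp add: turns_def)
      have "total a < d" "d < total a + card (K - {m})" using t ci i2 by auto
      note pp = partner_props[OF this _ ne', folded f_def, folded b_def M_def]
      have nl: "\<not> lead a (K - {m})" using True by (simp add: turns_def)
      have nK: "f \<notin> K - {m}" and minM: "Min M = f" and lM: "lead b M" and fa: "f \<in> keys a" "Suc (total b) = total a"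
        and less: "f < Min (K - {m})"
        using pp nl by auto
      have ba: "b + single f 1 = a" unfolding b_def by (rule diff_single_add[OF fa(1)])
      have Mf: "M - {f} = K - {m}" using nK by (auto simp: M_def)
      have cM: "card M = Suc (Suc i)" using nK ci by (simp add: M_def)
      have "cell_of a (K - {m}) = (a, K - {m})" using True by (simp add: cell_of_card turns_def)
      \<comment> \<open>This facet is matched with (b, M) and drops out of the direct sum, leaving
        the gap at j = m.\<close>
      have "(a, K - {m}) \<notin> crit i"
      proof
        assume cr: "(a, K - {m}) \<in> crit i"
        have "pair_of (a, K - {m}) = (a, K - {m})" using ne' by (simp add: pair_of_def)
        then show False using critical_props(3)[OF cr d] nl by blast
      qed
      then have "(\<Sum>j\<in>K. if cell_of a (K - {j}) \<in> crit i then fscale (rem_sign K j * xvar j) (?D (cell_of a (K - {j}))) else 0) =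
          (\<Sum>j\<in>K - {m}. ?T j)"
        using mK \<open>cell_of a (K - {m}) = _\<close> good lead_rem by (subst sum.remove[of K m]) auto
      moreover have "(\<Sum>j\<in>M - {f}. if (b + single j 1, M - {j}) \<in> crit i
        then fscale (- rem_sign M j * xvar m) (?D (b + single j 1, M - {j})) else 0) = ?T m"
      proof -
        have "(if (b + single j 1, M - {j}) \<in> crit i then fscale (- rem_sign M j * xvar m) (?D (b + single j 1, M - {j})) else 0) =
          fscale (xvar m) (fscale (- rem_sign M j) (symm_diff (basis_elt (M - {j}) (b + single j 1))))" if j: "j \<in> M - {f}" for j
        proof -
          have jM: "j \<in> M" "j \<noteq> Min M" using j minM by auto
          have cj: "card (M - {j}) = Suc i" using cM jM by simp
          have lj: "lead (b + single j 1) (M - {j})" by (rule lead_mono(2)[OF lM jM])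
          have ceq: "cell_of (b + single j 1) (M - {j}) = (b + single j 1, M - {j})"
            using cj i2 by (intro cell_of_card) linarith
          have "(b + single j 1, M - {j}) \<in> crit i"
            using cell_of_critical[OF cj _ lj, of d] fa(2) t by (simp add: ceq total_plus)
          moreover have "M - {j} \<noteq> {}" using cj by (intro card_pos_nonempty) simp
          moreover have "?D (b + single j 1, M - {j}) = symm_diff (basis_elt (M - {j}) (b + single j 1))"
            using symm_diff_cell_gen_cell_of[of "b + single j 1" "M - {j}"] lj calculation(2)
            unfolding ceq by blast
          ultimately show ?thesis by (simp add: mult.commute)
        qed
        then have "(\<Sum>j\<in>M - {f}. if (b + single j 1, M - {j}) \<in> crit i
            then fscale (- rem_sign M j * xvar m) (?D (b + single j 1, M - {j})) else 0) =
          fscale (xvar m) (\<Sum>j\<in>M - {f}. fscale (- rem_sign M j) (symm_diff (basis_elt (M - {j}) (b + single j 1))))"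
          unfolding fmod.scale_sum_right by (rule sum.cong[OF refl])
        also have "(\<Sum>j\<in>M - {f}. fscale (- rem_sign M j) (symm_diff (basis_elt (M - {j}) (b + single j 1)))) =
          (symm_diff (basis_elt (K - {m}) a) :: ('n, 'k) L_elt)"
          unfolding M_def
          by (rule symm_diff_turn[OF nK _ ba, symmetric]) (use less Min_le[of "K - {m}"] in \<open>auto intro: less_le_trans\<close>)
        moreover have "rem_sign K m = (1 :: ('n, 'k) mpol)"
          by (rule rem_sign_Min) (simp add: m_def)
        ultimately show ?thesis by simp
      qed
      moreover have "(\<Sum>j\<in>K. ?T j) = ?T m + (\<Sum>j\<in>K - {m}. ?T j)" by (rule sum.remove) (use mK in auto)
      ultimately show ?thesis unfolding if_P[OF True] by (simp only: add.commute)
    qed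
  qed
  also have "fscale (of_int (cs c)) (\<Sum>j\<in>K. ?T j) = - coef_diff (to_L_basis ori (Some c))"
  proof -
    have "- coef_diff (to_L_basis ori (Some c)) = fscale (of_int (cs c)) (symm_diff (coef_diff (basis_elt K a :: ('n, 'k) L_elt)))"
      unfolding to_L_basis_def option.case coef_diff_fscale symm_diff_coef_diff cell_gen_def pr fst_conv snd_conv
      by (simp only: fmod.scale_minus_right)
    also have "symm_diff (coef_diff (basis_elt K a :: ('n, 'k) L_elt)) = (\<Sum>j\<in>K. ?T j)"
    proof -
      have "coef_diff (basis_elt K a :: ('n, 'k) L_elt) = (\<Sum>j\<in>K. fscale (rem_sign K j * xvar j) (basis_elt (K - {j}) a))"
        unfolding coef_diff_single by simp
      then show ?thesis by (simp only: symm_diff_sum symm_diff_fscale)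
    qed
    finally show ?thesis ..
  qed
  finally show ?thesis .
qed

section \<open>The cellular complex and the comparison chain map\<close>

definition cell_bd :: "nat \<Rightarrow> 'n hcell option \<Rightarrow> ('n, 'k::field) cell_elt"
  where "cell_bd i b = (\<Sum>b'\<in>cell_basis Y i. single b' (single (cell_deg Y b - cell_deg Y b') (of_int (aug_inc Y b b'))))"

lemma chain_diff_cellular: "chain_diff (cellular_complex Y) (Suc i) = lin_ext (cell_bd i)"
  by (simp add: cellular_complex_def cell_bd_def[abs_def])

lemma chain_mod_cellular: "chain_mod (cellular_complex Y) i = free_on (cell_basis Y i)"
  by (simp add: cellular_complex_def)

lemma cell_basis_Suc: "cell_basis Y (Suc i) = Some ` crit i"
  by (simp add: morse_complex_def)

lemma cell_deg_Some: "cell_deg Y (Some c) = mdeg (hypersimplicial d) c"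
  by (simp add: cell_deg_def morse_complex_def)

lemma finite_cell_basis: "finite (cell_basis Y i)"
  by (cases i) (simp_all add: cell_basis_Suc finite_critical[OF d] del: cell_basis.simps(2))

lemma lookup_cell_bd:
  "lookup (cell_bd i b) b' = (if b' \<in> cell_basis Y i then single (cell_deg Y b - cell_deg Y b') (of_int (aug_inc Y b b')) else 0)"
  by (simp add: cell_bd_def lookup_sum lookup_single when_def finite_cell_basis)

lemma cell_bd_in: "cell_bd i b \<in> free_on (cell_basis Y i)"
  unfolding cell_bd_def by (intro free_on_sum free_on_single)

lemma total_deg:
  assumes "c \<in> crit i" shows "total (mdeg (hypersimplicial d) c) = d + i"
proof -
  obtain a K where p: "pair_of c = (a, K)" by (cases "pair_of c")
  note cp = critical_props[OF assms d p]
  have "mdeg (hypersimplicial d) c = a + (\<Sum>j\<in>K. single j 1)" using mdeg_cell_of[of d a K] cp(4) by simp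
  then show ?thesis using cp(1,2) by (simp add: total_plus total_sum)
qed

text \<open>Over the generator of S the coefficient has degree d, which is positive; between
  critical cells it is a single variable. The bound on \<open>total m\<close> is what minimality
  uses.\<close>

lemma keys_cell_bd:
  assumes b: "b \<in> cell_basis Y (Suc i)" and m: "m \<in> keys (lookup (cell_bd i b :: _ \<Rightarrow>\<^sub>0 ('n, 'k::field) mpol) b')"
  shows "m + cell_deg Y b' = cell_deg Y b" "1 \<le> total m"
proof -
  have b': "b' \<in> cell_basis Y i" using m by (auto simp: lookup_cell_bd split: if_splits)
  have "m = cell_deg Y b - cell_deg Y b' \<and> aug_inc Y b b' \<noteq> 0"
    using m b' by (auto simp: lookup_cell_bd split: if_splits)
  then have meq: "m = cell_deg Y b - cell_deg Y b'" and nz: "aug_inc Y b b' \<noteq> 0" by auto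
  obtain c where c: "b = Some c" "c \<in> crit i" using b by (auto simp: cell_basis_Suc simp del: cell_basis.simps(2))
  have "m + cell_deg Y b' = cell_deg Y b \<and> 1 \<le> total m"
  proof (cases i)
    case 0
    then have "cell_deg Y b' = 0" using b' by (simp add: cell_deg_def)
    then show ?thesis using meq c total_deg[OF c(2)] d by (simp add: cell_deg_Some)
  next
    case (Suc i')
    then obtain c' where c': "b' = Some c'" "c' \<in> crit i'"
      using b' by (auto simp: cell_basis_Suc simp del: cell_basis.simps(2))
    have c1: "c \<in> crit (Suc i')" using c(2) Suc by simp
    obtain a K where aK: "c = (a, K)" "card K = Suc (Suc i')" "Suc (total a) = d" "lead a K"
      using crit_pos[OF c1] .
    have "morse_incidence (hypersimplicial d) ori (hyper_matching d) (a, K) c' \<noteq> 0"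
      using nz by (simp add: c(1) c'(1) aug_inc_def morse_complex_def aK(1))
    then obtain j where "mdeg (hypersimplicial d) c = single j 1 + mdeg (hypersimplicial d) c'"
      using incidence_coefficient(2)[OF c1[unfolded aK(1)] aK(2-4) c'(2)] aK(1) by blast
    then show ?thesis by (simp add: meq c(1) c'(1) cell_deg_Some)
  qed
  then show "m + cell_deg Y b' = cell_deg Y b" "1 \<le> total m" by auto
qed

lemma to_L_cell_bd_Suc:
  assumes "c \<in> crit (Suc i)"
  shows "to_L ori (cell_bd (Suc i) (Some c)) = koszul_tensor_id xvar (to_L_basis ori (Some c) :: ('n, 'k::field) L_elt)"
proof -
  have "to_L ori (cell_bd (Suc i) (Some c)) = (\<Sum>c'\<in>crit i. fscale (single (mdeg (hypersimplicial d) c - mdeg (hypersimplicial d) c')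
      (of_int (morse_incidence (hypersimplicial d) ori (hyper_matching d) c c'))) (to_L_basis ori (Some c') :: ('n, 'k) L_elt))"
    unfolding cell_bd_def to_L_def lin_ext_sum lin_ext_single cell_basis_Suc
    by (subst sum.reindex) (simp_all add: cell_deg_Some aug_inc_def, simp add: morse_complex_def)
  then show ?thesis
    unfolding koszul_eq_coef_diff to_L_morse_boundary[OF assms] .
qed

lemma crit_0:
  assumes "c \<in> crit 0"
  obtains v where "c = (v, {})" "total v = d" "mdeg (hypersimplicial d) c = v"
proof -
  obtain a K where p: "pair_of c = (a, K)" by (cases "pair_of c")
  note cp = critical_props[OF assms d p]
  have "card K = 1" using cp(1) by simp
  then obtain k where "K = {k}" by (rule card_1_singletonE)
  then have "c = (a + single k 1, {})" using cp(4) by simp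
  then show ?thesis using that cp(2) by (simp add: total_plus mdeg_hypersimplicial)
qed

lemma vertex_critical:
  assumes "total v = d" shows "(v, {}) \<in> crit 0"
proof -
  have "v \<noteq> 0" using assms d by auto
  then obtain i where i: "i \<in> keys v" by fastforce
  let ?k = "Min (keys v)"
  have k: "?k \<in> keys v" using i by (intro Min_in) auto
  have "cell_of (v - single ?k 1) {?k} \<in> crit 0"
    by (rule cell_of_critical) (use assms total_diff_single[OF k] keys_diff_single_subset[of v "single ?k 1"] in
      \<open>auto simp: lead_def intro!: Min_le\<close>)
  then show ?thesis unfolding cell_of_singleton diff_single_add[OF k] .
qed

text \<open>A vertex has sign 1, and \<open>symm_diff\<close> returns its split-off index to the
  exponent, so the augmentation with its incidences 1 matches without correction.\<close>

lemma to_L_basis_vertex: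
  assumes "v \<noteq> 0" shows "to_L_basis ori (Some (v, {})) = (basis_elt {} v :: ('n, 'k::field) L_elt)"
proof -
  have k: "Min (keys v) \<in> keys v" using assms by simp
  show ?thesis
    by (simp add: to_L_basis_def cell_sign_def cell_gen_def pair_of_def symm_diff_singleton diff_single_add[OF k])
qed

lemma to_L_cell_bd_0:
  assumes "c \<in> crit 0"
  shows "to_L ori (cell_bd 0 (Some c)) = sym_power_map xvar (to_L_basis ori (Some c) :: ('n, 'k::field) L_elt)"
proof -
  obtain v where v: "c = (v, {})" "total v = d" "mdeg (hypersimplicial d) c = v" using crit_0[OF assms] .
  have "v \<noteq> 0" using v(2) d by auto
  have "cell_bd 0 (Some c) = (single None (single v 1) :: _ \<Rightarrow>\<^sub>0 ('n, 'k) mpol)"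
    unfolding cell_bd_def by (simp add: cell_deg_Some v(3) aug_inc_def) (simp add: cell_deg_def)
  then have "to_L ori (cell_bd 0 (Some c)) = (single None (single v 1) :: _ \<Rightarrow>\<^sub>0 ('n, 'k) mpol)"
    by (simp add: to_L_def to_L_basis_def)
  moreover have "sym_power_map xvar (to_L_basis ori (Some c)) = (single None (single v 1) :: _ \<Rightarrow>\<^sub>0 ('n, 'k) mpol)"
    unfolding v(1) to_L_basis_vertex[OF \<open>v \<noteq> 0\<close>] sym_eval_def[symmetric] by (simp add: sym_eval_single)
  ultimately show ?thesis by simp
qed

lemma to_L_chain_map:
  assumes f: "f \<in> free_on (cell_basis Y (Suc i))"
  shows "to_L ori (lin_ext (cell_bd i) f) = (chain_diff (L_complex xvar d) (Suc i) (to_L ori f) :: ('n, 'k::field) L_elt)"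
proof -
  let ?D = "chain_diff (L_complex xvar d) (Suc i) :: (('n, 'k) L_elt) \<Rightarrow> _"
  have D: "?D = (if i = 0 then sym_power_map xvar else koszul_tensor_id xvar)"
    by (simp add: L_complex_def)
  have lin: "?D (lin_ext g h) = lin_ext (\<lambda>b. ?D (g b)) h" for g :: "'n hcell option \<Rightarrow> _" and h
    unfolding D by (auto simp: sym_power_map_def koszul_tensor_id_def lin_ext_lin_ext)
  have "lin_ext (\<lambda>b. to_L ori (cell_bd i b)) f = lin_ext (\<lambda>b. ?D (to_L_basis ori b)) f"
  proof (rule lin_ext_cong)
    fix b assume "b \<in> keys f"
    then obtain c where "b = Some c" "c \<in> crit i"
      using f by (auto simp: mem_free_on cell_basis_Suc simp del: cell_basis.simps(2))
    then show "to_L ori (cell_bd i b) = ?D (to_L_basis ori b)"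
      unfolding D by (cases i) (simp_all add: to_L_cell_bd_0 to_L_cell_bd_Suc)
  qed
  then show ?thesis
    unfolding lin[symmetric] by (simp only: to_L_def lin_ext_lin_ext)
qed

section \<open>Bijectivity of the comparison map\<close>

definition lead_to_cell :: "(('n, 'k::field) L_elt) \<Rightarrow> ('n, 'k) cell_elt"
  where "lead_to_cell = lin_ext (\<lambda>b. case b of None \<Rightarrow> 0
    | Some (K, a) \<Rightarrow> single (Some (cell_of a K)) (of_int (cs (cell_of a K))))"

definition cell_to_lead :: "(('n, 'k::field) cell_elt) \<Rightarrow> ('n, 'k) L_elt"
  where "cell_to_lead = lin_ext (\<lambda>b. case b of None \<Rightarrow> 0 | Some c \<Rightarrow> fscale (of_int (cs c)) (cell_gen c))"

lemma cs_sq: "c \<in> crit i \<Longrightarrow> of_int (cs c) * of_int (cs c) = (1 :: ('n, 'k::field) mpol)"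
  using cell_sign_sq[OF ori, of c] by (simp add: critical_def flip: of_int_mult)

text \<open>Factors the comparison map into a signed relabelling of bases and
  \<open>symm_diff\<close>, which are inverted separately.\<close>

lemma to_L_cell_to_lead:
  assumes "f \<in> free_on (cell_basis Y (Suc i))"
  shows "to_L ori f = symm_diff (cell_to_lead f)"
proof -
  have "to_L ori f = lin_ext (\<lambda>b. symm_diff (case b of None \<Rightarrow> 0 | Some c \<Rightarrow> fscale (of_int (cs c)) (cell_gen c))) f"
    unfolding to_L_def
    by (rule lin_ext_cong) (use assms in \<open>auto simp: mem_free_on cell_basis_Suc to_L_basis_def symm_diff_fscale simp del: cell_basis.simps(2)\<close>)
  then show ?thesis by (simp only: cell_to_lead_def symm_diff_def lin_ext_lin_ext)
qed

lemma cell_to_lead_in: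
  assumes "f \<in> free_on (cell_basis Y (Suc i))"
  shows "cell_to_lead f \<in> free_on (lead_basis i d)"
  unfolding cell_to_lead_def
proof (rule lin_ext_in_free_on[OF assms], unfold cell_basis_Suc, elim imageE)
  fix b c assume b: "b = Some c" and c: "c \<in> crit i"
  obtain a K where p: "pair_of c = (a, K)" by (cases "pair_of c")
  have "Some (K, a) \<in> lead_basis i d" using critical_props[OF c d p] by (auto simp: lead_basis_def)
  then show "(case b of None \<Rightarrow> 0 | Some c \<Rightarrow> fscale (of_int (cs c)) (cell_gen c)) \<in> free_on (lead_basis i d)"
    by (simp add: b cell_gen_def p free_on_single)
qed

lemma lead_to_cell_in:
  assumes "f \<in> free_on (lead_basis i d)"
  shows "lead_to_cell f \<in> free_on (cell_basis Y (Suc i))"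
  unfolding lead_to_cell_def cell_basis_Suc
  by (rule lin_ext_in_free_on[OF assms])
    (auto simp: lead_basis_def intro!: free_on_single cell_of_critical)

lemma lead_to_cell_to_lead:
  fixes f :: "('n, 'k::field) cell_elt"
  assumes "f \<in> free_on (cell_basis Y (Suc i))"
  shows "lead_to_cell (cell_to_lead f) = f"
proof -
  have "lead_to_cell (cell_to_lead f) = lin_ext (\<lambda>b. single b 1) f"
    unfolding lead_to_cell_def cell_to_lead_def lin_ext_lin_ext
  proof (rule lin_ext_cong)
    fix b assume "b \<in> keys f"
    then obtain c where b: "b = Some c" "c \<in> crit i"
      using assms by (auto simp: mem_free_on cell_basis_Suc simp del: cell_basis.simps(2))
    obtain a K where p: "pair_of c = (a, K)" by (cases "pair_of c")
    have sq: "of_int (cs c) * of_int (cs c) = (1 :: ('n, 'k) mpol)" by (rule cs_sq[OF b(2)])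
    show "lin_ext (\<lambda>b. case b of None \<Rightarrow> 0 | Some (K, a) \<Rightarrow> single (Some (cell_of a K)) (of_int (cs (cell_of a K))))
        (case b of None \<Rightarrow> 0 | Some c \<Rightarrow> fscale (of_int (cs c)) (cell_gen c)) =
        (single b 1 :: ('n, 'k) cell_elt)"
      using critical_props(4)[OF b(2) d p] by (simp add: b(1) cell_gen_def p sq)
  qed
  then show ?thesis by (simp add: lin_ext_basis)
qed

lemma cell_to_lead_to_cell:
  fixes f :: "('n, 'k::field) L_elt"
  assumes "f \<in> free_on (lead_basis i d)"
  shows "cell_to_lead (lead_to_cell f) = f"
proof -
  have "cell_to_lead (lead_to_cell f) = lin_ext (\<lambda>b. single b 1) f"
    unfolding lead_to_cell_def cell_to_lead_def lin_ext_lin_ext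
  proof (rule lin_ext_cong)
    fix b assume "b \<in> keys f"
    then obtain K a where b: "b = Some (K, a)" "card K = Suc i" "Suc (total a) = d" "lead a K"
      using assms by (auto simp: mem_free_on lead_basis_def)
    have "K \<noteq> {}" using b(2) by auto
    then have "pair_of (cell_of a K) = (a, K)" using b(4) by (rule pair_of_cell_of[rotated])
    moreover have "of_int (cs (cell_of a K)) * of_int (cs (cell_of a K)) = (1 :: ('n, 'k) mpol)"
      by (rule cs_sq[OF cell_of_critical[OF b(2-4)]])
    ultimately show "lin_ext (\<lambda>b. case b of None \<Rightarrow> 0 | Some c \<Rightarrow> fscale (of_int (cs c)) (cell_gen c))
      (case b of None \<Rightarrow> 0 | Some (K, a) \<Rightarrow> single (Some (cell_of a K)) (of_int (cs (cell_of a K)))) =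
        (single b 1 :: ('n, 'k) L_elt)"
      by (simp add: b(1) cell_gen_def)
  qed
  then show ?thesis by (simp add: lin_ext_basis)
qed

text \<open>\<open>symm_htpy\<close> vanishes on the leading span, so one summand of the contraction
  identity disappears.\<close>

lemma symm_htpy_symm_diff_lead:
  assumes w: "w \<in> free_on (lead_basis i d)"
  shows "symm_htpy (symm_diff w) = w"
proof -
  obtain e where e: "d = Suc e" using d by (cases d) auto
  have "w \<in> wedge_sym (Suc i) e" using w unfolding e by (rule lead_basis_wedge)
  then show ?thesis
    using symm_contraction[of w "Suc i" e] symm_htpy_lead_zero[OF w]
    by (simp add: symm_diff_zero)
qed

lemma to_L_bij:
  "bij_betw (to_L ori) (free_on (cell_basis Y (Suc i))) (L_module i d :: (('n, 'k::field) L_elt) set)"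
proof (rule bij_betw_byWitness[where f' = "\<lambda>z. lead_to_cell (symm_htpy z)"])
  show "\<forall>f\<in>free_on (cell_basis Y (Suc i)). lead_to_cell (symm_htpy (to_L ori f)) = f"
    using to_L_cell_to_lead cell_to_lead_in symm_htpy_symm_diff_lead lead_to_cell_to_lead by metis
  have htpy: "symm_htpy z \<in> free_on (lead_basis i d)" if "z \<in> L_module i d" for z :: "('n, 'k) L_elt"
    using that by (intro symm_htpy_lead) (simp add: L_module_eq)
  show "\<forall>z\<in>L_module i d. to_L ori (lead_to_cell (symm_htpy z)) = (z :: ('n, 'k) L_elt)"
  proof
    fix z :: "('n, 'k) L_elt" assume z: "z \<in> L_module i d"
    show "to_L ori (lead_to_cell (symm_htpy z)) = z"
      unfolding to_L_cell_to_lead[OF lead_to_cell_in[OF htpy[OF z]]] cell_to_lead_to_cell[OF htpy[OF z]]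
      by (rule symm_diff_htpy_L[OF z]) (use d in simp)
  qed
  show "to_L ori ` free_on (cell_basis Y (Suc i)) \<subseteq> (L_module i d :: (('n, 'k) L_elt) set)"
  proof safe
    fix f :: "('n, 'k) cell_elt" assume f: "f \<in> free_on (cell_basis Y (Suc i))"
    obtain e where e: "d = Suc e" using d by (cases d) auto
    have "cell_to_lead f \<in> wedge_sym (Suc i) e" using cell_to_lead_in[OF f] unfolding e by (rule lead_basis_wedge)
    then have "symm_diff (cell_to_lead f) \<in> wedge_sym i d" unfolding e by (rule symm_diff_wedge)
    then show "to_L ori f \<in> L_module i d"
      unfolding to_L_cell_to_lead[OF f] by (simp add: L_module_eq symm_diff_symm_diff)
  qed
  show "(\<lambda>z. lead_to_cell (symm_htpy z)) ` (L_module i d :: (('n, 'k) L_elt) set) \<subseteq> free_on (cell_basis Y (Suc i))"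
    using htpy lead_to_cell_in by blast
qed

lemma chain_mod_L_0: "chain_mod (L_complex xvar d) 0 = free_on {None}"
  by (simp add: L_complex_def)

text \<open>\<open>L_complex\<close> is cut off beyond \<open>CARD('n)\<close>. For i =
  \<open>CARD('n)\<close> the exterior power is still nonzero, but the kernel is the
  \<open>symm_diff\<close> image of leading pairs whose set has i + 1 elements, and there are
  none.\<close>

lemma chain_mod_L_Suc:
  "chain_mod (L_complex xvar d) (Suc i) = (L_module i d :: (('n, 'k::field) L_elt) set)"
proof (cases "Suc i \<le> CARD('n)")
  case False
  have "z = 0" if z: "z \<in> L_module i d" for z :: "('n, 'k) L_elt"
  proof -
    have "card (J :: 'n set) \<noteq> Suc i" for J
      using card_mono[of UNIV J] False by auto
    then have "lead_basis i d = ({} :: 'n lbasis set)" by (auto simp: lead_basis_def)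
    moreover have "symm_htpy z \<in> free_on (lead_basis i d)"
      using z by (intro symm_htpy_lead) (simp add: L_module_eq)
    ultimately have "symm_htpy z = 0" by (simp add: mem_free_on)
    then show ?thesis
      using symm_diff_htpy_L[OF z] d by (simp add: symm_diff_zero)
  qed
  moreover have "(0 :: ('n, 'k) L_elt) \<in> L_module i d"
    by (simp add: L_module_eq wedge_sym_def symm_diff_zero)
  ultimately show ?thesis using False by (auto simp: L_complex_def)
qed (simp add: L_complex_def)

lemma to_L_bij_0: "bij_betw (to_L ori) (free_on {None}) (free_on {None} :: (('n, 'k::field) L_elt) set)"
proof -
  have *: "f = single None (lookup f None)" if "f \<in> free_on {None}" for f :: "'c option \<Rightarrow>\<^sub>0 ('n, 'k) mpol"
    using that by (rule free_on_None)
  have to_L: "to_L ori (single None r) = (single None r :: ('n, 'k) L_elt)" for r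
    by (simp add: to_L_def to_L_basis_def)
  show ?thesis
  proof (rule bij_betw_byWitness[where f' = "\<lambda>z. single None (lookup z None)"])
    show "\<forall>f\<in>free_on {None}. single None (lookup (to_L ori f :: ('n, 'k) L_elt) None) = f"
      using * to_L by (metis lookup_single_eq)
    show "\<forall>z\<in>free_on {None}. to_L ori (single None (lookup z None)) = (z :: ('n, 'k) L_elt)"
      using * to_L by metis
    show "to_L ori ` free_on {None} \<subseteq> (free_on {None} :: (('n, 'k) L_elt) set)"
    proof safe
      fix f :: "('n, 'k) cell_elt" assume "f \<in> free_on {None}"
      then have "f = single None (lookup f None)" by (rule *)
      then have "to_L ori f = single None (lookup f None)" using to_L by metis
      then show "to_L ori f \<in> free_on {None}" by (simp add: free_on_single)
    qed
  qed (auto intro: free_on_single)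
qed

lemma to_L_bij_chain:
  "bij_betw (to_L ori) (chain_mod (cellular_complex Y) i) (chain_mod (L_complex xvar d) i :: (('n, 'k::field) L_elt) set)"
  unfolding chain_mod_cellular
  by (cases i) (simp_all only: chain_mod_L_0 chain_mod_L_Suc cell_basis.simps(1) to_L_bij to_L_bij_0)

lemma chain_iso_L:
  "chain_iso (cellular_complex Y :: (('n, 'k::field) cell_elt) chain) (L_complex xvar d)"
  unfolding chain_iso_def
proof (intro exI[of _ "\<lambda>_. to_L ori"] conjI allI ballI)
  fix i
  show bij: "bij_betw (to_L ori) (chain_mod (cellular_complex Y) i) (chain_mod (L_complex xvar d) i :: (('n, 'k) L_elt) set)"
    by (rule to_L_bij_chain)
  show "linear_between fscale fscale (chain_mod (cellular_complex Y) i) (chain_mod (L_complex xvar d) i) (to_L ori :: _ \<Rightarrow> ('n, 'k) L_elt)"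
    unfolding linear_between_def
    using bij_betw_imp_surj_on[OF bij] by (simp add: to_L_def lin_ext_add lin_ext_fscale)
  fix f :: "('n, 'k) cell_elt" assume "f \<in> chain_mod (cellular_complex Y) (Suc i)"
  then show "to_L ori (chain_diff (cellular_complex Y) (Suc i) f) = chain_diff (L_complex xvar d) (Suc i) (to_L ori f)"
    unfolding chain_diff_cellular chain_mod_cellular by (rule to_L_chain_map)
qed

section \<open>Grading, minimality and exactness of the cellular complex\<close>

lemma multigraded_cellular:
  "multigraded_free (cellular_complex Y :: (('n, 'k::field) cell_elt) chain) (cell_basis Y) (cell_deg Y)"
  unfolding multigraded_free_def chain_diff_cellular chain_mod_cellular
  by (auto simp: keys_cell_bd(1) simp del: cell_basis.simps(2))

lemma linear_cellular:
  "linear_complex (cellular_complex Y :: (('n, 'k::field) cell_elt) chain) (cell_basis Y) (cell_deg Y) d"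
  unfolding linear_complex_def
proof (intro conjI allI ballI)
  fix i b assume "b \<in> cell_basis Y (Suc i)"
  then show "total (cell_deg Y b) = d + i"
    unfolding cell_basis_Suc by (auto simp: cell_deg_Some total_deg)
qed (rule multigraded_cellular)

lemma minimal_cellular:
  "minimal_complex (cellular_complex Y :: (('n, 'k::field) cell_elt) chain)"
  unfolding minimal_complex_def chain_diff_cellular chain_mod_cellular
proof (intro allI subsetI, elim imageE)
  fix i g and f :: "('n, 'k) cell_elt"
  assume g: "g = lin_ext (cell_bd i) f" and f: "f \<in> free_on (cell_basis Y (Suc i))"
  show "g \<in> ideal_times_module max_ideal (free_on (cell_basis Y i))"
    unfolding g
  proof (rule ideal_times_module_free_on)
    show "lin_ext (cell_bd i) f \<in> free_on (cell_basis Y i)"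
      by (rule lin_ext_in_free_on[OF f cell_bd_in])
    fix b'
    have sub: "rmod.subspace (max_ideal :: ('n, 'k) mpol set)" by (simp add: max_ideal_def)
    have "lookup f b * lookup (cell_bd i b) b' \<in> (max_ideal :: ('n, 'k) mpol set)" if "b \<in> keys f" for b
    proof (rule rmod.subspace_scale[OF sub])
      have "b \<in> cell_basis Y (Suc i)" using that f by (auto simp: mem_free_on simp del: cell_basis.simps(2))
      then show "lookup (cell_bd i b) b' \<in> (max_ideal :: ('n, 'k) mpol set)"
        unfolding max_ideal_eq order_ge_def using keys_cell_bd(2) by blast
    qed
    then show "lookup (lin_ext (cell_bd i) f) b' \<in> max_ideal"
      unfolding lin_ext_def lookup_sum lookup_fscale by (intro rmod.subspace_sum[OF sub])
  qed
qed

lemma to_L_eq_0_iff: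
  assumes "f \<in> chain_mod (cellular_complex Y) i"
  shows "(to_L ori f :: ('n, 'k::field) L_elt) = 0 \<longleftrightarrow> f = 0"
proof -
  have "0 \<in> chain_mod (cellular_complex Y) i" "to_L ori 0 = (0 :: ('n, 'k) L_elt)"
    by (simp_all add: chain_mod_cellular to_L_def)
  then show ?thesis using bij_betw_imp_inj_on[OF to_L_bij_chain[of i]] assms by (metis inj_onD)
qed

text \<open>Both inclusions are transported along the injective chain map \<open>to_L\<close>:
  boundaries are cycles because \<open>coef_diff\<close> squares to zero and evaluation kills its
  image on the kernel, and cycles are boundaries by \<open>L_exact\<close>.\<close>

lemma exact_cellular:
  "lin_ext (cell_bd (Suc i)) ` free_on (cell_basis Y (Suc (Suc i))) =
    {f \<in> free_on (cell_basis Y (Suc i)). lin_ext (cell_bd i) f = (0 :: _ \<Rightarrow>\<^sub>0 ('n, 'k::field) mpol)}"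
proof (intro equalityI subsetI)
  fix g :: "('n, 'k) cell_elt" assume "g \<in> lin_ext (cell_bd (Suc i)) ` free_on (cell_basis Y (Suc (Suc i)))"
  then obtain h where h: "h \<in> free_on (cell_basis Y (Suc (Suc i)))" and g: "g = lin_ext (cell_bd (Suc i)) h" by blast
  have gin: "g \<in> free_on (cell_basis Y (Suc i))" unfolding g by (rule lin_ext_in_free_on[OF h cell_bd_in])
  have hL: "to_L ori h \<in> (L_module (Suc i) d :: (('n, 'k) L_elt) set)"
    using bij_betw_imp_surj_on[OF to_L_bij[of "Suc i"]] h by blast
  have tg: "to_L ori g = - coef_diff (to_L ori h)"
    unfolding g to_L_chain_map[OF h] by (simp add: L_complex_def koszul_eq_coef_diff)
  have "to_L ori (lin_ext (cell_bd i) g) = (0 :: ('n, 'k) L_elt)"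
  proof (cases "i = 0")
    case True
    then have "sym_eval (coef_diff (to_L ori h)) = 0" using hL sym_eval_coef_diff_L by auto
    then show ?thesis
      unfolding to_L_chain_map[OF gin] tg using True
      by (simp add: L_complex_def sym_eval_minus flip: sym_eval_def)
  next
    case False
    then show ?thesis
      unfolding to_L_chain_map[OF gin] tg
      by (simp add: L_complex_def koszul_eq_coef_diff coef_diff_minus coef_diff_coef_diff)
  qed
  then have "lin_ext (cell_bd i) g = 0"
    using to_L_eq_0_iff[of "lin_ext (cell_bd i) g" i] lin_ext_in_free_on[OF gin cell_bd_in] by (simp add: chain_mod_cellular)
  then show "g \<in> {f \<in> free_on (cell_basis Y (Suc i)). lin_ext (cell_bd i) f = 0}" using gin by blast
next
  fix f :: "('n, 'k) cell_elt" assume "f \<in> {f \<in> free_on (cell_basis Y (Suc i)). lin_ext (cell_bd i) f = 0}"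
  then have f: "f \<in> free_on (cell_basis Y (Suc i))" and 0: "lin_ext (cell_bd i) f = 0" by auto
  have fL: "to_L ori f \<in> (L_module i d :: (('n, 'k) L_elt) set)"
    using bij_betw_imp_surj_on[OF to_L_bij[of i]] f by blast
  have "chain_diff (L_complex xvar d) (Suc i) (to_L ori f) = (0 :: ('n, 'k) L_elt)"
    unfolding to_L_chain_map[OF f, symmetric] 0 by (simp add: to_L_def)
  then have "if i = 0 then sym_eval (to_L ori f) = 0 else coef_diff (to_L ori f) = (0 :: ('n, 'k) L_elt)"
    by (simp add: L_complex_def koszul_eq_coef_diff sym_eval_def split: if_splits)
  from L_exact[OF fL this] obtain t where t: "t \<in> L_module (Suc i) d" "coef_diff t = to_L ori f" by blast
  \<comment> \<open>The Koszul map is the negative of \<open>coef_diff\<close>, so the preimage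
    changes sign.\<close>
  have "- t \<in> to_L ori ` free_on (cell_basis Y (Suc (Suc i)))"
    unfolding bij_betw_imp_surj_on[OF to_L_bij] by (rule L_module_uminus[OF t(1)])
  then obtain h where h: "h \<in> free_on (cell_basis Y (Suc (Suc i)))" "to_L ori h = - t" by force
  have "to_L ori (lin_ext (cell_bd (Suc i)) h) = to_L ori f"
    unfolding to_L_chain_map[OF h(1)] h(2)
    by (simp add: L_complex_def koszul_eq_coef_diff coef_diff_minus t(2))
  then have "lin_ext (cell_bd (Suc i)) h = f"
    by (rule inj_onD[OF bij_betw_imp_inj_on[OF to_L_bij]]) (rule lin_ext_in_free_on[OF h(1) cell_bd_in], rule f)
  then show "f \<in> lin_ext (cell_bd (Suc i)) ` free_on (cell_basis Y (Suc (Suc i)))" using h(1) by blast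
qed

text \<open>Each monomial of degree at least d is a multiple of one of degree d, and the latter is
  the boundary of a vertex.\<close>

lemma image_cell_bd_0:
  "lin_ext (cell_bd 0) ` free_on (cell_basis Y (Suc 0)) =
    {f \<in> free_on (cell_basis Y 0). lookup f None \<in> (order_ge d :: ('n, 'k::field) mpol set)}"
proof (intro equalityI subsetI)
  fix g :: "('n, 'k) cell_elt" assume "g \<in> lin_ext (cell_bd 0) ` free_on (cell_basis Y (Suc 0))"
  then obtain f where f: "f \<in> free_on (cell_basis Y (Suc 0))" and g: "g = lin_ext (cell_bd 0) f" by blast
  have gin: "g \<in> free_on (cell_basis Y 0)" unfolding g by (rule lin_ext_in_free_on[OF f cell_bd_in])
  have "lookup f b * lookup (cell_bd 0 b) None \<in> (order_ge d :: ('n, 'k) mpol set)" if bk: "b \<in> keys f" for b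
  proof (rule rmod.subspace_scale[OF subspace_order_ge])
    obtain c where "b = Some c" "c \<in> crit 0"
      using bk f by (auto simp: mem_free_on cell_basis_Suc simp del: cell_basis.simps(2))
    then show "lookup (cell_bd 0 b) None \<in> (order_ge d :: ('n, 'k) mpol set)"
      using total_deg by (simp add: lookup_cell_bd order_ge_single cell_deg_Some) (simp add: cell_deg_def)
  qed
  then have "lookup g None \<in> order_ge d"
    unfolding g lin_ext_def lookup_sum lookup_fscale by (intro rmod.subspace_sum[OF subspace_order_ge])
  then show "g \<in> {f \<in> free_on (cell_basis Y 0). lookup f None \<in> order_ge d}"
    using gin by blast
next
  fix g :: "('n, 'k) cell_elt" assume "g \<in> {f \<in> free_on (cell_basis Y 0). lookup f None \<in> order_ge d}"
  then have g0: "g \<in> free_on {None}" and p: "lookup g None \<in> order_ge d" by auto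
  define p where "p = lookup g None"
  have "\<forall>u\<in>keys p. \<exists>v. total v = d \<and> (\<exists>w. u = v + w)"
  proof
    fix u assume "u \<in> keys p"
    then have "d \<le> total u" using p unfolding p_def order_ge_def by blast
    from exists_divisor_of_total[OF this] show "\<exists>v. total v = d \<and> (\<exists>w. u = v + w)" by blast
  qed
  from bchoice[OF this] obtain v where v: "\<And>u. u \<in> keys p \<Longrightarrow> total (v u) = d" "\<And>u. u \<in> keys p \<Longrightarrow> \<exists>w. u = v u + w" by blast
  define f :: "('n, 'k) cell_elt"
    where "f = (\<Sum>u\<in>keys p. single (Some (v u, {})) (single (u - v u) (lookup p u)))"
  have "f \<in> free_on (cell_basis Y (Suc 0))"
    unfolding f_def cell_basis_Suc using v vertex_critical by (intro free_on_sum free_on_single) blast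
  moreover have "lin_ext (cell_bd 0) f = g"
  proof -
    have "lin_ext (cell_bd 0) f = (\<Sum>u\<in>keys p. fscale (single (u - v u) (lookup p u)) (cell_bd 0 (Some (v u, {}))))"
      by (simp add: f_def lin_ext_sum)
    also have "\<dots> = (\<Sum>u\<in>keys p. single None (single u (lookup p u)))"
    proof (intro sum.cong refl)
      fix u assume u: "u \<in> keys p"
      have "cell_bd 0 (Some (v u, {})) = (single None (single (v u) 1) :: _ \<Rightarrow>\<^sub>0 ('n, 'k) mpol)"
        unfolding cell_bd_def by (simp add: cell_deg_Some mdeg_hypersimplicial aug_inc_def) (simp add: cell_deg_def)
      moreover obtain w where "u = v u + w" using v(2)[OF u] by blast
      then have "u - v u + v u = u" by (metis add.commute add_diff_cancel_left')
      ultimately show "fscale (single (u - v u) (lookup p u)) (cell_bd 0 (Some (v u, {}))) = single None (single u (lookup p u))"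
        by (simp add: mult_single)
    qed
    also have "\<dots> = single None p"
      by (simp only: additive_sum[OF additive_single, symmetric] poly_mapping_sum_single[symmetric])
    also have "\<dots> = g"
      unfolding p_def using free_on_None[OF g0] by (rule sym)
    finally show ?thesis .
  qed
  ultimately show "g \<in> lin_ext (cell_bd 0) ` free_on (cell_basis Y (Suc 0))" by blast
qed

lemma free_resolution_cellular:
  "free_resolution (cellular_complex Y) (\<lambda>f. lookup f None) (order_ge d :: ('n, 'k::field) mpol set)"
  unfolding free_resolution_def chain_diff_cellular chain_mod_cellular
proof (intro conjI allI)
  show "lin_ext (cell_bd (Suc i)) ` free_on (cell_basis Y (Suc (Suc i))) =
    {f \<in> free_on (cell_basis Y (Suc i)). lin_ext (cell_bd i) f = (0 :: _ \<Rightarrow>\<^sub>0 ('n, 'k) mpol)}" for i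
    by (rule exact_cellular)
  show "lin_ext (cell_bd 0) ` free_on (cell_basis Y (Suc 0)) =
    {f \<in> free_on (cell_basis Y 0). lookup f None \<in> (order_ge d :: ('n, 'k) mpol set)}"
    by (rule image_cell_bd_0)
  show "linear_between fscale (*) (free_on (cell_basis Y 0)) UNIV (\<lambda>f. lookup f None :: ('n, 'k) mpol)"
    by (simp add: linear_between_def lookup_add)
  fix s :: "('n, 'k) mpol"
  show "\<exists>f\<in>free_on (cell_basis Y 0). s - lookup f None \<in> order_ge d"
    by (rule bexI[of _ "single None s"]) (simp_all add: free_on_single order_ge_def)
qed (simp_all only: is_free_free_on linear_between_lin_ext cell_bd_in)

lemma vertices_min_gens:
  "bij_betw (cw_mdeg Y) (cw_cells Y 0) (min_gens (order_ge d :: ('n, 'k::field) mpol set))"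
  unfolding min_gens_order_ge
proof (rule bij_betw_byWitness[where f' = "\<lambda>v. (v, {})"])
  show "\<forall>c\<in>cw_cells Y 0. (cw_mdeg Y c, {}) = c"
    by (auto simp: morse_complex_def elim: crit_0)
  show "\<forall>v\<in>{u. total u = d}. cw_mdeg Y (v, {}) = v"
    by (simp add: morse_complex_def mdeg_hypersimplicial)
  show "cw_mdeg Y ` cw_cells Y 0 \<subseteq> {u. total u = d}"
    by (auto simp: morse_complex_def total_deg)
  show "(\<lambda>v. (v, {})) ` {u. total u = d} \<subseteq> cw_cells Y 0"
    by (intro image_subsetI) (simp add: morse_complex_def vertex_critical)
qed

lemma supports_cellular_resolution_morse:
  "supports_cellular_resolution Y (ideal_power (max_ideal :: ('n, 'k::field) mpol set) d)"
  unfolding supports_cellular_resolution_def ideal_power_max_ideal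
  by (intro conjI vertices_min_gens multigraded_cellular free_resolution_cellular)

end

theorem proposition4p11:
  fixes d :: nat
    and ori :: "'n::{finite,linorder} hcell \<Rightarrow> (real ^ 'n::{finite,linorder}) list"
    and H :: "('n hcell, real ^ 'n::{finite,linorder}, 'n) polycomplex"
    and A :: "('n hcell \<times> 'n hcell) set"
    and Y :: "('n hcell, 'n) cw_data"
    and FY :: "('n hcell option \<Rightarrow>\<^sub>0 ('n, 'k::field) mpol) chain"
  assumes "d \<ge> 1"
    and "H = hypersimplicial d"
    and "oriented H ori"
    and "A = hyper_matching d"
    and "Y = morse_complex H ori A"
    and "FY = cellular_complex Y"
  shows "acyclic_matching H A \<and> homogeneous_matching H A \<and>
    supports_cellular_resolution Y (ideal_power (max_ideal :: ('n, 'k) mpol set) d) \<and>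
    minimal_complex FY \<and>
    linear_complex FY (cell_basis Y) (cell_deg Y) d \<and>
    chain_iso FY (L_complex xvar d)"
proof -
  have ori: "oriented (hypersimplicial d) ori" using assms(2,3) by simp
  show ?thesis
    unfolding assms(6) unfolding assms(5) unfolding assms(2,4)
    by (intro conjI acyclic_hyper_matching homogeneous_hyper_matching
        supports_cellular_resolution_morse[OF assms(1) ori] minimal_cellular[OF assms(1) ori]
        linear_cellular[OF assms(1) ori] chain_iso_L[OF assms(1) ori])
qed

end
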